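(* Let $G$ be a plane elementary bipartite graph whose infinite face is forcing. Then the following hold. (i) Let $S$ be a resonant set of $G$. Then $S$ is maximal if and only if $S$ is canonical. (ii) Suppose $G$ is different from $K_2$. Let $\mathcal{H}(R(G))$ be the set of nontrivial hypercubes of the resonance graph $R(G)$, let $\mathcal{RS}(G)$ be the set of nonempty resonant sets of $G$, and let $f:\mathcal{H}(R(G))\to\mathcal{RS}(G)$ be the map sending a hypercube $Q$ of $R(G)$ to the set of face-labels of the $\Theta$-classes of $Q$. Then $f$ induces a bijection between the set of maximal hypercubes of $R(G)$ and the set of maximal resonant sets of $G$, which maps a maximal hypercube $Q$ of $R(G)$ to a maximal resonant set $S$ of $G$ such that $S$ is the set of face-labels of the $\Theta$-classes of $Q$.
   Context: All graphs are finite. An edge of a graph with a perfect matching is allowed if it lies in some perfect matching. A graph (with a perfect matching) is elementary if all its allowed edges form a connected subgraph; a bipartite graph is elementary if and only if it is connected and every edge is allowed. A face of a plane graph $G$ is forcing if the induced subgraph of $G$ obtained by deleting all vertices of that face (on its periphery) is either empty or has a unique perfect matching. The infinite face is the unbounded face; the other faces are finite. A cycle is $M$-alternating if its edges are alternately in and out of the perfect matching $M$. A face is $M$-resonant if its periphery is an $M$-alternating cycle. A resonant set of $G$ is a set $S$ of pairwise vertex disjoint finite faces of $G$ such that there is a perfect matching $M$ of $G$ for which each face in $S$ is $M$-resonant. A resonant set is maximal if it is not contained in any other resonant set of $G$. $G-S$ denotes the induced subgraph of $G$ obtained by removing all vertices of the faces in $S$. A resonant set $S$ is canonical if $G-S$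 is empty or has a unique perfect matching. Resonance graph: the vertices of $R(G)$ are the perfect matchings of $G$; two perfect matchings $M_1,M_2$ are adjacent if their symmetric difference is the edge set of exactly one cycle which is the periphery of a finite face $s$ of $G$; then the edge $M_1M_2$ has face-label $s$. The hypercube $Q_k$ is the Cartesian product of $k$ copies of $K_2$ ($Q_0$ is the one-vertex graph). A hypercube of $R(G)$ is a subgraph of $R(G)$ isomorphic to some $Q_k$; it is nontrivial if $k\ge 1$, and maximal if it is not contained in any other hypercube of $R(G)$. The $\Theta$-classes of a $k$-dimensional hypercube are its $k$ classes of parallel edges (the equivalence classes of the Djoković–Winkler relation: $x_1x_2\,\Theta\,y_1y_2$ iff $d(x_1,y_1)+d(x_2,y_2)\ne d(x_1,y_2)+d(x_2,y_1)$). For a hypercube $Q$ of $R(G)$ all edges of a $\Theta$-class of $Q$ have the same face-label, called the face-label of that $\Theta$-class; the set of face-labels of the $\Theta$-classes of a $k$-dimensional hypercube $Q$, $k\ge1$, is a resonant set of cardinality $k$. *)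

theory Defs
  imports "HOL-Analysis.Analysis"
begin

(* An edge is a set, and its ends are the vertices it contains.  Thus in an abstract simple graph
   an edge is a doubleton of vertices, while in a graph drawn in the plane an edge is an arc
   (a set of points) and parallel edges are possible. *)

record 'a graph =
  verts :: "'a set"
  edges :: "'a set set"

definition ends :: "'a graph \<Rightarrow> 'a set \<Rightarrow> 'a set" where
  "ends G e = e \<inter> verts G"

definition adj :: "'a graph \<Rightarrow> 'a rel" where
  "adj G = {(u, v). \<exists>e\<in>edges G. ends G e = {u, v}}"

definition connected_graph :: "'a graph \<Rightarrow> bool" where
  "connected_graph G \<longleftrightarrow> verts G \<noteq> {} \<and> (\<forall>u\<in>verts G. \<forall>v\<in>verts G. (u, v) \<in> (adj G)\<^sup>*)"

definition bipartite :: "'a graph \<Rightarrow> bool" where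
  "bipartite G \<longleftrightarrow> (\<exists>A B. A \<union> B = verts G \<and> A \<inter> B = {} \<and>
     (\<forall>e\<in>edges G. \<exists>a\<in>A. \<exists>b\<in>B. ends G e = {a, b}))"

definition subgraph :: "'a graph \<Rightarrow> 'a graph \<Rightarrow> bool" where
  "subgraph H G \<longleftrightarrow> verts H \<subseteq> verts G \<and> edges H \<subseteq> edges G \<and> (\<forall>e\<in>edges H. ends G e \<subseteq> verts H)"

definition delete_verts :: "'a graph \<Rightarrow> 'a set \<Rightarrow> 'a graph" where
  "delete_verts G X = \<lparr>verts = verts G - X, edges = {e \<in> edges G. ends G e \<inter> X = {}}\<rparr>"

definition graph_iso :: "'a graph \<Rightarrow> 'b graph \<Rightarrow> bool" where
  "graph_iso G H \<longleftrightarrow> (\<exists>\<phi> \<psi>. bij_betw \<phi> (verts G) (verts H) \<and> bij_betw \<psi> (edges G) (edges H) \<and>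
     (\<forall>e\<in>edges G. ends H (\<psi> e) = \<phi> ` ends G e))"

definition K2 :: "bool graph" where
  "K2 = \<lparr>verts = {False, True}, edges = {{False, True}}\<rparr>"

(* The vertices and edges of G are v 0, e 0, v 1, e 1, ..., v (n-1), e (n-1) in cyclic order;
   for n = 2 the two edges are parallel. *)
definition cycle_enum :: "'a graph \<Rightarrow> nat \<Rightarrow> (nat \<Rightarrow> 'a) \<Rightarrow> (nat \<Rightarrow> 'a set) \<Rightarrow> bool" where
  "cycle_enum G n v e \<longleftrightarrow> 2 \<le> n \<and> bij_betw v {..<n} (verts G) \<and> bij_betw e {..<n} (edges G) \<and>
     (\<forall>i<n. ends G (e i) = {v i, v (Suc i mod n)})"

definition cycle_graph :: "'a graph \<Rightarrow> bool" where
  "cycle_graph G \<longleftrightarrow> (\<exists>n v e. cycle_enum G n v e)"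

definition alternating_cycle :: "'a set set \<Rightarrow> 'a graph \<Rightarrow> bool" where
  "alternating_cycle M C \<longleftrightarrow>
     (\<exists>n v e. cycle_enum C n v e \<and> (\<forall>i<n. e i \<in> M \<longleftrightarrow> e (Suc i mod n) \<notin> M))"

definition perfect_matching :: "'a graph \<Rightarrow> 'a set set \<Rightarrow> bool" where
  "perfect_matching G M \<longleftrightarrow> M \<subseteq> edges G \<and> (\<forall>v\<in>verts G. \<exists>!e. e \<in> M \<and> v \<in> ends G e)"

definition allowed_edge :: "'a graph \<Rightarrow> 'a set \<Rightarrow> bool" where
  "allowed_edge G e \<longleftrightarrow> (\<exists>M. perfect_matching G M \<and> e \<in> M)"

(* In the presence of a perfect matching the allowed edges cover all vertices, so they form a
   spanning subgraph. *)
definition elementary :: "'a graph \<Rightarrow> bool" where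
  "elementary G \<longleftrightarrow> (\<exists>M. perfect_matching G M) \<and>
     connected_graph \<lparr>verts = verts G, edges = {e. allowed_edge G e}\<rparr>"

definition plane_graph :: "complex graph \<Rightarrow> bool" where
  "plane_graph G \<longleftrightarrow> finite (verts G) \<and> finite (edges G) \<and>
     (\<forall>e\<in>edges G. \<exists>g. arc g \<and> path_image g = e \<and> ends G e = {pathstart g, pathfinish g}) \<and>
     (\<forall>e\<in>edges G. \<forall>e'\<in>edges G. e \<noteq> e' \<longrightarrow> e \<inter> e' \<subseteq> verts G)"

definition faces :: "complex graph \<Rightarrow> complex set set" where
  "faces G = components (- (verts G \<union> \<Union> (edges G)))"

definition finite_faces :: "complex graph \<Rightarrow> complex set set" where
  "finite_faces G = {s \<in> faces G. bounded s}"

definition periphery :: "complex graph \<Rightarrow> complex set \<Rightarrow> complex graph" where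
  "periphery G s = \<lparr>verts = verts G \<inter> frontier s, edges = {e \<in> edges G. e \<subseteq> frontier s}\<rparr>"

definition empty_or_unique_pm :: "'a graph \<Rightarrow> bool" where
  "empty_or_unique_pm G \<longleftrightarrow> verts G = {} \<or> (\<exists>!M. perfect_matching G M)"

definition forcing_face :: "complex graph \<Rightarrow> complex set \<Rightarrow> bool" where
  "forcing_face G s \<longleftrightarrow> empty_or_unique_pm (delete_verts G (verts (periphery G s)))"

definition resonant_face :: "complex graph \<Rightarrow> complex set set \<Rightarrow> complex set \<Rightarrow> bool" where
  "resonant_face G M s \<longleftrightarrow> alternating_cycle M (periphery G s)"

definition resonant_set :: "complex graph \<Rightarrow> complex set set \<Rightarrow> bool" where
  "resonant_set G S \<longleftrightarrow> S \<subseteq> finite_faces G \<and>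
     pairwise (\<lambda>s t. disjnt (verts (periphery G s)) (verts (periphery G t))) S \<and>
     (\<exists>M. perfect_matching G M \<and> (\<forall>s\<in>S. resonant_face G M s))"

definition maximal_resonant_set :: "complex graph \<Rightarrow> complex set set \<Rightarrow> bool" where
  "maximal_resonant_set G S \<longleftrightarrow> resonant_set G S \<and> (\<forall>T. resonant_set G T \<and> S \<subseteq> T \<longrightarrow> T = S)"

definition canonical_resonant_set :: "complex graph \<Rightarrow> complex set set \<Rightarrow> bool" where
  "canonical_resonant_set G S \<longleftrightarrow> resonant_set G S \<and>
     empty_or_unique_pm (delete_verts G (\<Union>s\<in>S. verts (periphery G s)))"

definition resonance_edge ::
    "complex graph \<Rightarrow> complex set set \<Rightarrow> complex set set \<Rightarrow> complex set \<Rightarrow> bool" where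
  "resonance_edge G M N s \<longleftrightarrow> perfect_matching G M \<and> perfect_matching G N \<and>
     s \<in> finite_faces G \<and> cycle_graph (periphery G s) \<and>
     (M - N) \<union> (N - M) = edges (periphery G s)"

definition resonance_graph :: "complex graph \<Rightarrow> complex set set graph" where
  "resonance_graph G =
     \<lparr>verts = {M. perfect_matching G M}, edges = {{M, N} | M N. \<exists>s. resonance_edge G M N s}\<rparr>"

definition edge_face_label :: "complex graph \<Rightarrow> complex set set set \<Rightarrow> complex set \<Rightarrow> bool" where
  "edge_face_label G x s \<longleftrightarrow> (\<exists>M N. x = {M, N} \<and> resonance_edge G M N s)"

definition hypercube_graph :: "nat \<Rightarrow> bool list graph" where
  "hypercube_graph k = \<lparr>verts = {xs. length xs = k},
     edges = {{xs, xs[i := \<not> xs ! i]} | xs i. length xs = k \<and> i < k}\<rparr>"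

definition is_hypercube_of :: "'a graph \<Rightarrow> 'a graph \<Rightarrow> bool" where
  "is_hypercube_of R Q \<longleftrightarrow> subgraph Q R \<and> (\<exists>k. graph_iso Q (hypercube_graph k))"

definition nontrivial_hypercubes :: "'a graph \<Rightarrow> 'a graph set" where
  "nontrivial_hypercubes R = {Q. subgraph Q R \<and> (\<exists>k\<ge>1. graph_iso Q (hypercube_graph k))}"

definition maximal_hypercubes :: "'a graph \<Rightarrow> 'a graph set" where
  "maximal_hypercubes R =
     {Q. is_hypercube_of R Q \<and> (\<forall>Q'. is_hypercube_of R Q' \<and> subgraph Q Q' \<longrightarrow> Q' = Q)}"

(* Meaningful only for vertices joined by a walk. *)
definition gdist :: "'a graph \<Rightarrow> 'a \<Rightarrow> 'a \<Rightarrow> nat" where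
  "gdist G u v = (LEAST n. (u, v) \<in> adj G ^^ n)"

definition Theta :: "'a graph \<Rightarrow> 'a set rel" where
  "Theta G = {(x, y). x \<in> edges G \<and> y \<in> edges G \<and>
     (\<exists>x1 x2 y1 y2. ends G x = {x1, x2} \<and> ends G y = {y1, y2} \<and>
        gdist G x1 y1 + gdist G x2 y2 \<noteq> gdist G x1 y2 + gdist G x2 y1)}"

definition Theta_classes :: "'a graph \<Rightarrow> 'a set set set" where
  "Theta_classes G = edges G // Theta G"

definition Theta_face_labels :: "complex graph \<Rightarrow> complex set set graph \<Rightarrow> complex set set" where
  "Theta_face_labels G Q = {s. \<exists>T\<in>Theta_classes Q. \<forall>x\<in>T. edge_face_label G x s}"

end

theory Submission
  imports Defs "HOL-Complex_Analysis.Complex_Analysis"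
begin

text \<open>
  Direct every edge from one colour class \<open>A\<close> to the other.  The symmetric difference of two
  perfect matchings \<open>M\<close> and \<open>N\<close> splits into circuits, so that for a point \<open>z\<close> off these circuits
  the sum of the winding numbers about \<open>z\<close> of the edges of \<open>M\<close>, minus the same sum for \<open>N\<close>, is an
  integer.  This height is constant on every face, zero on the unbounded face, and additive:
  passing from \<open>M\<close> to \<open>N\<close> and on to \<open>K\<close> adds up heights (\<open>height_locally_constant\<close>, \<open>hgt_add\<close>).
  An edge that lies in some but not in all perfect matchings has exactly two faces along it
  (\<open>edge_sides_circuit\<close>, an application of Janiszewski's theorem), and the height jumps by one
  between them if the edge belongs to one of the matchings only, and not at all otherwise
  (\<open>hgt_jump\<close>, \<open>hgt_no_jump\<close>).  So heights determine matchings.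

  Take a matching of greatest and a matching of least height.  A circuit of their symmetric
  difference that runs along the unbounded face must enclose the whole graph, hence is the
  boundary of the unbounded face; as that face is forcing, the two matchings agree off this
  circuit.  So the heights over the lowest matching are all 0 or 1 (\<open>extremal_matchings\<close>), and a
  perfect matching \<open>M\<close> amounts to the set \<open>D M\<close> of finite faces of height 1.  Rotating one circuit
  at a time shows that these sets are closed under union and intersection, so that they are the
  up-sets of a preorder on the finite faces.  It is a partial order: for every class of
  equivalent faces there is a circuit that has only faces of this class inside, and an edge in
  there would separate two of them (\<open>face_le_antisym\<close>).

  In this model everything becomes order theory.  Two matchings are adjacent in the resonance
  graph if and only if their up-sets differ in one face, the label of the edge
  (\<open>resonance_edge_iff\<close>).  A resonant set is an antichain, since independent faces are those that
  can be rotated one after the other in either order (\<open>resonant_set_iff\<close>).  If an antichain \<open>S\<close> is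
  maximal, every face is comparable with a member of \<open>S\<close>, so the rotations along \<open>S\<close> fix the
  up-set elsewhere and the matching off \<open>S\<close> is unique; if \<open>S\<close> is not maximal, a further face can be
  rotated off \<open>S\<close> (\<open>maximal_iff_canonical\<close>).

  A hypercube in the graph of up-sets consists of the sets \<open>D0 \<union> U\<close> with \<open>U \<subseteq> S\<close>, for an antichain
  \<open>S\<close>, which is the set of labels of its parallel classes (\<open>hypercube_is_cube\<close>, \<open>labels_cube\<close>).
  If \<open>S\<close> is not maximal then the cube can be enlarged by one dimension; if \<open>S\<close> is maximal, \<open>D0\<close> has
  to be the set of elements above \<open>S\<close>.  So maximal hypercubes correspond to maximal antichains
  (\<open>labels_bij\<close>).

  The argument needs every edge to be missing from some perfect matching.  Otherwise the graph
  is \<open>K2\<close>, which has no resonant set except the empty one.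
\<close>

section \<open>Alternating circuits of a bipartite graph\<close>

text \<open>The enumeration \<open>cycle_enum\<close>, for a cycle that is traced inside a larger graph rather than
  given as a graph of its own, together with alternation along the matching.\<close>

definition alt_cycle :: "'a graph \<Rightarrow> 'a set set \<Rightarrow> nat \<Rightarrow> (nat \<Rightarrow> 'a) \<Rightarrow> (nat \<Rightarrow> 'a set) \<Rightarrow> bool" where
  "alt_cycle G M n v e \<longleftrightarrow> 2 \<le> n \<and> inj_on v {..<n} \<and> inj_on e {..<n} \<and>
     (\<forall>i<n. e i \<in> edges G \<and> ends G (e i) = {v i, v (Suc i mod n)} \<and>
        (e i \<in> M \<longleftrightarrow> e (Suc i mod n) \<notin> M))"

text \<open>Rotating a matching only depends on the set of edges; the enumeration is needed just to
  parametrise the cycle as a closed curve.\<close>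

definition alt_circuit :: "'a graph \<Rightarrow> 'a set set \<Rightarrow> 'a set set \<Rightarrow> bool" where
  "alt_circuit G M E \<longleftrightarrow> (\<exists>n v e. alt_cycle G M n v e \<and> E = e ` {..<n})"

text \<open>The alternation clause loops when it is used as a rewrite rule, hence these destruction
  rules.\<close>

lemma alt_cycleD:
  assumes "alt_cycle G M n v e"
  shows "2 \<le> n" "inj_on v {..<n}" "inj_on e {..<n}"
    and "\<And>i. i < n \<Longrightarrow> e i \<in> edges G"
    and "\<And>i. i < n \<Longrightarrow> ends G (e i) = {v i, v (Suc i mod n)}"
    and "\<And>i. i < n \<Longrightarrow> (e i \<in> M \<longleftrightarrow> e (Suc i mod n) \<notin> M)"
  using assms unfolding alt_cycle_def by blast+

lemma alt_cycle_rotate: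
  assumes "alt_cycle G M n v e" "k < n"
  shows "alt_cycle G M n (\<lambda>i. v ((i + k) mod n)) (\<lambda>i. e ((i + k) mod n))"
    and "(\<lambda>i. e ((i + k) mod n)) ` {..<n} = e ` {..<n}"
proof -
  have n: "0 < n" "2 \<le> n" using alt_cycleD(1)[OF assms(1)] by auto
  have inj: "inj_on (\<lambda>i. (i + k) mod n) {..<n}"
  proof (rule inj_onI)
    fix i j assume "i \<in> {..<n}" "j \<in> {..<n}" "(i + k) mod n = (j + k) mod n"
    then show "i = j"
      using assms(2) by (auto simp: mod_if split: if_splits)
  qed
  have sub: "(\<lambda>i. (i + k) mod n) ` {..<n} \<subseteq> {..<n}" using n by auto
  have im: "(\<lambda>i. (i + k) mod n) ` {..<n} = {..<n}"
    using inj sub by (simp add: endo_inj_surj)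
  have iv: "inj_on (\<lambda>i. v ((i + k) mod n)) {..<n}"
    using comp_inj_on[OF inj, of v] alt_cycleD(2)[OF assms(1)] im by (simp add: comp_def)
  have ie: "inj_on (\<lambda>i. e ((i + k) mod n)) {..<n}"
    using comp_inj_on[OF inj, of e] alt_cycleD(3)[OF assms(1)] im by (simp add: comp_def)
  have s: "(Suc i mod n + k) mod n = Suc ((i + k) mod n) mod n" for i
    by (metis add_Suc mod_Suc_eq mod_add_left_eq)
  show "alt_cycle G M n (\<lambda>i. v ((i + k) mod n)) (\<lambda>i. e ((i + k) mod n))"
    unfolding alt_cycle_def s using n(2) iv ie alt_cycleD(4-6)[OF assms(1)] mod_less_divisor[OF n(1)] by blast
  show "(\<lambda>i. e ((i + k) mod n)) ` {..<n} = e ` {..<n}"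
    using im by (metis image_image)
qed

text \<open>Every edge can be made the first one, which is the one that \<open>circuit_curve\<close> treats
  specially.\<close>

lemma alt_circuit_start:
  assumes "alt_circuit G M E" "x \<in> E"
  obtains n v e where "alt_cycle G M n v e" "E = e ` {..<n}" "e 0 = x"
proof -
  obtain n v e where c: "alt_cycle G M n v e" "E = e ` {..<n}"
    using assms(1) by (auto simp: alt_circuit_def)
  then obtain k where k: "k < n" "e k = x" using assms(2) by auto
  show ?thesis
    using that[OF alt_cycle_rotate(1)[OF c(1) k(1)]] alt_cycle_rotate(2)[OF c(1) k(1)] c(2) k by simp
qed

lemma alt_circuit_edges: "alt_circuit G M E \<Longrightarrow> E \<subseteq> edges G"
  unfolding alt_circuit_def alt_cycle_def by blast

lemma alt_circuit_nonempty: "alt_circuit G M E \<Longrightarrow> E \<noteq> {}"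
  using alt_cycleD(1) by (fastforce simp: alt_circuit_def lessThan_empty_iff)

lemma alt_circuit_cong:
  assumes "alt_circuit G M E" "\<And>e. e \<in> E \<Longrightarrow> (e \<in> M \<longleftrightarrow> e \<in> N)"
  shows "alt_circuit G N E"
proof -
  obtain n v e where c: "alt_cycle G M n v e" "E = e ` {..<n}"
    using assms(1) by (auto simp: alt_circuit_def)
  have "alt_cycle G N n v e"
    using c assms(2) unfolding alt_cycle_def
    by (metis (no_types, lifting) image_eqI lessThan_iff mod_less_divisor less_nat_zero_code gr0I)
  with c show ?thesis by (auto simp: alt_circuit_def)
qed

lemma alt_circuit_compl:
  assumes "alt_circuit G M E" "\<And>e. e \<in> E \<Longrightarrow> (e \<in> M \<longleftrightarrow> e \<notin> N)"
  shows "alt_circuit G N E"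
proof -
  obtain n v e where c: "alt_cycle G M n v e" "E = e ` {..<n}"
    using assms(1) by (auto simp: alt_circuit_def)
  have "alt_cycle G N n v e"
    using c assms(2) unfolding alt_cycle_def
    by (metis (no_types, lifting) image_eqI lessThan_iff mod_less_divisor less_nat_zero_code gr0I)
  with c show ?thesis by (auto simp: alt_circuit_def)
qed

text \<open>The circuit has two edges at each of its vertices, namely \<open>e i\<close> and its predecessor, and
  these alternate.\<close>

lemma alt_circuit_vertex:
  assumes "alt_circuit G M E" "x \<in> E" "w \<in> ends G x"
  shows "\<exists>!y. y \<in> E \<and> y \<in> M \<and> w \<in> ends G y" "\<exists>!y. y \<in> E \<and> y \<notin> M \<and> w \<in> ends G y"
proof -
  obtain n v e where c: "alt_cycle G M n v e" and E: "E = e ` {..<n}"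
    using assms(1) by (auto simp: alt_circuit_def)
  have n: "2 \<le> n" and iv: "inj_on v {..<n}"
    and en: "\<And>i. i < n \<Longrightarrow> ends G (e i) = {v i, v (Suc i mod n)}"
    and al: "\<And>i. i < n \<Longrightarrow> e i \<in> M \<longleftrightarrow> e (Suc i mod n) \<notin> M"
    using alt_cycleD[OF c] by blast+
  obtain k where k: "k < n" "x = e k" using E assms(2) by auto
  obtain i where i: "i < n" "w = v i"
  proof -
    have "Suc k mod n < n" using n by simp
    moreover have "w = v k \<or> w = v (Suc k mod n)" using en[OF k(1)] assms(3) k(2) by simp
    ultimately show ?thesis using that k(1) by metis
  qed
  define j where "j = (i + (n - 1)) mod n"
  have j: "j < n" using n by (auto simp: j_def)
  have sj: "Suc j mod n = i"
  proof -
    have "Suc j mod n = (Suc (i + (n - 1))) mod n" unfolding j_def by (rule mod_Suc_eq)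
    also have "\<dots> = (i + n) mod n" using n by simp
    finally show ?thesis using i by simp
  qed
  have at: "w \<in> ends G (e l) \<longleftrightarrow> l = i \<or> l = j" if l: "l < n" for l
  proof -
    have "w \<in> ends G (e l) \<longleftrightarrow> i = l \<or> i = Suc l mod n"
      using en[OF l] iv i l n by (auto simp: inj_on_def)
    moreover have "i = Suc l mod n \<longleftrightarrow> l = j"
      using sj l j by (auto simp: mod_Suc split: if_splits)
    ultimately show ?thesis by auto
  qed
  have al': "e j \<in> M \<longleftrightarrow> e i \<notin> M" using al[OF j] sj by simp
  have inE: "y \<in> E \<and> w \<in> ends G y \<longleftrightarrow> y = e i \<or> y = e j" for y
    using at i j unfolding E by blast
  show "\<exists>!y. y \<in> E \<and> y \<in> M \<and> w \<in> ends G y" "\<exists>!y. y \<in> E \<and> y \<notin> M \<and> w \<in> ends G y"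
    using inE al' by metis+
qed

text \<open>At every vertex of the circuit one circuit edge is replaced by the other; elsewhere nothing
  changes.\<close>

lemma perfect_matching_flip:
  assumes M: "perfect_matching G M" and E: "alt_circuit G M E"
  shows "perfect_matching G (sym_diff M E)"
  unfolding perfect_matching_def
proof (intro conjI ballI)
  show "sym_diff M E \<subseteq> edges G"
    using M alt_circuit_edges[OF E] by (auto simp: perfect_matching_def)
  fix w assume w: "w \<in> verts G"
  have m: "\<exists>!e. e \<in> M \<and> w \<in> ends G e" using M w by (auto simp: perfect_matching_def)
  show "\<exists>!e. e \<in> sym_diff M E \<and> w \<in> ends G e"
  proof (cases "\<exists>x\<in>E. w \<in> ends G x")
    case True
    then obtain x where x: "x \<in> E" "w \<in> ends G x" by auto
    show ?thesis
      using alt_circuit_vertex[OF E x] m by (auto 4 4)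
  next
    case False
    then show ?thesis using m by auto
  qed
qed

text \<open>The colour classes are parameters, because they direct the edges later on.\<close>

locale bip_graph =
  fixes G :: "'a graph" and A B :: "'a set"
  assumes AB: "A \<union> B = verts G" "A \<inter> B = {}"
    and ends_AB: "\<And>e. e \<in> edges G \<Longrightarrow> \<exists>a\<in>A. \<exists>b\<in>B. ends G e = {a, b}"
    and fin: "finite (verts G)" "finite (edges G)"
begin

abbreviation pm :: "'a set set \<Rightarrow> bool" where "pm \<equiv> perfect_matching G"

definition medge :: "'a set set \<Rightarrow> 'a \<Rightarrow> 'a set" where
  "medge M v = (THE e. e \<in> M \<and> v \<in> ends G e)"

definition mate :: "'a set set \<Rightarrow> 'a \<Rightarrow> 'a" where
  "mate M v = (THE w. w \<in> ends G (medge M v) \<and> w \<noteq> v)"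

lemma finite_pms: "finite {M. pm M}"
  by (rule finite_subset[of _ "Pow (edges G)"]) (auto simp: perfect_matching_def fin)

lemma pm_finite: "pm M \<Longrightarrow> finite M"
  using fin by (auto simp: perfect_matching_def intro: finite_subset)

lemma medge:
  assumes "pm M" "v \<in> verts G"
  shows "medge M v \<in> M" "v \<in> ends G (medge M v)" "medge M v \<in> edges G"
proof -
  have "\<exists>!e. e \<in> M \<and> v \<in> ends G e" using assms by (auto simp: perfect_matching_def)
  from theI'[OF this] show "medge M v \<in> M" "v \<in> ends G (medge M v)" by (auto simp: medge_def)
  then show "medge M v \<in> edges G" using assms by (auto simp: perfect_matching_def)
qed

lemma medge_eq:
  assumes "pm M" "e \<in> M" "v \<in> ends G e"
  shows "medge M v = e"
proof -
  have "v \<in> verts G" using assms by (auto simp: ends_def)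
  then have "\<exists>!e. e \<in> M \<and> v \<in> ends G e" using assms by (auto simp: perfect_matching_def)
  then show ?thesis using assms medge[OF assms(1) \<open>v \<in> verts G\<close>] by auto
qed

lemma mate_AB:
  assumes "pm M"
  shows "a \<in> A \<Longrightarrow> mate M a \<in> B \<and> ends G (medge M a) = {a, mate M a}"
    and "b \<in> B \<Longrightarrow> mate M b \<in> A \<and> ends G (medge M b) = {mate M b, b}"
proof -
  have *: "mate M v = w" if "ends G (medge M v) = {v, w}" "v \<noteq> w" for v w
    unfolding mate_def using that by (intro the_equality) auto
  show "mate M a \<in> B \<and> ends G (medge M a) = {a, mate M a}" if a: "a \<in> A"
  proof -
    have "a \<in> verts G" using a AB by auto
    note m = medge[OF assms this]
    obtain a' b' where "a' \<in> A" "b' \<in> B" "ends G (medge M a) = {a', b'}" using ends_AB[OF m(3)] by auto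
    then show ?thesis using m a AB *[of a b'] by auto
  qed
  show "mate M b \<in> A \<and> ends G (medge M b) = {mate M b, b}" if a: "b \<in> B"
  proof -
    have "b \<in> verts G" using a AB by auto
    note m = medge[OF assms this]
    obtain a' b' where "a' \<in> A" "b' \<in> B" "ends G (medge M b) = {a', b'}" using ends_AB[OF m(3)] by auto
    then show ?thesis using m a AB *[of b a'] by auto
  qed
qed

lemma mate_mate:
  assumes "pm M"
  shows "a \<in> A \<Longrightarrow> mate M (mate M a) = a \<and> medge M (mate M a) = medge M a"
    and "b \<in> B \<Longrightarrow> mate M (mate M b) = b \<and> medge M (mate M b) = medge M b"
proof -
  show "mate M (mate M a) = a \<and> medge M (mate M a) = medge M a" if a: "a \<in> A"
  proof -
    note m = mate_AB(1)[OF assms a]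
    have e: "medge M (mate M a) = medge M a"
      using m medge[OF assms, of a] a AB by (intro medge_eq[OF assms]) auto
    with mate_AB(2)[OF assms, of "mate M a"] m a AB show ?thesis by (auto simp: doubleton_eq_iff)
  qed
  show "mate M (mate M b) = b \<and> medge M (mate M b) = medge M b" if a: "b \<in> B"
  proof -
    note m = mate_AB(2)[OF assms a]
    have e: "medge M (mate M b) = medge M b"
      using m medge[OF assms, of b] a AB by (intro medge_eq[OF assms]) auto
    with mate_AB(1)[OF assms, of "mate M b"] m a AB show ?thesis by (auto simp: doubleton_eq_iff)
  qed
qed

text \<open>The circuit goes from \<open>x i\<close> through \<open>d i\<close> to the mate of the next vertex \<open>x (i + 1)\<close>, and
  back through the matching edge to that vertex.  Both the circuits in the difference of two
  matchings and the circuit in \<open>all_edges_allowed\<close> have this form.\<close>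

lemma zigzag_circuit:
  assumes M: "pm M" and m: "0 < m" and inj: "inj_on x {..<m}"
    and x: "\<And>i. i < m \<Longrightarrow> x i \<in> A"
    and d: "\<And>i. i < m \<Longrightarrow> d i \<in> edges G \<and> d i \<notin> M \<and> ends G (d i) = {x i, mate M (x (Suc i mod m))}"
  shows "alt_circuit G M (d ` {..<m} \<union> (\<lambda>i. medge M (x i)) ` {..<m})"
proof -
  define s where "s i = Suc i mod m" for i
  have s: "s i < m" for i using m by (auto simp: s_def)
  have sinj: "i = j" if "s i = s j" "i < m" "j < m" for i j
    using that by (auto simp: s_def mod_Suc split: if_splits)
  have simg: "s ` {..<m} = {..<m}"
    using s sinj by (intro endo_inj_surj) (auto simp: inj_on_def)
  define v where "v j = (if even j then x (j div 2) else mate M (x (s (j div 2))))" for j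
  define e where "e j = (if even j then d (j div 2) else medge M (x (s (j div 2))))" for j
  have xd: "x i = x j \<longleftrightarrow> i = j" if "i < m" "j < m" for i j using inj that by (auto simp: inj_on_def)
  have mB: "mate M (x i) \<in> B" if "i < m" for i using mate_AB(1)[OF M x[OF that]] by auto
  have mm: "mate M (x i) = mate M (x j) \<longleftrightarrow> i = j" if "i < m" "j < m" for i j
    using mate_mate(1)[OF M x] xd that by metis
  have xv: "x i \<in> verts G" if "i < m" for i using x[OF that] AB by auto
  have me: "medge M (x i) \<in> M" "medge M (x i) \<in> edges G"
    "ends G (medge M (x i)) = {x i, mate M (x i)}" if "i < m" for i
    using medge[OF M xv[OF that]] mate_AB(1)[OF M x[OF that]] by auto
  have half: "j div 2 < m" if "j < 2 * m" for j using that by auto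
  have inj_v: "inj_on v {..<2*m}"
  proof (rule inj_onI)
    fix i j assume ij: "i \<in> {..<2*m}" "j \<in> {..<2*m}" "v i = v j"
    have "even i \<longleftrightarrow> even j"
      using ij half[of i] half[of j] x[of "i div 2"] x[of "j div 2"] mB[OF s, of "i div 2"] mB[OF s, of "j div 2"] AB
      by (auto simp: v_def split: if_splits)
    moreover have "i div 2 = j div 2"
      using ij calculation xd[of "i div 2" "j div 2"] mm[OF s s, of "i div 2" "j div 2"] sinj[of "i div 2" "j div 2"]
      by (auto simp: v_def split: if_splits)
    ultimately show "i = j" by (metis dvd_mult_div_cancel odd_two_times_div_two_succ)
  qed
  have xends: "x i \<in> ends G (d j) \<longleftrightarrow> i = j" if "i < m" "j < m" for i j
    using d[OF that(2)] that xd x mB[OF s] AB by (auto simp: s_def) (metis disjoint_iff)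
  have inj_e: "inj_on e {..<2*m}"
  proof (rule inj_onI)
    fix i j assume ij: "i \<in> {..<2*m}" "j \<in> {..<2*m}" "e i = e j"
    have "even i \<longleftrightarrow> even j"
      using ij d[of "i div 2"] d[of "j div 2"] me(1)[OF s, of "i div 2"] me(1)[OF s, of "j div 2"]
      by (auto simp: e_def split: if_splits)
    moreover have "i div 2 = j div 2"
    proof (cases "even i")
      case True
      then have "d (i div 2) = d (j div 2)" using ij calculation by (simp add: e_def)
      then show ?thesis using xends[of "i div 2" "i div 2"] xends[of "i div 2" "j div 2"] ij half by auto
    next
      case False
      then have "medge M (x (s (i div 2))) = medge M (x (s (j div 2)))"
        using ij calculation by (simp add: e_def)
      then have "{x (s (i div 2)), mate M (x (s (i div 2)))} = {x (s (j div 2)), mate M (x (s (j div 2)))}"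
        using me(3)[OF s] by metis
      then have "x (s (i div 2)) = x (s (j div 2))"
        using x[OF s] mB[OF s] AB by (metis disjoint_iff doubleton_eq_iff)
      then have "s (i div 2) = s (j div 2)" using xd s by blast
      then show ?thesis using sinj ij half by auto
    qed
    ultimately show "i = j" by (metis dvd_mult_div_cancel odd_two_times_div_two_succ)
  qed
  have "alt_cycle G M (2*m) v e"
    unfolding alt_cycle_def
  proof (intro conjI allI impI)
    show "2 \<le> 2 * m" using m by simp
    show "inj_on v {..<2*m}" "inj_on e {..<2*m}" by fact+
    fix i assume i: "i < 2 * m"
    note h = half[OF i]
    show "e i \<in> edges G" using d[OF h] me(2)[OF s] by (auto simp: e_def)
    have sm: "even (Suc i mod (2*m)) \<longleftrightarrow> odd i" by (simp add: dvd_mod_iff)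
    show "e i \<in> M \<longleftrightarrow> e (Suc i mod (2*m)) \<notin> M"
      using sm d[OF h] me(1)[OF s] d[of "(Suc i mod (2*m)) div 2"] half[of "Suc i mod (2*m)"] m
      by (auto simp: e_def)
    show "ends G (e i) = {v i, v (Suc i mod (2*m))}"
    proof (cases "even i")
      case True
      then have "Suc i < 2 * m" using i by (metis Suc_lessI even_Suc even_mult_iff even_numeral)
      then have "Suc i mod (2*m) = Suc i" "Suc i div 2 = i div 2" using True by auto
      then show ?thesis using True d[OF h] by (simp add: e_def v_def s_def)
    next
      case False
      have "(Suc i mod (2*m)) div 2 = s (i div 2)"
      proof (cases "Suc i = 2 * m")
        case True
        then have "Suc (i div 2) = m" using False by (auto elim!: oddE)
        then show ?thesis using True by (simp add: s_def)
      next
        case F: False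
        then have lt: "Suc i < 2 * m" using i by auto
        then have "Suc (i div 2) < m" using False by (auto elim!: oddE)
        then show ?thesis using lt False by (auto simp: s_def elim!: oddE)
      qed
      moreover have "v i = mate M (x (s (i div 2)))" "e i = medge M (x (s (i div 2)))"
        using False by (auto simp: v_def e_def)
      ultimately show ?thesis using me(3)[OF s, of "i div 2"] sm False by (auto simp: v_def)
    qed
  qed
  moreover have "e ` {..<2*m} = d ` {..<m} \<union> (\<lambda>i. medge M (x i)) ` {..<m}"
  proof
    show "e ` {..<2*m} \<subseteq> d ` {..<m} \<union> (\<lambda>i. medge M (x i)) ` {..<m}"
      using half s by (auto simp: e_def)
    have "d i \<in> e ` {..<2*m}" if "i < m" for i
      using that by (intro image_eqI[of _ _ "2*i"]) (auto simp: e_def)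
    moreover have "medge M (x i) \<in> e ` {..<2*m}" if "i < m" for i
    proof -
      obtain j where "j < m" "s j = i" using simg \<open>i < m\<close> by (metis imageE lessThan_iff)
      then show ?thesis by (intro image_eqI[of _ _ "Suc (2*j)"]) (auto simp: e_def)
    qed
    ultimately show "d ` {..<m} \<union> (\<lambda>i. medge M (x i)) ` {..<m} \<subseteq> e ` {..<2*m}" by blast
  qed
  ultimately show ?thesis unfolding alt_circuit_def by metis
qed

end

lemma orbit_returns:
  assumes "finite A" "inj_on f A" "f ` A \<subseteq> A" "a \<in> A"
  obtains n where "0 < n" "(f ^^ n) a = a" "inj_on (\<lambda>i. (f ^^ i) a) {..<n}"
proof -
  have inA: "(f ^^ i) a \<in> A" for i by (induction i) (use assms in auto)
  have cancel: "(f ^^ (j - i)) a = a" if "i \<le> j" "(f ^^ i) a = (f ^^ j) a" for i j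
    using that
  proof (induction i arbitrary: j)
    case (Suc i)
    then obtain j' where j: "j = Suc j'" by (cases j) auto
    have "(f ^^ i) a = (f ^^ j') a" using Suc.prems inA assms(2) by (auto simp: j inj_on_def)
    then show ?case using Suc j by auto
  qed auto
  have "\<not> inj_on (\<lambda>i. (f ^^ i) a) UNIV"
    using inA assms(1) by (metis finite_imageD finite_subset image_subsetI infinite_UNIV_nat)
  then obtain i j where "i < j" "(f ^^ i) a = (f ^^ j) a"
    by (auto simp: inj_on_def) (metis linorder_neqE_nat)
  then have ex: "\<exists>n. 0 < n \<and> (f ^^ n) a = a" using cancel[of i j] by (intro exI[of _ "j - i"]) auto
  define n where "n = (LEAST n. 0 < n \<and> (f ^^ n) a = a)"
  have n: "0 < n" "(f ^^ n) a = a" using LeastI_ex[OF ex] by (auto simp: n_def)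
  have "i = j" if "i < n" "j < n" "(f ^^ i) a = (f ^^ j) a" "i \<le> j" for i j
  proof (rule ccontr)
    assume "i \<noteq> j"
    then have "0 < j - i \<and> (f ^^ (j - i)) a = a" using cancel that by auto
    then have "n \<le> j - i" unfolding n_def by (rule Least_le)
    then show False using that \<open>i \<noteq> j\<close> by auto
  qed
  then have "inj_on (\<lambda>i. (f ^^ i) a) {..<n}"
    by (auto simp: inj_on_def) (metis nle_le)
  with n show ?thesis using that by blast
qed

context bip_graph begin

text \<open>Going from a vertex of \<open>A\<close> along \<open>N\<close> and then along \<open>M\<close> permutes \<open>A\<close>; the orbit of an end of
  \<open>e\<close> traces the circuit.\<close>

lemma sym_diff_circuit:
  assumes M: "pm M" and N: "pm N" and e: "e \<in> sym_diff M N"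
  obtains E where "alt_circuit G M E" "E \<subseteq> sym_diff M N" "e \<in> E"
proof -
  have "e \<in> edges G" using M N e by (auto simp: perfect_matching_def)
  then obtain a b where ab: "a \<in> A" "b \<in> B" "ends G e = {a, b}" using ends_AB by blast
  define f where "f x = mate M (mate N x)" for x
  have fA: "f x \<in> A" if "x \<in> A" for x using that mate_AB M N by (auto simp: f_def)
  have finj: "inj_on f A"
    by (rule inj_onI) (metis f_def mate_AB(1) mate_mate M N)
  have "finite A" using AB fin by (metis finite_Un)
  then obtain n where n: "0 < n" "(f ^^ n) a = a" "inj_on (\<lambda>i. (f ^^ i) a) {..<n}"
    using orbit_returns[OF _ finj] fA ab(1) by (metis image_subsetI)
  define x where "x i = (f ^^ i) a" for i
  have xA: "x i \<in> A" for i by (induction i) (use ab fA in \<open>auto simp: x_def\<close>)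
  have xS: "x (Suc i mod n) = f (x i)" if "i < n" for i
  proof (cases "Suc i = n")
    case True
    then have "x (Suc i) = x 0" using n by (simp add: x_def)
    moreover have "x (Suc i) = f (x i)" by (simp add: x_def)
    ultimately show ?thesis using True by simp
  next
    case False
    then show ?thesis using that by (simp add: x_def)
  qed
  have xv: "x i \<in> verts G" for i using xA[of i] AB by auto
  have ea: "e = medge M a \<or> e = medge N a"
    using e medge_eq[OF M, of e a] medge_eq[OF N, of e a] ab by auto
  have ne0: "medge M a \<noteq> medge N a"
  proof -
    have "a \<in> verts G" using ab AB by auto
    then show ?thesis
      using e medge(1)[OF M, of a] medge(1)[OF N, of a] medge_eq[OF M, of e a] medge_eq[OF N, of e a] ab
      by auto
  qed
  have ne: "medge M (x i) \<noteq> medge N (x i)" if "i < n" for i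
  proof
    assume eq: "medge M (x i) = medge N (x i)"
    then have "mate M (x i) = mate N (x i)" by (simp add: mate_def)
    then have "f (x i) = x i" using mate_mate(1)[OF M xA[of i]] by (simp add: f_def)
    then have "x (Suc i mod n) = x i" using xS[OF that] by simp
    then have "Suc i mod n = i" using n(3) that by (auto simp: inj_on_def x_def)
    then have "i = 0" using that by (auto simp: mod_Suc split: if_splits)
    then show False using eq ne0 by (simp add: x_def)
  qed
  have dn: "medge N (x i) \<notin> M" if "i < n" for i
    using medge_eq[OF M, of "medge N (x i)" "x i"] medge[OF N xv[of i]] ne[OF that] by auto
  have en: "medge M (x i) \<notin> N" if "i < n" for i
    using medge_eq[OF N, of "medge M (x i)" "x i"] medge[OF M xv[of i]] ne[OF that] by auto
  have ends: "ends G (medge N (x i)) = {x i, mate M (x (Suc i mod n))}" if "i < n" for i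
    using mate_AB(1)[OF N xA[of i]] mate_mate(2)[OF M, of "mate N (x i)"] by (simp add: xS[OF that] f_def)
  have c: "alt_circuit G M ((\<lambda>i. medge N (x i)) ` {..<n} \<union> (\<lambda>i. medge M (x i)) ` {..<n})"
    using n(1,3) xA dn ends medge(3)[OF N xv] by (intro zigzag_circuit[OF M]) (auto simp: x_def[symmetric])
  have "medge N a \<in> (\<lambda>i. medge N (x i)) ` {..<n}" "medge M a \<in> (\<lambda>i. medge M (x i)) ` {..<n}"
    using n by (auto intro!: image_eqI[of _ _ 0] simp: x_def)
  then show ?thesis
    using that[OF c] ea dn en medge(1)[OF M xv] medge(1)[OF N xv] by auto
qed

text \<open>Suppose that the edge \<open>e\<close> with ends \<open>a\<close> and \<open>b\<close> lies in no perfect matching, and let \<open>X\<close> be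
  the set of vertices of \<open>A\<close> that can be reached from the mate of \<open>b\<close> by leaving along non-matching
  edges and returning along matching edges.  It does not contain \<open>a\<close>, as otherwise a shortest
  such walk and \<open>e\<close> would close up to an alternating circuit.  All neighbours of \<open>X\<close> are in the set
  \<open>Y\<close> of mates of \<open>X\<close>, and \<open>Y\<close> is no larger than \<open>X\<close>; so every perfect matching matches \<open>X\<close> onto \<open>Y\<close>,
  and the allowed edges do not connect \<open>X \<union> Y\<close> with \<open>a\<close>.\<close>

lemma all_edges_allowed:
  assumes M: "pm M" and conn: "connected_graph \<lparr>verts = verts G, edges = {e. allowed_edge G e}\<rparr>"
    and e: "e \<in> edges G"
  shows "allowed_edge G e"
proof (rule ccontr)
  assume na: "\<not> allowed_edge G e"
  then have eM: "e \<notin> M" using M by (auto simp: allowed_edge_def)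
  obtain a b where ab: "a \<in> A" "b \<in> B" "ends G e = {a, b}" using ends_AB[OF e] by blast
  define R where "R = {(x, y). x \<in> A \<and> y \<in> A \<and> (\<exists>d\<in>edges G. d \<notin> M \<and> ends G d = {x, mate M y})}"
  define x0 where "x0 = mate M b"
  have x0: "x0 \<in> A" "mate M x0 = b" using mate_AB(2)[OF M ab(2)] mate_mate(2)[OF M ab(2)] by (auto simp: x0_def)
  define X where "X = R\<^sup>* `` {x0}"
  have XA: "X \<subseteq> A"
  proof
    fix y assume "y \<in> X"
    then have "(x0, y) \<in> R\<^sup>*" by (simp add: X_def)
    then show "y \<in> A" by (cases rule: rtranclE) (use x0 in \<open>auto simp: R_def\<close>)
  qed
  \<comment> \<open>Least length makes the vertices of the walk distinct.\<close>
  have aX: "a \<notin> X"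
  proof
    assume "a \<in> X"
    then have ex: "\<exists>k. (x0, a) \<in> R ^^ k" by (auto simp: X_def rtrancl_power)
    define k where "k = (LEAST k. (x0, a) \<in> R ^^ k)"
    have "(x0, a) \<in> R ^^ k" using LeastI_ex[OF ex] by (simp add: k_def)
    then obtain f where f: "f 0 = x0" "f k = a" "\<And>i. i < k \<Longrightarrow> (f i, f (Suc i)) \<in> R"
      by (auto simp: relpow_fun_conv)
    have seg: "(f i, f (i + l)) \<in> R ^^ l" if "i + l \<le> k" for i l
      using that by (induction l) (auto dest!: f(3) intro: relcompI simp: Suc_le_eq)
    have "i = j" if ij: "i \<le> j" "j \<le> k" "f i = f j" for i j
    proof (rule ccontr)
      assume ne: "i \<noteq> j"
      have "(x0, f i) \<in> R ^^ i" "(f i, a) \<in> R ^^ (k - j)"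
        using seg[of 0 i] seg[of j "k - j"] f ij by auto
      then have "(x0, a) \<in> R ^^ (i + (k - j))" by (auto simp: relpow_add)
      then have "k \<le> i + (k - j)" unfolding k_def by (rule Least_le)
      then show False using ne ij by auto
    qed
    then have inj: "inj_on f {..<Suc k}"
      by (auto simp: inj_on_def less_Suc_eq_le) (metis nle_le)
    have "\<forall>i\<in>{..<k}. \<exists>d. d \<in> edges G \<and> d \<notin> M \<and> ends G d = {f i, mate M (f (Suc i))}"
      using f(3) by (force simp: R_def)
    then obtain d where d: "\<And>i. i < k \<Longrightarrow> d i \<in> edges G \<and> d i \<notin> M \<and> ends G (d i) = {f i, mate M (f (Suc i))}"
      by (metis lessThan_iff)
    define d' where "d' i = (if i < k then d i else e)" for i
    have fA: "f i \<in> A" if "i < Suc k" for i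
      using that f(3)[of i] f(2) ab by (cases "i = k") (auto simp: R_def)
    have d': "d' i \<in> edges G \<and> d' i \<notin> M \<and> ends G (d' i) = {f i, mate M (f (Suc i mod Suc k))}" if "i < Suc k" for i
      
    proof (cases "i < k")
      case True
      then show ?thesis using d[OF True] by (simp add: d'_def)
    next
      case False
      then have "i = k" using that by simp
      then show ?thesis using e eM f x0 ab by (simp add: d'_def)
    qed
    have c: "alt_circuit G M (d' ` {..<Suc k} \<union> (\<lambda>i. medge M (f i)) ` {..<Suc k})"
      (is "alt_circuit G M ?E")
      by (rule zigzag_circuit[OF M _ inj fA d']) auto
    have "e \<in> ?E" by (auto simp: d'_def intro!: image_eqI[of _ _ k])
    then show False using perfect_matching_flip[OF M c] na eM by (auto simp: allowed_edge_def)
  qed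
  define Y where "Y = mate M ` X"
  have toY: "y \<in> Y" if "d \<in> edges G" "ends G d = {x, y}" "x \<in> X" "y \<in> B" for d x y
  proof (cases "d \<in> M")
    case True
    then have "medge M x = d" using that medge_eq[OF M] by auto
    then have "y = mate M x" using mate_AB(1)[OF M, of x] that XA AB by (auto simp: doubleton_eq_iff)
    then show ?thesis using that by (auto simp: Y_def)
  next
    case False
    then have "(x, mate M y) \<in> R"
      using that XA mate_AB(2)[OF M, of y] mate_mate(2)[OF M, of y] by (auto simp: R_def)
    then have "mate M y \<in> X" using that(3) by (auto simp: X_def)
    then show ?thesis using mate_mate(2)[OF M that(4)] by (force simp: Y_def)
  qed
  have finX: "finite X" using XA AB fin by (metis finite_Un finite_subset)
  have closed: "ends G d \<subseteq> X \<union> Y" if d: "allowed_edge G d" "w \<in> ends G d" "w \<in> X \<union> Y" for d w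
  proof -
    obtain N where N: "pm N" "d \<in> N" using d by (auto simp: allowed_edge_def)
    have inj: "inj_on (mate K) X" if "pm K" for K
      by (rule inj_on_inverseI[of _ "mate K"]) (use mate_mate(1)[OF that] XA in blast)
    note injN = inj[OF N(1)] and injM = inj[OF M]
    have sub: "mate N ` X \<subseteq> Y"
    proof clarify
      fix x assume "x \<in> X"
      then have "x \<in> A" using XA by auto
      note mm = mate_AB(1)[OF N(1) this]
      have "x \<in> verts G" using \<open>x \<in> A\<close> AB by auto
      then show "mate N x \<in> Y" using toY[OF medge(3)[OF N(1)]] mm \<open>x \<in> X\<close> by blast
    qed
    have eqY: "mate N ` X = Y"
      using sub finX card_image[OF injN] card_image[OF injM] by (intro card_subset_eq) (auto simp: Y_def)
    have dw: "medge N w = d" using medge_eq[OF N] d(2) .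
    have xin: "ends G d \<subseteq> X \<union> Y" if "x \<in> X" "medge N x = d" for x
    proof -
      have "ends G d = {x, mate N x}" using mate_AB(1)[OF N(1), of x] that XA by blast
      moreover have "mate N x \<in> Y" using that eqY by blast
      ultimately show ?thesis using that(1) by simp
    qed
    show ?thesis
    proof (cases "w \<in> X")
      case True
      then show ?thesis using xin dw by auto
    next
      case False
      then obtain x where x: "x \<in> X" "w = mate N x" using d(3) eqY by auto
      then have "medge N x = d" using mate_mate(1)[OF N(1), of x] XA dw by auto
      then show ?thesis using xin x by auto
    qed
  qed
  let ?H = "\<lparr>verts = verts G, edges = {e. allowed_edge G e}\<rparr>"
  have "b \<in> Y" using x0 by (auto simp: Y_def X_def)
  have "w \<in> X \<union> Y" if "(b, w) \<in> (adj ?H)\<^sup>*" for w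
    using that
  proof (induction rule: rtrancl_induct)
    case base
    then show ?case using \<open>b \<in> Y\<close> by simp
  next
    case (step y z)
    then obtain d where "allowed_edge G d" "ends ?H d = {y, z}" by (auto simp: adj_def)
    then show ?case using closed[of d y] step by (auto simp: ends_def)
  qed
  moreover have "(b, a) \<in> (adj ?H)\<^sup>*" 
  proof -
    have "a \<in> verts ?H" "b \<in> verts ?H" using ab AB by auto
    then show ?thesis using conn unfolding connected_graph_def by blast
  qed
  moreover have "a \<notin> Y" 
  proof
    assume "a \<in> Y"
    then obtain x where "x \<in> X" "a = mate M x" by (auto simp: Y_def)
    then have "a \<in> B" using mate_AB(1)[OF M, of x] XA by blast
    then show False using ab AB by blast
  qed
  ultimately show False using aX by auto
qed

end

section \<open>Circuits as closed curves and the height of a pair of matchings\<close>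

lemma arc_interior_closure:
  fixes g :: "real \<Rightarrow> complex"
  assumes "arc g"
  shows "path_image g \<subseteq> closure (path_image g - {pathstart g, pathfinish g})"
proof -
  have "g ` closure {0<..<1} \<subseteq> closure (g ` {0<..<1})"
    using assms by (intro image_closure_subset) (auto simp: arc_def path_def closure_subset)
  then show ?thesis
    using simple_path_endless[OF arc_imp_simple_path[OF assms]] by (simp add: path_image_def)
qed

locale plane_bip = bip_graph G A B for G :: "complex graph" and A B +
  assumes plane: "plane_graph G"
begin

definition drawing :: "complex set" where "drawing = verts G \<union> \<Union> (edges G)"

definition inner :: "complex set \<Rightarrow> complex set" where "inner e = e - verts G"

text \<open>A parametrisation that runs from the class \<open>A\<close> to the class \<open>B\<close>, so that along an alternating
  circuit the matching edges are traversed in one direction and the others in the opposite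
  one.\<close>

definition garc :: "complex set \<Rightarrow> real \<Rightarrow> complex" where
  "garc e = (SOME g. arc g \<and> path_image g = e \<and> pathstart g \<in> A \<and> ends G e = {pathstart g, pathfinish g})"

lemma garc:
  assumes "e \<in> edges G"
  shows "arc (garc e)" "path_image (garc e) = e" "pathstart (garc e) \<in> A"
    "ends G e = {pathstart (garc e), pathfinish (garc e)}"
proof -
  obtain g where g: "arc g" "path_image g = e" "ends G e = {pathstart g, pathfinish g}"
    using plane assms unfolding plane_graph_def by metis
  obtain a b where ab: "a \<in> A" "b \<in> B" "ends G e = {a, b}" using ends_AB[OF assms] by blast
  have "\<exists>g. arc g \<and> path_image g = e \<and> pathstart g \<in> A \<and> ends G e = {pathstart g, pathfinish g}"
  proof (cases "pathstart g = a")
    case True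
    then show ?thesis using g ab by blast
  next
    case False
    then have "pathfinish g = a" using g ab by (metis doubleton_eq_iff)
    then show ?thesis
      using g ab by (intro exI[of _ "reversepath g"]) (auto simp: arc_reversepath insert_commute)
  qed
  from someI_ex[OF this] show "arc (garc e)" "path_image (garc e) = e" "pathstart (garc e) \<in> A"
    "ends G e = {pathstart (garc e), pathfinish (garc e)}"
    unfolding garc_def by blast+
qed

lemma edges_disjoint: "e \<in> edges G \<Longrightarrow> e' \<in> edges G \<Longrightarrow> e \<noteq> e' \<Longrightarrow> e \<inter> e' \<subseteq> verts G"
  using plane by (auto simp: plane_graph_def)

lemma edge_compact: "e \<in> edges G \<Longrightarrow> compact e"
  using garc compact_arc_image by metis

lemma inner_eq:
  assumes "e \<in> edges G"
  shows "inner e = path_image (garc e) - {pathstart (garc e), pathfinish (garc e)}"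
  using garc[OF assms] by (auto simp: inner_def ends_def)

lemma inner_connected: "e \<in> edges G \<Longrightarrow> connected (inner e)"
  using inner_eq connected_simple_path_endless arc_imp_simple_path garc(1) by metis

lemma inner_nonempty: "e \<in> edges G \<Longrightarrow> inner e \<noteq> {}"
  using inner_eq nonempty_simple_path_endless arc_imp_simple_path garc(1) by metis

lemma inner_closure: "e \<in> edges G \<Longrightarrow> e \<subseteq> closure (inner e)"
  using inner_eq arc_interior_closure garc(1,2) by metis

lemma inner_disjoint: "e \<in> edges G \<Longrightarrow> e' \<in> edges G \<Longrightarrow> e \<noteq> e' \<Longrightarrow> inner e \<inter> e' = {}"
  using edges_disjoint[of e e'] by (auto simp: inner_def)

text \<open>Different edges only meet in vertices, so the open edge can be covered by nothing but
  itself.\<close>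

lemma edge_subset_Union:
  assumes "e \<in> edges G" "E \<subseteq> edges G" "e \<subseteq> \<Union>E"
  shows "e \<in> E"
proof -
  obtain x where x: "x \<in> inner e" using inner_nonempty[OF assms(1)] by blast
  then obtain y where y: "y \<in> E" "x \<in> y" using assms by (auto simp: inner_def)
  then have "y = e" using inner_disjoint[of e y] assms x by auto
  then show ?thesis using y by simp
qed

lemma drawing_decomp: "drawing = verts G \<union> (\<Union>e\<in>edges G. inner e)"
  by (auto simp: drawing_def inner_def)

lemma compact_Union_edges: "E \<subseteq> edges G \<Longrightarrow> compact (\<Union>E)"
  using edge_compact fin finite_subset by (intro compact_Union) auto

lemma compact_drawing: "compact drawing"
  unfolding drawing_def using fin by (intro compact_Un compact_Union_edges finite_imp_compact) auto

definition wnd :: "complex set \<Rightarrow> complex \<Rightarrow> complex" where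
  "wnd e z = winding_number (garc e) z"

text \<open>Winding numbers of single arcs are no integers, and at points of an edge they are arbitrary.
  In the difference the common edges cancel, and the remaining ones close up to circuits.\<close>

definition height :: "complex set set \<Rightarrow> complex set set \<Rightarrow> complex \<Rightarrow> complex" where
  "height M N z = (\<Sum>e\<in>M. wnd e z) - (\<Sum>e\<in>N. wnd e z)"

lemma directed_arc:
  assumes "e \<in> edges G" "ends G e = {v, w}" "v \<noteq> w"
  obtains p where "arc p" "path_image p = e" "pathstart p = v" "pathfinish p = w"
    "\<And>z. z \<notin> e \<Longrightarrow> winding_number p z = (if v \<in> A then 1 else -1) * wnd e z"
proof (cases "v \<in> A")
  case True
  have "w \<notin> A" using ends_AB[OF assms(1)] assms True AB by (auto simp: doubleton_eq_iff)
  then have "pathstart (garc e) = v" "pathfinish (garc e) = w"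
    using garc[OF assms(1)] assms by (metis doubleton_eq_iff)+
  then show ?thesis using that[of "garc e"] garc[OF assms(1)] True by (simp add: wnd_def)
next
  case False
  then have "pathstart (garc e) = w" "pathfinish (garc e) = v"
    using garc[OF assms(1)] assms by (metis doubleton_eq_iff)+
  then show ?thesis using that[of "reversepath (garc e)"] garc[OF assms(1)] False
    by (simp add: wnd_def arc_reversepath winding_number_reversepath arc_imp_path)
qed

text \<open>Traversing the circuit, one passes \<open>A\<close> and \<open>B\<close> alternately, and edges in and out of \<open>M\<close>
  alternately; so up to one global sign the winding number of the curve is the difference of the
  two sums.  The edge \<open>e 0\<close> is joined last: without it the curve is an arc, hence connected.\<close>

lemma circuit_curve:
  assumes c: "alt_cycle G M n v e"
  obtains p \<sigma> where "simple_path p" "pathfinish p = pathstart p" "path_image p = \<Union> (e ` {..<n})"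
    "connected (\<Union> (e ` {..<n} - {e 0}))" "\<sigma> = 1 \<or> \<sigma> = (-1::complex)"
    "\<And>z. z \<notin> \<Union> (e ` {..<n}) \<Longrightarrow>
       winding_number p z = \<sigma> * ((\<Sum>x\<in>e ` {..<n} - M. wnd x z) - (\<Sum>x\<in>e ` {..<n} \<inter> M. wnd x z))"
proof -
  note cD = alt_cycleD[OF c]
  have n: "0 < n" "1 < n" using cD(1) by auto
  have vd: "v i = v j \<longleftrightarrow> i = j" if "i < n" "j < n" for i j using cD(2) that by (auto simp: inj_on_def)
  have ed: "e i = e j \<longleftrightarrow> i = j" if "i < n" "j < n" for i j using cD(3) that by (auto simp: inj_on_def)
  have ne: "v i \<noteq> v (Suc i mod n)" if "i < n" for i
  proof -
    have "i \<noteq> Suc i mod n" using that n by (auto simp: mod_Suc)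
    then show ?thesis using vd[OF that] n by auto
  qed
  define s where "s i = (if v i \<in> A then 1 else (-1::complex))" for i
  have P: "\<exists>p. arc p \<and> pathstart p = v 1 \<and> pathfinish p = v (Suc (Suc k) mod n) \<and>
      path_image p = \<Union> (e ` {1..Suc k}) \<and>
      (\<forall>z. z \<notin> \<Union> (e ` {1..Suc k}) \<longrightarrow> winding_number p z = (\<Sum>i\<in>{1..Suc k}. s i * wnd (e i) z))"
    if "Suc k < n" for k
    using that
  proof (induction k)
    case 0
    obtain p where "arc p" "path_image p = e 1" "pathstart p = v 1" "pathfinish p = v (Suc 1 mod n)"
      "\<And>z. z \<notin> e 1 \<Longrightarrow> winding_number p z = s 1 * wnd (e 1) z"
      using directed_arc[OF cD(4)[OF n(2)] cD(5)[OF n(2)] ne[OF n(2)]] unfolding s_def by blast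
    then show ?case by (intro exI[of _ p]) auto
  next
    case (Suc k)
    define j where "j = Suc (Suc k)"
    have j: "j < n" using Suc.prems by (simp add: j_def)
    obtain p where p: "arc p" "pathstart p = v 1" "pathfinish p = v j" "path_image p = \<Union> (e ` {1..Suc k})"
      "\<And>z. z \<notin> \<Union> (e ` {1..Suc k}) \<Longrightarrow> winding_number p z = (\<Sum>i\<in>{1..Suc k}. s i * wnd (e i) z)"
      using Suc.IH Suc.prems j by (auto simp: j_def)
    obtain q where q: "arc q" "path_image q = e j" "pathstart q = v j" "pathfinish q = v (Suc j mod n)"
      "\<And>z. z \<notin> e j \<Longrightarrow> winding_number q z = s j * wnd (e j) z"
      using directed_arc[OF cD(4)[OF j] cD(5)[OF j] ne[OF j]] unfolding s_def by blast
    have "path_image p \<inter> path_image q \<subseteq> {pathstart q}"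
    proof
      fix x assume "x \<in> path_image p \<inter> path_image q"
      then obtain i where i: "1 \<le> i" "i \<le> Suc k" "x \<in> e i" "x \<in> e j" using p(4) q(2) by auto
      have il: "i < n" "Suc i < n" "i \<noteq> j" using i j by (auto simp: j_def)
      have "x \<in> verts G" using edges_disjoint[OF cD(4)[OF il(1)] cD(4)[OF j]] ed[OF il(1) j] il(3) i by blast
      then have "x \<in> ends G (e i)" "x \<in> ends G (e j)" using i by (auto simp: ends_def)
      then have x: "x = v i \<or> x = v (Suc i)" "x = v j \<or> x = v (Suc j mod n)"
        using cD(5)[OF il(1)] cD(5)[OF j] il by auto
      have "Suc j mod n \<noteq> i" "Suc j mod n \<noteq> Suc i"
        using i j by (auto simp: mod_Suc j_def)
      then have "x \<noteq> v (Suc j mod n)" using x vd il n by (metis mod_less_divisor)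
      then show "x \<in> {pathstart q}" using x q(3) by simp
    qed
    then have "arc (p +++ q)" using p q by (intro arc_join) auto
    moreover have img: "path_image (p +++ q) = \<Union> (e ` {1..Suc (Suc k)})"
      using p q by (simp add: path_image_join atLeastAtMostSuc_conv j_def Un_commute)
    moreover have "winding_number (p +++ q) z = (\<Sum>i\<in>{1..Suc (Suc k)}. s i * wnd (e i) z)"
      if "z \<notin> \<Union> (e ` {1..Suc (Suc k)})" for z
    proof -
      have z: "z \<notin> \<Union> (e ` {1..Suc k})" "z \<notin> e j" using that by (auto simp: j_def)
      have "winding_number (p +++ q) z = winding_number p z + winding_number q z"
        using p q z by (intro winding_number_join) (auto simp: arc_imp_path)
      then show ?thesis using p(5)[OF z(1)] q(5)[OF z(2)] by (simp add: j_def)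
    qed
    ultimately show ?case using p q by (intro exI[of _ "p +++ q"]) (simp add: j_def)
  qed
  have n2: "Suc (n - 2) < n" "Suc (Suc (n - 2)) = n" "Suc (n - 2) = n - 1" using n by auto
  have "\<exists>p. arc p \<and> pathstart p = v 1 \<and> pathfinish p = v 0 \<and> path_image p = \<Union> (e ` {1..n-1}) \<and>
      (\<forall>z. z \<notin> \<Union> (e ` {1..n-1}) \<longrightarrow> winding_number p z = (\<Sum>i\<in>{1..n-1}. s i * wnd (e i) z))"
    using P[OF n2(1)] unfolding n2(2) unfolding n2(3) by simp
  then obtain p where p: "arc p" "pathstart p = v 1" "pathfinish p = v 0"
    "path_image p = \<Union> (e ` {1..n-1})"
    "\<And>z. z \<notin> \<Union> (e ` {1..n-1}) \<Longrightarrow> winding_number p z = (\<Sum>i\<in>{1..n-1}. s i * wnd (e i) z)"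
    by blast
  have ne0: "v 0 \<noteq> v (Suc 0 mod n)" using ne[OF n(1)] .
  obtain q where q: "arc q" "path_image q = e 0" "pathstart q = v 0" "pathfinish q = v 1"
    "\<And>z. z \<notin> e 0 \<Longrightarrow> winding_number q z = s 0 * wnd (e 0) z"
    using directed_arc[OF cD(4)[OF n(1)] cD(5)[OF n(1)] ne0] n unfolding s_def by auto
  have range: "{..<n} = insert 0 {1..n-1}" using n by auto
  have img: "path_image (p +++ q) = \<Union> (e ` {..<n})"
    using p q by (simp add: path_image_join range Un_commute)
  have minus: "e ` {..<n} - {e 0} = e ` {1..n-1}"
  proof -
    have "e 0 \<noteq> e i" if "1 \<le> i" "i \<le> n - 1" for i using that ed[of 0 i] n by auto
    then have "e 0 \<notin> e ` {1..n-1}" by (simp add: image_iff)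
    then show ?thesis unfolding range by simp
  qed
  have "path_image p \<inter> path_image q \<subseteq> {pathstart p, pathstart q}"
  proof
    fix x assume "x \<in> path_image p \<inter> path_image q"
    then obtain i where i: "1 \<le> i" "i \<le> n - 1" "x \<in> e i" "x \<in> e 0" using p(4) q(2) by auto
    have il: "i < n" "i \<noteq> 0" using i n by auto
    have "x \<in> verts G" using edges_disjoint[OF cD(4)[OF il(1)] cD(4)[OF n(1)]] ed[OF il(1) n(1)] il(2) i by blast
    then have "x \<in> ends G (e 0)" using i by (auto simp: ends_def)
    then show "x \<in> {pathstart p, pathstart q}" using cD(5)[OF n(1)] n p(2) q(3) by auto
  qed
  then have sp: "simple_path (p +++ q)" using p q by (intro simple_path_join_loop) auto
  define \<sigma> where "\<sigma> = s 0 * (if e 0 \<in> M then -1 else 1)"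
  have sig: "s i * (if e i \<in> M then -1 else 1) = \<sigma>" if "i < n" for i
    using that
  proof (induction i)
    case 0
    then show ?case by (simp add: \<sigma>_def)
  next
    case (Suc i)
    have i: "i < n" "Suc i mod n = Suc i" using Suc.prems by auto
    have "e i \<in> M \<longleftrightarrow> e (Suc i) \<notin> M" using cD(6)[OF i(1)] i(2) by simp
    moreover have "v i \<in> A \<longleftrightarrow> v (Suc i) \<notin> A"
    proof -
      obtain a b where "a \<in> A" "b \<in> B" "{v i, v (Suc i)} = {a, b}"
        using ends_AB[OF cD(4)[OF i(1)]] cD(5)[OF i(1)] i(2) by metis
      then show ?thesis using AB by (auto simp: doubleton_eq_iff)
    qed
    ultimately show ?case using Suc.IH[OF i(1)] by (auto simp: s_def)
  qed
  have s_eq: "s i = \<sigma> * (if e i \<in> M then -1 else 1)" if "i < n" for i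
    using sig[OF that] by (auto split: if_splits)
  have w: "winding_number (p +++ q) z = \<sigma> * ((\<Sum>x\<in>e ` {..<n} - M. wnd x z) - (\<Sum>x\<in>e ` {..<n} \<inter> M. wnd x z))"
    if z: "z \<notin> \<Union> (e ` {..<n})" for z
  proof -
    have "z \<notin> \<Union> (e ` {1..n-1})" "z \<notin> e 0" using z unfolding range by auto
    moreover have "winding_number (p +++ q) z = winding_number p z + winding_number q z"
      using p q calculation by (intro winding_number_join) (auto simp: arc_imp_path)
    ultimately have "winding_number (p +++ q) z = (\<Sum>i<n. s i * wnd (e i) z)"
      using p(5) q(5) unfolding range by simp
    also have "\<dots> = (\<Sum>i<n. \<sigma> * ((if e i \<in> M then -1 else 1) * wnd (e i) z))"
      using s_eq by (intro sum.cong) auto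
    also have "\<dots> = \<sigma> * (\<Sum>i<n. (if e i \<in> M then -1 else 1) * wnd (e i) z)"
      by (simp add: sum_distrib_left)
    also have "(\<Sum>i<n. (if e i \<in> M then -1 else 1) * wnd (e i) z) = (\<Sum>x\<in>e ` {..<n}. (if x \<in> M then -1 else 1) * wnd x z)"
      using sum.reindex[OF cD(3), of "\<lambda>x. (if x \<in> M then -1 else 1) * wnd x z"] by (simp add: comp_def)
    also have "\<dots> = (\<Sum>x\<in>e ` {..<n} - M. wnd x z) - (\<Sum>x\<in>e ` {..<n} \<inter> M. wnd x z)"
    proof -
      have "(\<Sum>x\<in>X. (if x \<in> M then -1 else 1) * wnd x z) = (\<Sum>x\<in>X - M. wnd x z) - (\<Sum>x\<in>X \<inter> M. wnd x z)"
        if "finite X" for X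
        using sum.Int_Diff[OF that, of "\<lambda>x. (if x \<in> M then -1 else 1) * wnd x z" M]
        by (simp add: sum_negf)
      then show ?thesis by simp
    qed
    finally show ?thesis .
  qed
  have con: "connected (\<Union> (e ` {..<n} - {e 0}))"
    using minus p(4) connected_arc_image[OF p(1)] by simp
  have "\<sigma> = 1 \<or> \<sigma> = -1" by (auto simp: \<sigma>_def s_def)
  moreover have "pathfinish (p +++ q) = pathstart (p +++ q)" using p q by simp
  ultimately show ?thesis using that[OF sp _ img con _ w] by blast
qed

lemma circuit_jordan:
  assumes "alt_circuit G M E"
  shows "open (inside (\<Union>E))" "connected (inside (\<Union>E))" "inside (\<Union>E) \<noteq> {}" "bounded (inside (\<Union>E))"
    "open (outside (\<Union>E))" "connected (outside (\<Union>E))"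
    "inside (\<Union>E) \<union> outside (\<Union>E) = - \<Union>E" "inside (\<Union>E) \<inter> outside (\<Union>E) = {}"
    "frontier (inside (\<Union>E)) = \<Union>E" "frontier (outside (\<Union>E)) = \<Union>E" "connected (\<Union>E)"
    "\<not> bounded (outside (\<Union>E))"
proof -
  obtain n v e where c: "alt_cycle G M n v e" "E = e ` {..<n}"
    using assms by (auto simp: alt_circuit_def)
  obtain p where p: "simple_path p" "pathfinish p = pathstart p" "path_image p = \<Union>E"
    using circuit_curve[OF c(1)] c(2) by metis
  from Jordan_inside_outside[OF p(1,2)]
  show "open (inside (\<Union>E))" "connected (inside (\<Union>E))" "inside (\<Union>E) \<noteq> {}" "bounded (inside (\<Union>E))"
    "open (outside (\<Union>E))" "connected (outside (\<Union>E))"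
    "inside (\<Union>E) \<union> outside (\<Union>E) = - \<Union>E" "inside (\<Union>E) \<inter> outside (\<Union>E) = {}"
    "frontier (inside (\<Union>E)) = \<Union>E" "frontier (outside (\<Union>E)) = \<Union>E" "\<not> bounded (outside (\<Union>E))"
    unfolding p(3) by auto
  show "connected (\<Union>E)" using connected_simple_path_image[OF p(1)] p(3) by simp
qed

lemma circuit_minus_edge_connected:
  assumes "alt_circuit G M E" "x \<in> E"
  shows "connected (\<Union>(E - {x}))"
proof -
  obtain n v e where c: "alt_cycle G M n v e" "E = e ` {..<n}" "e 0 = x"
    using alt_circuit_start[OF assms] .
  then show ?thesis using circuit_curve[OF c(1)] by metis
qed

lemma circuit_sides:
  assumes "alt_circuit G M E" "connected X" "X \<inter> \<Union>E = {}"
  shows "X \<subseteq> inside (\<Union>E) \<or> X \<subseteq> outside (\<Union>E)"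
proof (rule ccontr)
  note J = circuit_jordan[OF assms(1)]
  assume "\<not> ?thesis"
  then have "inside (\<Union>E) \<inter> X \<noteq> {}" "outside (\<Union>E) \<inter> X \<noteq> {}" using J(7) assms(3) by blast+
  moreover have "inside (\<Union>E) \<inter> outside (\<Union>E) \<inter> X = {}" "X \<subseteq> inside (\<Union>E) \<union> outside (\<Union>E)"
    using J(7,8) assms(3) by blast+
  ultimately show False using connectedD[OF assms(2) J(1) J(5)] by blast
qed

lemma circuit_winding:
  assumes "alt_circuit G M E"
  obtains \<epsilon> :: int where "\<epsilon> = 1 \<or> \<epsilon> = -1"
    "\<And>z. z \<notin> \<Union>E \<Longrightarrow> (\<Sum>x\<in>E - M. wnd x z) - (\<Sum>x\<in>E \<inter> M. wnd x z) = (if z \<in> inside (\<Union>E) then of_int \<epsilon> else 0)"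
proof -
  obtain n v e where c: "alt_cycle G M n v e" "E = e ` {..<n}"
    using assms by (auto simp: alt_circuit_def)
  obtain p \<sigma> where p: "simple_path p" "pathfinish p = pathstart p" "path_image p = \<Union>E" "\<sigma> = 1 \<or> \<sigma> = (-1::complex)"
    and w: "\<And>z. z \<notin> \<Union>E \<Longrightarrow> winding_number p z = \<sigma> * ((\<Sum>x\<in>E - M. wnd x z) - (\<Sum>x\<in>E \<inter> M. wnd x z))"
    using circuit_curve[OF c(1)] c(2) by metis
  obtain \<delta> :: int where d: "\<delta> = 1 \<or> \<delta> = -1" "\<And>z. z \<in> inside (\<Union>E) \<Longrightarrow> winding_number p z = of_int \<delta>"
    using simple_closed_path_winding_number_inside[OF p(1)] unfolding p(3)
    by (metis of_int_1 of_int_minus)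
  obtain \<tau> :: int where t: "\<tau> = 1 \<or> \<tau> = -1" "\<sigma> = of_int \<tau>" using p(4) by (metis of_int_1 of_int_minus)
  have ss: "\<sigma> * \<sigma> = 1" using p(4) by auto
  have "(\<Sum>x\<in>E - M. wnd x z) - (\<Sum>x\<in>E \<inter> M. wnd x z) = (if z \<in> inside (\<Union>E) then of_int (\<tau> * \<delta>) else 0)"
    if z: "z \<notin> \<Union>E" for z
  proof -
    have "(\<Sum>x\<in>E - M. wnd x z) - (\<Sum>x\<in>E \<inter> M. wnd x z) = \<sigma> * winding_number p z"
      unfolding w[OF z] mult.assoc[symmetric] ss by simp
    moreover have "winding_number p z = 0" if "z \<notin> inside (\<Union>E)"
    proof -
      have "z \<in> outside (path_image p)" using that z circuit_jordan(7)[OF assms] unfolding p(3) by blast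
      then show ?thesis using winding_number_zero_in_outside p simple_path_imp_path by blast
    qed
    ultimately show ?thesis using d(2) t(2) by auto
  qed
  moreover have "\<tau> * \<delta> = 1 \<or> \<tau> * \<delta> = -1" using d(1) t(1) by auto
  ultimately show ?thesis using that by blast
qed

lemma height_add: "height M N z + height N K z = height M K z"
  by (simp add: height_def)

lemma height_flip:
  assumes "pm M" "alt_circuit G M E"
  shows "height (sym_diff M E) M z = (\<Sum>x\<in>E - M. wnd x z) - (\<Sum>x\<in>E \<inter> M. wnd x z)"
proof -
  have f: "finite M" "finite E"
    using pm_finite[OF assms(1)] alt_circuit_edges[OF assms(2)] fin finite_subset by auto
  have "(\<Sum>x\<in>sym_diff M E. wnd x z) = (\<Sum>x\<in>M - E. wnd x z) + (\<Sum>x\<in>E - M. wnd x z)"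
    using f by (intro sum.union_disjoint) auto
  moreover have "(\<Sum>x\<in>M. wnd x z) = (\<Sum>x\<in>M \<inter> E. wnd x z) + (\<Sum>x\<in>M - E. wnd x z)"
    using sum.Int_Diff[OF f(1)] .
  ultimately show ?thesis by (simp add: height_def Int_commute)
qed

lemma height_flip_both:
  assumes "pm M" "pm N" "alt_circuit G M E" "E \<subseteq> sym_diff M N"
  shows "alt_circuit G N E" "height (sym_diff N E) N z = - height (sym_diff M E) M z"
proof -
  show c: "alt_circuit G N E" by (rule alt_circuit_compl[OF assms(3)]) (use assms(4) in auto)
  have "E - N = E \<inter> M" "E \<inter> N = E - M" using assms(4) by auto
  then show "height (sym_diff N E) N z = - height (sym_diff M E) M z"
    using height_flip[OF assms(2) c] height_flip[OF assms(1,3)] by simp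
qed

text \<open>Rotate the circuits of the difference one by one.  Each contributes a constant to the points
  inside and nothing to those outside, and a connected set that avoids the circuit lies on one
  side of it.\<close>

lemma height_locally_constant:
  assumes "pm M" "pm N" "connected X" "X \<inter> \<Union>(sym_diff M N) = {}"
  shows "\<exists>k::int. (\<forall>z\<in>X. height M N z = of_int k) \<and> (\<not> bounded X \<longrightarrow> k = 0)"
  using assms(1,4)
proof (induction "card (sym_diff M N)" arbitrary: M rule: less_induct)
  case less
  show ?case
  proof (cases "M = N")
    case True
    then show ?thesis by (intro exI[of _ 0]) (simp add: height_def)
  next
    case False
    then obtain e where "e \<in> sym_diff M N" by auto
    then obtain E where E: "alt_circuit G M E" "E \<subseteq> sym_diff M N" "e \<in> E"
      using sym_diff_circuit[OF less.prems(1) assms(2)] by metis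
    define M' where "M' = sym_diff M E"
    have M': "pm M'" unfolding M'_def by (rule perfect_matching_flip[OF less.prems(1) E(1)])
    have sd: "sym_diff M' N = sym_diff M N - E" using E(2) unfolding M'_def by blast
    have fin': "finite (sym_diff M N)" using pm_finite less.prems(1) assms(2) by auto
    have "card (sym_diff M' N) < card (sym_diff M N)"
      unfolding sd using E fin' by (intro psubset_card_mono) auto
    moreover have "X \<inter> \<Union>(sym_diff M' N) = {}" using less.prems(2) unfolding sd by blast
    ultimately obtain k where k: "\<forall>z\<in>X. height M' N z = of_int k" "\<not> bounded X \<longrightarrow> k = 0"
      using less.hyps M' by blast
    have XE: "X \<inter> \<Union>E = {}" using less.prems(2) E(2) by blast
    obtain \<epsilon> :: int where ep: "\<And>z. z \<notin> \<Union>E \<Longrightarrow> (\<Sum>x\<in>E - M. wnd x z) - (\<Sum>x\<in>E \<inter> M. wnd x z)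
        = (if z \<in> inside (\<Union>E) then of_int \<epsilon> else 0)"
      using circuit_winding[OF E(1)] by metis
    have hM: "height M N z = of_int k - (if z \<in> inside (\<Union>E) then of_int \<epsilon> else 0)" if "z \<in> X" for z
    proof -
      have "height M N z = height M' N z - height M' M z" by (simp add: height_def)
      moreover have "z \<notin> \<Union>E" using XE that by blast
      ultimately show ?thesis
        using k(1) that ep height_flip[OF less.prems(1) E(1), of z] unfolding M'_def by simp
    qed
    consider "X \<subseteq> inside (\<Union>E)" | "X \<subseteq> outside (\<Union>E)" using circuit_sides[OF E(1) assms(3) XE] by blast
    then show ?thesis
    proof cases
      case 1
      then have "bounded X" using circuit_jordan(4)[OF E(1)] bounded_subset by blast
      then show ?thesis using hM 1 by (intro exI[of _ "k - \<epsilon>"]) auto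
    next
      case 2
      then have "z \<notin> inside (\<Union>E)" if "z \<in> X" for z using circuit_jordan(8)[OF E(1)] that by blast
      then show ?thesis using hM k(2) by (intro exI[of _ k]) auto
    qed
  qed
qed

section \<open>The two faces along an edge\<close>

lemma faces_eq: "faces G = components (- drawing)"
  by (simp add: faces_def drawing_def)

lemma face_open: "f \<in> faces G \<Longrightarrow> open f"
  using compact_drawing by (metis faces_eq open_components compact_imp_closed open_Compl)

lemma face_connected: "f \<in> faces G \<Longrightarrow> connected f"
  by (metis faces_eq in_components_connected)

lemma face_nonempty: "f \<in> faces G \<Longrightarrow> f \<noteq> {}"
  by (metis faces_eq in_components_nonempty)

lemma face_drawing: "f \<in> faces G \<Longrightarrow> f \<inter> drawing = {}"
  using in_components_subset unfolding faces_eq by blast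

lemma face_eq: "f \<in> faces G \<Longrightarrow> g \<in> faces G \<Longrightarrow> f \<inter> g \<noteq> {} \<Longrightarrow> f = g"
  unfolding faces_eq by (metis components_eq)

lemma face_frontier: "f \<in> faces G \<Longrightarrow> frontier f \<subseteq> drawing"
  using frontier_of_components_closed_complement compact_drawing unfolding faces_eq
  by (metis compact_imp_closed)

lemma face_edges: "f \<in> faces G \<Longrightarrow> E \<subseteq> edges G \<Longrightarrow> f \<inter> \<Union>E = {}"
  using face_drawing by (auto simp: drawing_def)

lemma face_circuit_sides:
  assumes "alt_circuit G M E" "f \<in> faces G"
  shows "f \<subseteq> inside (\<Union>E) \<or> f \<subseteq> outside (\<Union>E)"
  using circuit_sides[OF assms(1) face_connected[OF assms(2)]] face_edges[OF assms(2) alt_circuit_edges[OF assms(1)]]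
  by blast

text \<open>The two faces and the open edge form an open connected set; this is what makes heights
  comparable across the edge, and it shows that no third face comes near the open edge.\<close>

definition sides :: "complex set \<Rightarrow> complex set \<Rightarrow> complex set \<Rightarrow> bool" where
  "sides e f g \<longleftrightarrow> e \<in> edges G \<and> f \<in> faces G \<and> g \<in> faces G \<and> f \<noteq> g \<and>
     open (f \<union> g \<union> inner e) \<and> connected (f \<union> g \<union> inner e) \<and> e \<subseteq> frontier f \<and> e \<subseteq> frontier g"

text \<open>Let \<open>H\<close> be the drawing without the open edge, and \<open>U\<close> the component of its complement around the
  open edge.  The circuit and \<open>H\<close> meet in the rest of the circuit, which is connected.  So by
  Janiszewski's theorem two points of \<open>U\<close> on the same side of the circuit are not separated by the
  drawing: the two faces are the parts of \<open>U\<close> inside and outside the circuit.\<close>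

lemma edge_sides_circuit:
  assumes E: "alt_circuit G M E" and e: "e \<in> E"
  obtains f g where "sides e f g"
proof -
  note J = circuit_jordan[OF E]
  have eG: "e \<in> edges G" using alt_circuit_edges[OF E] e by auto
  let ?C = "\<Union>E"
  define H where "H = verts G \<union> \<Union>(edges G - {e})"
  have "compact H" unfolding H_def
    using fin by (intro compact_Un compact_Union_edges finite_imp_compact) auto
  then have clH: "closed H" by (rule compact_imp_closed)
  have CH: "?C \<union> H = drawing" using alt_circuit_edges[OF E] eG e unfolding H_def drawing_def by blast
  have inH: "inner e \<subseteq> - H" using inner_disjoint[OF eG] by (auto simp: H_def inner_def)
  have eH: "e - H \<subseteq> inner e" by (auto simp: H_def inner_def)
  have int: "?C \<inter> H = \<Union>(E - {e})"
  proof
    show "\<Union>(E - {e}) \<subseteq> ?C \<inter> H" using alt_circuit_edges[OF E] by (auto simp: H_def)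
    show "?C \<inter> H \<subseteq> \<Union>(E - {e})"
    proof
      fix x assume x: "x \<in> ?C \<inter> H"
      then obtain y where y: "y \<in> E" "x \<in> y" by auto
      show "x \<in> \<Union>(E - {e})"
      proof (cases "y = e")
        case True
        then have xe: "x \<in> e" using y by simp
        then have "x \<in> verts G" using x inH by (auto simp: inner_def)
        then have "x \<in> ends G e" using xe by (auto simp: ends_def)
        then obtain y1 y2 where "y1 \<in> E" "y1 \<in> M" "x \<in> ends G y1" "y2 \<in> E" "y2 \<notin> M" "x \<in> ends G y2"
          using alt_circuit_vertex[OF E e, of x] by metis
        then show ?thesis by (cases "y1 = e") (auto simp: ends_def)
      qed (use y in auto)
    qed
  qed
  have conC: "connected (?C \<inter> H)" unfolding int by (rule circuit_minus_edge_connected[OF E e])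
  have compC: "compact ?C" using compact_Union_edges alt_circuit_edges[OF E] by blast
  obtain x0 where x0: "x0 \<in> inner e" using inner_nonempty[OF eG] by blast
  define U where "U = connected_component_set (- H) x0"
  have U: "open U" "connected U" "U \<subseteq> - H" "x0 \<in> U"
    using clH x0 inH unfolding U_def
    by (auto simp: open_connected_component open_Compl connected_component_subset)
  have inU: "inner e \<subseteq> U" unfolding U_def
    using connected_component_maximal[OF x0 inner_connected[OF eG] inH] .
  have face: "U \<inter> X \<in> faces G"
    if X: "X = inside ?C \<or> X = outside ?C" and ne: "U \<inter> X \<noteq> {}" for X
  proof -
    obtain a where a: "a \<in> U" "a \<in> X" using ne by blast
    have Xc: "connected X" "X \<subseteq> - ?C" using X J(2,6,7) by blast+
    define K where "K = connected_component_set (- drawing) a"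
    have ad: "a \<notin> drawing" using a U(3) Xc(2) CH by blast
    have "U \<inter> X \<subseteq> K"
    proof
      fix b assume b: "b \<in> U \<inter> X"
      have "connected_component (- ?C) a b"
        using Xc a b unfolding connected_component_def by blast
      moreover have "connected_component (- H) a b"
        using U(2,3) a b unfolding connected_component_def by blast
      ultimately have "connected_component (- (?C \<union> H)) a b"
        using Janiszewski[OF compC clH conC] by blast
      then show "b \<in> K" unfolding CH K_def by simp
    qed
    moreover have "K \<subseteq> U \<inter> X"
    proof
      fix b assume b: "b \<in> K"
      have K: "connected K" "K \<subseteq> - drawing" "a \<in> K"
        using ad unfolding K_def by (auto simp: connected_component_subset)
      have "K \<subseteq> - H" "K \<inter> ?C = {}" using K(2) CH by auto
      moreover have "a \<in> connected_component_set (- H) x0" using a(1) unfolding U_def .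
      ultimately have "K \<subseteq> U" unfolding U_def
        using K connected_component_maximal[of a K "- H"] connected_component_eq[of a "- H" x0] by auto
      moreover have "K \<subseteq> X"
        using circuit_sides[OF E K(1) \<open>K \<inter> ?C = {}\<close>] K(3) a(2) X J(8) by blast
      ultimately show "b \<in> U \<inter> X" using b by blast
    qed
    ultimately have "U \<inter> X = K" by blast
    then show ?thesis unfolding faces_eq K_def using ad by (simp add: componentsI)
  qed
  have meets: "inner e \<subseteq> closure (U \<inter> X)" if "frontier X = ?C" for X
  proof
    fix x assume x: "x \<in> inner e"
    then have "x \<in> ?C" using e by (auto simp: inner_def)
    then have "x \<in> closure X" using that by (auto simp: frontier_def)
    then show "x \<in> closure (U \<inter> X)" using open_Int_closure_subset[OF U(1), of X] x inU by blast
  qed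
  have front: "e \<subseteq> frontier (U \<inter> X)" if X: "X = inside ?C \<or> X = outside ?C" and F: "U \<inter> X \<in> faces G" for X
  proof -
    have "frontier X = ?C" using X J by auto
    then have "closure (inner e) \<subseteq> closure (U \<inter> X)" 
      using closure_minimal[OF meets closed_closure] by simp
    then have "e \<subseteq> closure (U \<inter> X)" using inner_closure[OF eG] by blast
    moreover have "e \<inter> (U \<inter> X) = {}" using face_drawing[OF F] eG by (auto simp: drawing_def)
    ultimately show ?thesis unfolding frontier_def interior_open[OF face_open[OF F]] by blast
  qed
  have nonempty: "U \<inter> X \<noteq> {}" if "frontier X = ?C" for X
    using meets[OF that] x0 by auto
  let ?f = "U \<inter> inside ?C" and ?g = "U \<inter> outside ?C"
  have f: "?f \<in> faces G" "?g \<in> faces G" 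
    by (auto intro!: face nonempty[OF J(9)] nonempty[OF J(10)])
  have "?f \<union> ?g \<union> inner e = U"
  proof
    show "U \<subseteq> ?f \<union> ?g \<union> inner e"
    proof
      fix x assume x: "x \<in> U"
      then have "x \<notin> H" using U(3) by auto
      show "x \<in> ?f \<union> ?g \<union> inner e"
      proof (cases "x \<in> ?C")
        case True
        then have "x \<in> e" using \<open>x \<notin> H\<close> int by blast
        then show ?thesis using eH \<open>x \<notin> H\<close> by blast
      next
        case False
        then show ?thesis using x J(7) by blast
      qed
    qed
  qed (use inU in blast)
  moreover have "?f \<noteq> ?g" using face_nonempty[OF f(1)] J(8) by blast
  ultimately have "sides e ?f ?g"
    unfolding sides_def using eG f front U(1,2) by simp
  then show ?thesis using that by blast
qed

lemma sides_commute: "sides e f g \<Longrightarrow> sides e g f"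
  by (auto simp: sides_def Un_commute)

lemma sides_only:
  assumes "sides e f g" "x \<in> faces G" "frontier x \<inter> inner e \<noteq> {}"
  shows "x = f \<or> x = g"
proof -
  have o: "open (f \<union> g \<union> inner e)" using assms(1) by (simp add: sides_def)
  obtain p where p: "p \<in> inner e" "p \<in> closure x" using assms(3) by (auto simp: frontier_def)
  have "(f \<union> g \<union> inner e) \<inter> x \<noteq> {}"
    using open_Int_closure_eq_empty[OF o, of x] p by blast
  moreover have "inner e \<inter> x = {}"
    using face_drawing[OF assms(2)] assms(1) by (auto simp: sides_def drawing_def inner_def)
  ultimately have "f \<inter> x \<noteq> {} \<or> g \<inter> x \<noteq> {}" by blast
  then show ?thesis using face_eq assms by (auto simp: sides_def)
qed

lemma sides_iff:
  assumes "sides e f g" "x \<in> faces G"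
  shows "e \<subseteq> frontier x \<longleftrightarrow> x = f \<or> x = g"
proof
  assume "e \<subseteq> frontier x"
  moreover have "inner e \<noteq> {}" "inner e \<subseteq> e" using inner_nonempty assms(1) by (auto simp: sides_def inner_def)
  ultimately show "x = f \<or> x = g" using sides_only[OF assms] by blast
qed (use assms in \<open>auto simp: sides_def\<close>)

text \<open>The circuit is the frontier both of its inside and of its outside, so both have points in
  every neighbourhood of the open edge.\<close>

lemma sides_circuit:
  assumes s: "sides e f g" and E: "alt_circuit G M E" and e: "e \<in> E"
  shows "f \<subseteq> inside (\<Union>E) \<longleftrightarrow> \<not> g \<subseteq> inside (\<Union>E)"
proof -
  note J = circuit_jordan[OF E]
  let ?C = "\<Union>E"
  have fg: "f \<in> faces G" "g \<in> faces G" "open (f \<union> g \<union> inner e)" "e \<in> edges G" using s by (auto simp: sides_def)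
  obtain x0 where x0: "x0 \<in> inner e" using inner_nonempty[OF fg(4)] by blast
  then have x0C: "x0 \<in> ?C" using e by (auto simp: inner_def)
  have meet: "(f \<union> g) \<inter> X \<noteq> {}" if "frontier X = ?C" "X \<inter> ?C = {}" for X
  proof -
    have "x0 \<in> closure X" using that x0C by (auto simp: frontier_def)
    then have "(f \<union> g \<union> inner e) \<inter> X \<noteq> {}" using open_Int_closure_eq_empty[OF fg(3), of X] x0 by blast
    moreover have "inner e \<subseteq> ?C" using e by (auto simp: inner_def)
    ultimately show ?thesis using that(2) by blast
  qed
  have "(f \<union> g) \<inter> inside ?C \<noteq> {}" "(f \<union> g) \<inter> outside ?C \<noteq> {}"
    using meet[of "inside ?C"] meet[of "outside ?C"] J(7,9,10) by blast+
  moreover have "f \<noteq> {}" "g \<noteq> {}" using face_nonempty fg by auto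
  ultimately show ?thesis
    using face_circuit_sides[OF E fg(1)] face_circuit_sides[OF E fg(2)] J(8) by blast
qed

end

section \<open>Matchings of the graph without a set of vertices\<close>

context bip_graph begin

lemma pm_delete_verts:
  assumes K: "pm K" and cl: "\<And>k. k \<in> K \<Longrightarrow> ends G k \<inter> X \<noteq> {} \<Longrightarrow> ends G k \<subseteq> X"
  shows "perfect_matching (delete_verts G X) {k \<in> K. ends G k \<inter> X = {}}"
  unfolding perfect_matching_def
proof (intro conjI ballI)
  show "{k \<in> K. ends G k \<inter> X = {}} \<subseteq> edges (delete_verts G X)"
    using K by (auto simp: delete_verts_def perfect_matching_def)
  fix w assume "w \<in> verts (delete_verts G X)"
  then have w: "w \<in> verts G" "w \<notin> X" by (auto simp: delete_verts_def)
  have "ends (delete_verts G X) k = ends G k" if "ends G k \<inter> X = {}" for k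
    using that by (auto simp: ends_def delete_verts_def)
  moreover have "\<exists>!k. k \<in> K \<and> w \<in> ends G k" using K w by (auto simp: perfect_matching_def)
  moreover have "ends G k \<inter> X = {}" if "k \<in> K" "w \<in> ends G k" for k
    using cl[OF that(1)] that(2) w(2) by blast
  ultimately have "k \<in> {k \<in> K. ends G k \<inter> X = {}} \<and> w \<in> ends (delete_verts G X) k \<longleftrightarrow> k \<in> K \<and> w \<in> ends G k" for k
    by blast
  then show "\<exists>!k. k \<in> {k \<in> K. ends G k \<inter> X = {}} \<and> w \<in> ends (delete_verts G X) k"
    using \<open>\<exists>!k. k \<in> K \<and> w \<in> ends G k\<close> by simp
qed

text \<open>A matching of the smaller graph is completed by the edges of \<open>K\<close> within the deleted set.\<close>

lemma pm_extend:
  assumes K: "pm K" and cl: "\<And>k. k \<in> K \<Longrightarrow> ends G k \<inter> X \<noteq> {} \<Longrightarrow> ends G k \<subseteq> X"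
    and L: "perfect_matching (delete_verts G X) L"
  shows "pm (L \<union> {k \<in> K. ends G k \<inter> X \<noteq> {}})"
  unfolding perfect_matching_def
proof (intro conjI ballI)
  have Ls: "\<And>k. k \<in> L \<Longrightarrow> k \<in> edges G \<and> ends G k \<inter> X = {}"
    using L by (auto simp: perfect_matching_def delete_verts_def)
  show "L \<union> {k \<in> K. ends G k \<inter> X \<noteq> {}} \<subseteq> edges G"
    using K Ls by (auto simp: perfect_matching_def)
  fix w assume w: "w \<in> verts G"
  have Kw: "\<exists>!k. k \<in> K \<and> w \<in> ends G k" using K w by (auto simp: perfect_matching_def)
  show "\<exists>!k. k \<in> L \<union> {k \<in> K. ends G k \<inter> X \<noteq> {}} \<and> w \<in> ends G k"
  proof (cases "w \<in> X")
    case True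
    then have "k \<in> L \<union> {k \<in> K. ends G k \<inter> X \<noteq> {}} \<and> w \<in> ends G k \<longleftrightarrow> k \<in> K \<and> w \<in> ends G k" for k
      using Ls by blast
    then show ?thesis using Kw by simp
  next
    case False
    have "w \<in> verts (delete_verts G X)" using w False by (simp add: delete_verts_def)
    then have "\<exists>!k. k \<in> L \<and> w \<in> ends (delete_verts G X) k" using L by (auto simp: perfect_matching_def)
    moreover have "w \<in> ends (delete_verts G X) k \<longleftrightarrow> w \<in> ends G k" if "k \<in> L" for k
      using w False by (auto simp: ends_def delete_verts_def)
    moreover have "k \<in> L \<union> {k \<in> K. ends G k \<inter> X \<noteq> {}} \<and> w \<in> ends G k \<longleftrightarrow> k \<in> L \<and> w \<in> ends G k" for k
      using cl False by blast
    ultimately show ?thesis by (simp cong: conj_cong)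
  qed
qed

lemma alt_circuit_closed:
  assumes E: "alt_circuit G K E" and K: "pm K" and k: "k \<in> K" "ends G k \<inter> \<Union>E \<noteq> {}"
  shows "k \<in> E"
proof -
  obtain w x where w: "w \<in> ends G k" "x \<in> E" "w \<in> x" using k by auto
  then have "w \<in> ends G x" by (auto simp: ends_def)
  then obtain y where y: "y \<in> E" "y \<in> K" "w \<in> ends G y" using alt_circuit_vertex(1)[OF E w(2)] by blast
  then have "y = k" using medge_eq[OF K] k w by metis
  then show ?thesis using y by simp
qed

end

section \<open>Heights of faces\<close>

text \<open>Elementarity enters in the form that every edge lies in some perfect matching and is missing
  from another one.\<close>

locale plane_elem = plane_bip +
  fixes F0 :: "complex set"
  assumes allowed: "\<And>e. e \<in> edges G \<Longrightarrow> \<exists>M. pm M \<and> e \<in> M"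
    and avoidable: "\<And>e. e \<in> edges G \<Longrightarrow> \<exists>M. pm M \<and> e \<notin> M"
    and conn: "connected_graph G" and edges_nonempty: "edges G \<noteq> {}"
    and F0: "F0 \<in> faces G" "\<not> bounded F0" "forcing_face G F0"
begin

lemma edge_separated:
  assumes "e \<in> edges G"
  obtains M N where "pm M" "pm N" "e \<in> M" "e \<notin> N"
  using allowed[OF assms] avoidable[OF assms] by blast

lemma edge_sides:
  assumes "e \<in> edges G"
  obtains f g where "sides e f g"
proof -
  obtain M N where MN: "pm M" "pm N" "e \<in> M" "e \<notin> N" using edge_separated[OF assms] .
  then obtain E where "alt_circuit G M E" "e \<in> E" using sym_diff_circuit[of M N e] by blast
  then show ?thesis using edge_sides_circuit that by blast
qed

lemma frontier_inner:
  assumes "f \<in> faces G" "e \<in> edges G" "frontier f \<inter> inner e \<noteq> {}"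
  shows "e \<subseteq> frontier f"
proof -
  obtain a b where ab: "sides e a b" using edge_sides[OF assms(2)] .
  then show ?thesis using sides_only[OF ab assms(1,3)] sides_iff[OF ab assms(1)] by simp
qed

text \<open>Otherwise the frontier of the face would be a set of vertices.  As a finite set does not
  disconnect the plane, the face would then contain every point that is not a vertex.\<close>

lemma face_has_edge:
  assumes f: "f \<in> faces G"
  shows "\<exists>e\<in>edges G. e \<subseteq> frontier f"
proof (rule ccontr)
  assume "\<not> ?thesis"
  then have no: "frontier f \<inter> inner e = {}" if "e \<in> edges G" for e
    using frontier_inner[OF f] that by blast
  have sub: "frontier f \<subseteq> verts G" using face_frontier[OF f] no unfolding drawing_decomp by blast
  have con: "connected (- verts G)"
    using fin(1) by (intro path_connected_imp_connected path_connected_complement_countable countable_finite) auto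
  obtain e where e: "e \<in> edges G" using edges_nonempty by blast
  obtain x where x: "x \<in> inner e" using inner_nonempty[OF e] by blast
  have "x \<in> drawing" using x e by (auto simp: drawing_def inner_def)
  then have "x \<in> - verts G - f" using x face_drawing[OF f] by (auto simp: inner_def)
  moreover have "- verts G \<inter> f \<noteq> {}" using face_nonempty[OF f] face_drawing[OF f] by (auto simp: drawing_def)
  ultimately have "- verts G \<inter> frontier f \<noteq> {}" using connected_Int_frontier[OF con] by blast
  then show False using sub by blast
qed

lemma finite_faces_all: "finite (faces G)"
proof -
  have "\<exists>S. finite S \<and> (\<forall>f\<in>faces G. e \<subseteq> frontier f \<longrightarrow> f \<in> S)" if e: "e \<in> edges G" for e
  proof -
    obtain a b where ab: "sides e a b" using edge_sides[OF e] .
    show ?thesis by (rule exI[of _ "{a, b}"]) (use sides_iff[OF ab] in auto)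
  qed
  then obtain S where S: "\<And>e. e \<in> edges G \<Longrightarrow> finite (S e) \<and> (\<forall>f\<in>faces G. e \<subseteq> frontier f \<longrightarrow> f \<in> S e)"
    by metis
  have sub: "faces G \<subseteq> (\<Union>e\<in>edges G. S e)"
  proof
    fix f assume f: "f \<in> faces G"
    then obtain e where "e \<in> edges G" "e \<subseteq> frontier f" using face_has_edge[OF f] by blast
    then show "f \<in> (\<Union>e\<in>edges G. S e)" using S[of e] f by auto
  qed
  have "finite (\<Union>e\<in>edges G. S e)" using S fin(2) by blast
  then show ?thesis using sub finite_subset by blast
qed

text \<open>Well defined by \<open>height_locally_constant\<close>.\<close>

definition hgt :: "complex set set \<Rightarrow> complex set set \<Rightarrow> complex set \<Rightarrow> int" where
  "hgt M N f = (THE k. \<forall>z\<in>f. height M N z = of_int k)"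

lemma hgt:
  assumes "pm M" "pm N" "f \<in> faces G" "z \<in> f"
  shows "height M N z = of_int (hgt M N f)"
proof -
  have "sym_diff M N \<subseteq> edges G" using assms by (auto simp: perfect_matching_def)
  then have "f \<inter> \<Union>(sym_diff M N) = {}" by (rule face_edges[OF assms(3)])
  then obtain k :: int where k: "\<forall>z\<in>f. height M N z = of_int k"
    using height_locally_constant[OF assms(1,2) face_connected[OF assms(3)]] by blast
  have "hgt M N f = k" unfolding hgt_def
  proof (rule the_equality)
    show "\<forall>z\<in>f. height M N z = of_int k" by (rule k)
    fix k' :: int assume "\<forall>z\<in>f. height M N z = of_int k'"
    then show "k' = k" using k assms(4) by (metis of_int_eq_iff)
  qed
  then show ?thesis using k assms by simp
qed

lemma hgt_eqI:
  assumes "pm M" "pm N" "f \<in> faces G" "\<And>z. z \<in> f \<Longrightarrow> height M N z = of_int k"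
  shows "hgt M N f = k"
  using face_nonempty[OF assms(3)] hgt[OF assms(1-3)] assms(4) by (metis ex_in_conv of_int_eq_iff)

lemma hgt_add:
  assumes "pm M" "pm N" "pm K" "f \<in> faces G"
  shows "hgt M N f + hgt N K f = hgt M K f"
proof -
  have "height M K z = of_int (hgt M N f + hgt N K f)" if "z \<in> f" for z
    using hgt[OF assms(1,2,4) that] hgt[OF assms(2,3,4) that] height_add[of M N z K] by simp
  then show ?thesis using hgt_eqI[OF assms(1,3,4), of "hgt M N f + hgt N K f"] by metis
qed

lemma hgt_self: "pm M \<Longrightarrow> f \<in> faces G \<Longrightarrow> hgt M M f = 0"
  using hgt_add[of M M M f] by simp

lemma hgt_swap: "pm M \<Longrightarrow> pm N \<Longrightarrow> f \<in> faces G \<Longrightarrow> hgt N M f = - hgt M N f"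
  using hgt_add[of M N M f] hgt_self[of M f] by simp

lemma hgt_F0:
  assumes "pm M" "pm N"
  shows "hgt M N F0 = 0"
proof -
  have "sym_diff M N \<subseteq> edges G" using assms by (auto simp: perfect_matching_def)
  then have "F0 \<inter> \<Union>(sym_diff M N) = {}" by (rule face_edges[OF F0(1)])
  then show ?thesis
    using height_locally_constant[OF assms face_connected[OF F0(1)]] F0(2) hgt_eqI[OF assms F0(1)] by metis
qed

lemma hgt_no_jump:
  assumes "pm M" "pm N" "sides e f g" "e \<notin> sym_diff M N"
  shows "hgt M N f = hgt M N g"
proof -
  have s: "f \<in> faces G" "g \<in> faces G" "connected (f \<union> g \<union> inner e)" "e \<in> edges G" using assms(3) by (auto simp: sides_def)
  have sub: "sym_diff M N \<subseteq> edges G" using assms by (auto simp: perfect_matching_def)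
  have "inner e \<inter> \<Union>(sym_diff M N) = {}"
    using inner_disjoint[OF s(4)] sub assms(4) by blast
  then have "(f \<union> g \<union> inner e) \<inter> \<Union>(sym_diff M N) = {}"
    using face_edges[OF s(1) sub] face_edges[OF s(2) sub] by blast
  then obtain k :: int where "\<forall>z\<in>f \<union> g \<union> inner e. height M N z = of_int k"
    using height_locally_constant[OF assms(1,2) s(3)] by blast
  then have "hgt M N f = k" "hgt M N g = k" using hgt_eqI assms s by auto
  then show ?thesis by simp
qed

lemma hgt_flip:
  assumes "pm M" "alt_circuit G M E"
  obtains \<epsilon> where "\<epsilon> = 1 \<or> \<epsilon> = -1"
    "\<And>f. f \<in> faces G \<Longrightarrow> hgt (sym_diff M E) M f = (if f \<subseteq> inside (\<Union>E) then \<epsilon> else 0)"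
proof -
  obtain \<epsilon> :: int where ep: "\<epsilon> = 1 \<or> \<epsilon> = -1" "\<And>z. z \<notin> \<Union>E \<Longrightarrow> (\<Sum>x\<in>E - M. wnd x z) - (\<Sum>x\<in>E \<inter> M. wnd x z)
        = (if z \<in> inside (\<Union>E) then of_int \<epsilon> else 0)"
    using circuit_winding[OF assms(2)] by metis
  have "hgt (sym_diff M E) M f = (if f \<subseteq> inside (\<Union>E) then \<epsilon> else 0)" if f: "f \<in> faces G" for f
  proof (rule hgt_eqI[OF perfect_matching_flip[OF assms] assms(1) f])
    fix z assume z: "z \<in> f"
    then have "z \<notin> \<Union>E" using face_edges[OF f alt_circuit_edges[OF assms(2)]] by blast
    moreover have "z \<in> inside (\<Union>E) \<longleftrightarrow> f \<subseteq> inside (\<Union>E)"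
      using face_circuit_sides[OF assms(2) f] circuit_jordan(8)[OF assms(2)] z by blast
    ultimately show "height (sym_diff M E) M z = of_int (if f \<subseteq> inside (\<Union>E) then \<epsilon> else 0)"
      using height_flip[OF assms] ep(2) by simp
  qed
  with ep(1) show ?thesis using that by blast
qed

lemma hgt_flip_both:
  assumes "pm M" "pm N" "alt_circuit G M E" "E \<subseteq> sym_diff M N" "f \<in> faces G"
  shows "hgt (sym_diff N E) N f = - hgt (sym_diff M E) M f"
proof -
  note c = height_flip_both[OF assms(1-4)]
  note p = perfect_matching_flip[OF assms(1,3)] perfect_matching_flip[OF assms(2) c(1)]
  show ?thesis
    using hgt_eqI[OF p(2) assms(2,5), of "- hgt (sym_diff M E) M f"] c(2) hgt[OF p(1) assms(1,5)] by simp
qed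

text \<open>Only the circuit through the edge contributes to the jump, and the edge has one of its faces
  inside and the other one outside that circuit.\<close>

lemma hgt_jump:
  assumes "pm M" "pm N" "sides e f g" "e \<in> sym_diff M N"
  shows "\<bar>hgt M N f - hgt M N g\<bar> = 1"
proof -
  obtain E where E: "alt_circuit G M E" "E \<subseteq> sym_diff M N" "e \<in> E"
    using sym_diff_circuit[OF assms(1,2,4)] .
  have s: "f \<in> faces G" "g \<in> faces G" using assms(3) by (auto simp: sides_def)
  let ?M = "sym_diff M E"
  have pm': "pm ?M" by (rule perfect_matching_flip[OF assms(1) E(1)])
  have "e \<notin> sym_diff ?M N" using E(2,3) assms(4) by blast
  then have "hgt ?M N f = hgt ?M N g" by (rule hgt_no_jump[OF pm' assms(2,3)])
  moreover obtain \<epsilon> where "\<epsilon> = 1 \<or> \<epsilon> = -1"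
    "\<And>f. f \<in> faces G \<Longrightarrow> hgt ?M M f = (if f \<subseteq> inside (\<Union>E) then \<epsilon> else 0)"
    using hgt_flip[OF assms(1) E(1)] by metis
  moreover have "hgt M N x = hgt ?M N x - hgt ?M M x" if "x \<in> faces G" for x
    using hgt_add[OF pm' assms(1,2) that] by simp
  ultimately have "hgt M N f - hgt M N g = hgt ?M M g - hgt ?M M f" "\<epsilon> = 1 \<or> \<epsilon> = -1"
    "hgt ?M M f = (if f \<subseteq> inside (\<Union>E) then \<epsilon> else 0)" "hgt ?M M g = (if g \<subseteq> inside (\<Union>E) then \<epsilon> else 0)"
    using s by auto
  then show ?thesis using sides_circuit[OF assms(3) E(1,3)] by (cases "f \<subseteq> inside (\<Union>E)") auto
qed

text \<open>The pairs \<open>M\<close>, \<open>M'\<close> and \<open>N\<close>, \<open>N'\<close> agree on the edge, so that exchanging one for the other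
  does not change the jump.\<close>

lemma hgt_jump_sign:
  assumes "pm M" "pm N" "pm M'" "pm N'" "sides e f g" "e \<in> M" "e \<notin> N" "e \<in> M'" "e \<notin> N'"
  shows "hgt M N f - hgt M N g = hgt M' N' f - hgt M' N' g"
proof -
  have s: "f \<in> faces G" "g \<in> faces G" using assms(5) by (auto simp: sides_def)
  have "hgt M M' f = hgt M M' g" "hgt N' N f = hgt N' N g"
    using hgt_no_jump[OF _ _ assms(5)] assms by auto
  moreover have "hgt M N x = hgt M M' x + hgt M' N' x + hgt N' N x" if "x \<in> faces G" for x
    using hgt_add[OF assms(1,3,2) that] hgt_add[OF assms(3,4,2) that] by simp
  ultimately show ?thesis using s by simp
qed

lemma hgt_inj:
  assumes "pm M" "pm N" "\<And>f. f \<in> faces G \<Longrightarrow> hgt M N f = 0"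
  shows "M = N"
proof (rule ccontr)
  assume "M \<noteq> N"
  then obtain e where e: "e \<in> sym_diff M N" by auto
  then have "e \<in> edges G" using assms by (auto simp: perfect_matching_def)
  then obtain f g where "sides e f g" using edge_sides by blast
  with hgt_jump[OF assms(1,2) this e] assms(3) show False by (auto simp: sides_def)
qed

lemma circuit_face_inside:
  assumes "alt_circuit G M E"
  obtains f where "f \<in> faces G" "f \<subseteq> inside (\<Union>E)"
proof -
  obtain e where e: "e \<in> E" using alt_circuit_nonempty[OF assms] by blast
  then obtain f g where s: "sides e f g" using edge_sides alt_circuit_edges[OF assms] by blast
  then show ?thesis using sides_circuit[OF s assms e] that by (auto simp: sides_def)
qed

text \<open>Choose a matching with the greatest (for \<open>\<sigma> = -1\<close>, the least) sum of heights.  Rotating any of its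
  circuits in the difference to \<open>M\<close> cannot improve the sum, so each of these circuits contributes
  with the right sign.\<close>

section \<open>The highest and the lowest perfect matching\<close>

lemma extremal_matching:
  fixes \<sigma> :: int
  assumes \<sigma>: "\<sigma> = 1 \<or> \<sigma> = -1"
  obtains M1 where "pm M1" "\<And>M f. pm M \<Longrightarrow> f \<in> faces G \<Longrightarrow> 0 \<le> \<sigma> * hgt M1 M f"
proof -
  obtain N0 where N0: "pm N0" using allowed edges_nonempty by blast
  define \<Phi> where "\<Phi> M = \<sigma> * (\<Sum>f\<in>faces G. hgt M N0 f)" for M
  have "finite (\<Phi> ` {M. pm M})" "\<Phi> ` {M. pm M} \<noteq> {}" using finite_pms N0 by auto
  then have "Max (\<Phi> ` {M. pm M}) \<in> \<Phi> ` {M. pm M}" "\<And>M. pm M \<Longrightarrow> \<Phi> M \<le> Max (\<Phi> ` {M. pm M})"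
    by auto
  then obtain M1 where M1: "pm M1" "\<And>M. pm M \<Longrightarrow> \<Phi> M \<le> \<Phi> M1" by (metis (no_types, lifting) imageE mem_Collect_eq)
  have "0 \<le> \<sigma> * hgt M1 M f" if "pm M" "f \<in> faces G" for M f
    using that
  proof (induction "card (sym_diff M1 M)" arbitrary: M rule: less_induct)
    case less
    show ?case
    proof (cases "M1 = M")
      case True
      then show ?thesis using hgt_self less.prems by simp
    next
      case False
      then obtain e where "e \<in> sym_diff M1 M" by auto
      then obtain E where E: "alt_circuit G M1 E" "E \<subseteq> sym_diff M1 M" "e \<in> E"
        using sym_diff_circuit[OF M1(1) less.prems(1)] by metis
      note EM = height_flip_both(1)[OF M1(1) less.prems(1) E(1,2)]
      let ?M = "sym_diff M E"
      have M': "pm ?M" by (rule perfect_matching_flip[OF less.prems(1) EM])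
      have sd: "sym_diff M1 ?M = sym_diff M1 M - E" using E(2) by blast
      have "card (sym_diff M1 ?M) < card (sym_diff M1 M)"
        unfolding sd using E pm_finite M1(1) less.prems(1) by (intro psubset_card_mono) auto
      then have IH: "0 \<le> \<sigma> * hgt M1 ?M f" using less.hyps M' less.prems(2) by blast
      have M1': "pm (sym_diff M1 E)" by (rule perfect_matching_flip[OF M1(1) E(1)])
      obtain \<epsilon> where ep: "\<epsilon> = 1 \<or> \<epsilon> = -1"
        "\<And>f. f \<in> faces G \<Longrightarrow> hgt (sym_diff M1 E) M1 f = (if f \<subseteq> inside (\<Union>E) then \<epsilon> else 0)"
        using hgt_flip[OF M1(1) E(1)] by metis
      have "\<sigma> * \<epsilon> \<le> 0"
      proof (rule ccontr)
        assume "\<not> \<sigma> * \<epsilon> \<le> 0"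
        then have se: "\<sigma> * \<epsilon> = 1" using \<sigma> ep(1) by auto
        have *: "hgt (sym_diff M1 E) N0 f = hgt M1 N0 f + (if f \<subseteq> inside (\<Union>E) then \<epsilon> else 0)" if "f \<in> faces G" for f
          using hgt_add[OF M1' M1(1) N0 that] ep(2)[OF that] by simp
        have "\<Phi> (sym_diff M1 E) = \<Phi> M1 + (\<Sum>f\<in>faces G. if f \<subseteq> inside (\<Union>E) then \<sigma> * \<epsilon> else 0)"
        proof -
          have "\<sigma> * hgt (sym_diff M1 E) N0 f = \<sigma> * hgt M1 N0 f + (if f \<subseteq> inside (\<Union>E) then \<sigma> * \<epsilon> else 0)"
            if "f \<in> faces G" for f
            using * [OF that] by (simp add: distrib_left)
          then show ?thesis unfolding \<Phi>_def sum_distrib_left by (simp add: sum.distrib)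
        qed
        moreover have "(\<Sum>f\<in>faces G. if f \<subseteq> inside (\<Union>E) then \<sigma> * \<epsilon> else 0) > 0"
        proof -
          obtain f where "f \<in> faces G" "f \<subseteq> inside (\<Union>E)" using circuit_face_inside[OF E(1)] .
          then show ?thesis using se finite_faces_all by (intro sum_pos2[of _ f]) auto
        qed
        ultimately show False using M1(2)[OF M1'] by simp
      qed
      moreover have "hgt ?M M f = - (if f \<subseteq> inside (\<Union>E) then \<epsilon> else 0)"
        using hgt_flip_both[OF M1(1) less.prems(1) E(1,2) less.prems(2)] ep(2) less.prems(2) by simp
      ultimately have "0 \<le> \<sigma> * hgt ?M M f" by simp
      moreover have "hgt M1 M f = hgt M1 ?M f + hgt ?M M f"
        using hgt_add[OF M1(1) M' less.prems] by simp
      ultimately show ?thesis using IH by (simp add: distrib_left)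
    qed
  qed
  then show ?thesis using M1(1) that by blast
qed

text \<open>An edge that is not in the circuit cannot cross it.\<close>

lemma inner_meets_side:
  assumes E: "alt_circuit G M E" and y: "y \<in> edges G" "y \<notin> E" and u: "u \<in> y" "u \<in> inside (\<Union>E)"
  shows "inner y \<subseteq> inside (\<Union>E)"
proof -
  have "inner y \<inter> \<Union>E = {}" using inner_disjoint[OF y(1)] alt_circuit_edges[OF E] y(2) by blast
  moreover have "inner y \<inter> inside (\<Union>E) \<noteq> {}"
    using open_Int_closure_eq_empty[OF circuit_jordan(1)[OF E], of "inner y"] inner_closure[OF y(1)] u by blast
  ultimately show ?thesis
    using circuit_sides[OF E inner_connected[OF y(1)]] circuit_jordan(8)[OF E] by blast
qed

text \<open>Across an edge \<open>e\<close> of the unbounded face the height of \<open>M1\<close> over \<open>M0\<close> does not stay 0, so \<open>e\<close>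
  lies on a circuit \<open>E\<close> of their difference.  The other circuits of the difference are disjoint
  from \<open>E\<close>; so their joint contribution to the height is constant along \<open>E\<close>, and it is zero as it is
  zero on the unbounded face.  Therefore any face that touches \<open>E\<close> from the outside has height 0.
  If an edge left \<open>E\<close> to the outside, both faces along it would have height 0, which is then also
  their height for any other pair of matchings, although the edge can be separated by two
  matchings.  By connectedness the whole graph lies on \<open>E\<close> and inside of it, so the outside of \<open>E\<close> is
  the unbounded face.\<close>

lemma extremal_matchings:
  obtains M0 M1 where "pm M0" "pm M1"
    "\<And>f. f \<in> faces G \<Longrightarrow> f \<noteq> F0 \<Longrightarrow> bounded f \<and> hgt M1 M0 f = 1"
    "\<And>M f. pm M \<Longrightarrow> f \<in> faces G \<Longrightarrow> 0 \<le> hgt M M0 f \<and> hgt M M0 f \<le> hgt M1 M0 f"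
proof -
  obtain M1 where M1: "pm M1" "\<And>M f. pm M \<Longrightarrow> f \<in> faces G \<Longrightarrow> 0 \<le> hgt M1 M f"
    using extremal_matching[of 1] by (metis mult_1)
  obtain M0 where M0: "pm M0" and M0': "\<And>M f. pm M \<Longrightarrow> f \<in> faces G \<Longrightarrow> 0 \<le> - hgt M0 M f"
    using extremal_matching[of "-1"] by (metis mult_minus1)
  have M0pos: "0 \<le> hgt M M0 f" if "pm M" "f \<in> faces G" for M f
    using M0'[OF that] hgt_swap[OF M0 that] by simp
  have bound: "hgt M N f \<le> hgt M1 M0 f" if "pm M" "pm N" "f \<in> faces G" for M N f
    using M1(2)[of M f] M0pos[of N f] that hgt_add[OF M1(1) that(1) M0 that(3)] hgt_add[OF that(1,2) M0 that(3)] by simp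
  have zero: "hgt M N f = 0" if "pm M" "pm N" "f \<in> faces G" "hgt M1 M0 f = 0" for M N f
    using bound[of M N f] bound[of N M f] hgt_swap[of M N f] that by simp
  \<comment> \<open>A face of height 0 here has height 0 for all pairs of matchings; the jump across an edge
    excludes this for one of its two faces.\<close>
  have L1: "\<not> (hgt M1 M0 f = 0 \<and> hgt M1 M0 g = 0)" if s: "sides e f g" for e f g
  proof
    assume z: "hgt M1 M0 f = 0 \<and> hgt M1 M0 g = 0"
    have fg: "f \<in> faces G" "g \<in> faces G" "e \<in> edges G" using s by (auto simp: sides_def)
    obtain M N where MN: "pm M" "pm N" "e \<in> M" "e \<notin> N" using edge_separated[OF fg(3)] .
    then have "\<bar>hgt M N f - hgt M N g\<bar> = 1" using hgt_jump[OF MN(1,2) s] by auto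
    then show False using zero MN fg z by simp
  qed
  obtain e where e: "e \<in> edges G" "e \<subseteq> frontier F0" using face_has_edge[OF F0(1)] by blast
  obtain a b where ab: "sides e a b" using edge_sides[OF e(1)] .
  then have "F0 = a \<or> F0 = b" using sides_iff[OF ab F0(1)] e by simp
  then obtain g where s: "sides e F0 g" using ab sides_commute by blast
  have eD: "e \<in> sym_diff M1 M0"
    using L1[OF s] hgt_F0[OF M1(1) M0] hgt_no_jump[OF M1(1) M0 s] by auto
  obtain E where E: "alt_circuit G M1 E" "E \<subseteq> sym_diff M1 M0" "e \<in> E"
    using sym_diff_circuit[OF M1(1) M0 eD] .
  note J = circuit_jordan[OF E(1)]
  note E0 = height_flip_both(1)[OF M1(1) M0 E(1,2)]
  let ?C = "\<Union>E"
  define M2 where "M2 = sym_diff M1 E"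
  have M2: "pm M2" unfolding M2_def by (rule perfect_matching_flip[OF M1(1) E(1)])
  obtain \<epsilon> where ep: "\<epsilon> = 1 \<or> \<epsilon> = -1"
    "\<And>f. f \<in> faces G \<Longrightarrow> hgt M2 M1 f = (if f \<subseteq> inside ?C then \<epsilon> else 0)"
    using hgt_flip[OF M1(1) E(1)] unfolding M2_def by metis
  have "\<epsilon> = -1"
  proof -
    obtain f where f: "f \<in> faces G" "f \<subseteq> inside ?C" using circuit_face_inside[OF E(1)] .
    then have "0 \<le> - \<epsilon>" using M1(2)[OF M2 f(1)] hgt_swap[OF M2 M1(1) f(1)] ep(2)[OF f(1)] by simp
    then show ?thesis using ep(1) by auto
  qed
  then have h12: "hgt M1 M2 f = (if f \<subseteq> inside ?C then 1 else 0)" if "f \<in> faces G" for f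
    using ep(2)[OF that] hgt_swap[OF M2 M1(1) that] by simp
  have sd: "sym_diff M2 M0 = sym_diff M1 M0 - E" using E(2) unfolding M2_def by blast
  have sdG: "sym_diff M2 M0 \<subseteq> edges G" using M2 M0 by (auto simp: perfect_matching_def)
  \<comment> \<open>At a vertex of the circuit both matchings use edges of the circuit.\<close>
  have V: "w \<notin> ends G y" if w: "w \<in> ?C" and y: "y \<in> sym_diff M2 M0" for w y
  proof
    assume wy: "w \<in> ends G y"
    have "y \<in> M1 \<or> y \<in> M0" "y \<notin> E" using y sd by auto
    then show False
      using alt_circuit_closed[OF E(1) M1(1), of y] alt_circuit_closed[OF E0 M0, of y] w wy by blast
  qed
  have CE: "?C \<inter> \<Union>(sym_diff M2 M0) = {}"
  proof (rule ccontr)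
    assume "?C \<inter> \<Union>(sym_diff M2 M0) \<noteq> {}"
    then obtain p x y where p: "x \<in> E" "p \<in> x" "y \<in> sym_diff M2 M0" "p \<in> y" by blast
    have "x \<noteq> y" using p(1,3) unfolding sd by blast
    then have "p \<in> verts G" using edges_disjoint[of x y] p sdG alt_circuit_edges[OF E(1)] by blast
    then have "p \<in> ends G y" using p by (simp add: ends_def)
    then show False using V[of p y] p by blast
  qed
  \<comment> \<open>Connecting the given set to the unbounded face through the circuit and the edge \<open>e\<close>
    shows that the contribution of the other circuits is zero.\<close>
  have rest0: "height M2 M0 z = 0" if X: "connected X" "X \<inter> \<Union>(sym_diff M2 M0) = {}" "X \<inter> ?C \<noteq> {}" "z \<in> X" for X z
  proof -
    let ?U = "F0 \<union> g \<union> inner e"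
    have g: "g \<in> faces G" "connected ?U" using s by (auto simp: sides_def)
    have eC: "inner e \<subseteq> ?C" using E(3) by (auto simp: inner_def)
    have "connected (X \<union> ?C)" by (rule connected_Un[OF X(1) J(11) X(3)])
    moreover have "(X \<union> ?C) \<inter> ?U \<noteq> {}" using eC inner_nonempty[OF e(1)] by blast
    ultimately have con: "connected (X \<union> ?C \<union> ?U)" using connected_Un g(2) by blast
    have "(X \<union> ?C \<union> ?U) \<inter> \<Union>(sym_diff M2 M0) = {}"
      using X(2) CE eC face_edges[OF F0(1) sdG] face_edges[OF g(1) sdG] by blast
    moreover have "\<not> bounded (X \<union> ?C \<union> ?U)" using F0(2) bounded_subset by blast
    ultimately have "\<forall>z\<in>X \<union> ?C \<union> ?U. height M2 M0 z = 0"
      using height_locally_constant[OF M2 M0 con] by auto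
    then show ?thesis using X(4) by blast
  qed
  \<comment> \<open>An edge at a vertex of the circuit runs along the circuit or inside of it.\<close>
  have L2: "inner y \<subseteq> inside ?C" if y: "y \<in> edges G" "y \<notin> E" and w: "w \<in> ends G y" "w \<in> ?C" for y w
  proof (rule ccontr)
    assume n: "\<not> inner y \<subseteq> inside ?C"
    have "inner y \<inter> ?C = {}" using inner_disjoint[OF y(1)] alt_circuit_edges[OF E(1)] y(2) by blast
    then have out: "inner y \<subseteq> outside ?C" using circuit_sides[OF E(1) inner_connected[OF y(1)]] n by blast
    have ynot: "y \<notin> sym_diff M2 M0" using V[OF w(2), of y] w(1) by blast
    obtain f' g' where s': "sides y f' g'" using edge_sides[OF y(1)] .
    have fg: "f' \<in> faces G" "g' \<in> faces G" using s' by (auto simp: sides_def)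
    let ?U = "f' \<union> g' \<union> inner y"
    have wcl: "w \<in> closure ?U"
    proof -
      have "w \<in> closure (inner y)" using inner_closure[OF y(1)] w(1) by (auto simp: ends_def)
      then show ?thesis using closure_mono[of "inner y" ?U] by blast
    qed
    have conU: "connected ?U" using s' by (simp add: sides_def)
    have con: "connected (insert w ?U)"
      by (rule connected_intermediate_closure[OF conU]) (use wcl closure_subset in auto)
    have "inner y \<inter> \<Union>(sym_diff M2 M0) = {}" using inner_disjoint[OF y(1)] sdG ynot by blast
    moreover have "w \<notin> \<Union>(sym_diff M2 M0)" using V[OF w(2)] w(1) by (auto simp: ends_def)
    ultimately have dis: "insert w ?U \<inter> \<Union>(sym_diff M2 M0) = {}"
      using face_edges[OF fg(1) sdG] face_edges[OF fg(2) sdG] by blast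
    have "insert w ?U \<inter> ?C \<noteq> {}" using w(2) by blast
    then have h0: "height M2 M0 z = 0" if "z \<in> f' \<union> g'" for z
      using rest0[OF con dis] that by blast
    have "hgt M1 M0 x = 0" if x: "x = f' \<or> x = g'" for x
    proof -
      have xf: "x \<in> faces G" using x fg by auto
      have "hgt M2 M0 x = 0" using hgt_eqI[OF M2 M0 xf, of 0] h0 x by auto
      moreover have "\<not> x \<subseteq> inside ?C"
      proof
        assume ins: "x \<subseteq> inside ?C"
        have "y \<subseteq> frontier x" using s' x by (auto simp: sides_def)
        then have "outside ?C \<inter> closure x \<noteq> {}"
          using out inner_nonempty[OF y(1)] by (auto simp: frontier_def inner_def) 
        then have "outside ?C \<inter> x \<noteq> {}" using open_Int_closure_eq_empty[OF J(5)] by blast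
        then show False using ins J(8) by blast
      qed
      ultimately show ?thesis using h12[OF xf] hgt_add[OF M1(1) M2 M0 xf] by simp
    qed
    then show False using L1[OF s'] by blast
  qed
  have clin: "closure (inside ?C) = inside ?C \<union> ?C"
    using J(9) closure_Un_frontier by metis
  have L2': "inner y \<subseteq> inside ?C \<and> y \<subseteq> inside ?C \<union> ?C"
    if y: "y \<in> edges G" "y \<notin> E" and u: "u \<in> ends G y" "u \<in> inside ?C \<union> ?C" for y u
  proof -
    have uy: "u \<in> y" using u by (auto simp: ends_def)
    have "inner y \<subseteq> inside ?C"
      using L2[OF y u(1)] inner_meets_side[OF E(1) y uy] u(2) by blast
    moreover have "y \<subseteq> closure (inside ?C)"
      using inner_closure[OF y(1)] closure_mono[OF calculation] by blast
    ultimately show ?thesis unfolding clin by blast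
  qed
  have L3: "v \<in> inside ?C \<union> ?C" if v: "v \<in> verts G" for v
  proof -
    obtain x where x: "x \<in> ends G e" using ends_AB[OF e(1)] by auto
    then have "x \<in> verts G" "x \<in> ?C" using E(3) by (auto simp: ends_def)
    moreover have "w \<in> inside ?C \<union> ?C" if "(x, w) \<in> (adj G)\<^sup>*" for w
      using that
    proof (induction rule: rtrancl_induct)
      case base
      then show ?case using \<open>x \<in> ?C\<close> by simp
    next
      case (step u w)
      then obtain y where y: "y \<in> edges G" "ends G y = {u, w}" by (auto simp: adj_def)
      then have wy: "w \<in> y" by (auto simp: ends_def)
      show ?case
      proof (cases "y \<in> E")
        case True
        then show ?thesis using wy by blast
      next
        case False
        then show ?thesis using L2'[OF y(1) False, of u] step.IH y(2) wy by blast
      qed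
    qed
    ultimately show ?thesis using conn v unfolding connected_graph_def by blast
  qed
  have "y \<subseteq> inside ?C \<union> ?C" if y: "y \<in> edges G" for y
  proof (cases "y \<in> E")
    case False
    obtain u where u: "u \<in> ends G y" using ends_AB[OF y] by auto
    then have "u \<in> verts G" by (auto simp: ends_def)
    then show ?thesis using L2'[OF y False u] L3 by blast
  qed auto
  then have "drawing \<subseteq> inside ?C \<union> ?C" using L3 unfolding drawing_def by blast
  then have outD: "outside ?C \<subseteq> - drawing" using J(7,8) by blast
  have F0out: "F0 \<subseteq> outside ?C"
    using face_circuit_sides[OF E(1) F0(1)] J(4) F0(2) bounded_subset by blast
  have F0eq: "F0 = outside ?C"
  proof
    have "F0 \<inter> outside ?C \<noteq> {}" using F0out face_nonempty[OF F0(1)] by blast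
    then show "outside ?C \<subseteq> F0"
      using components_maximal[of F0 "- drawing" "outside ?C"] F0(1) J(6) outD unfolding faces_eq by blast
  qed (rule F0out)
  have inF: "f \<subseteq> inside ?C" if "f \<in> faces G" "f \<noteq> F0" for f
    using face_circuit_sides[OF E(1) that(1)] face_eq[OF that(1) F0(1)] face_nonempty[OF that(1)] that(2) F0eq by blast
  define X where "X = verts G \<inter> ?C"
  have per: "verts (periphery G F0) = X" unfolding periphery_def X_def F0eq J(10) by simp
  have cl: "ends G k \<subseteq> X" if "k \<in> K" "ends G k \<inter> X \<noteq> {}" "alt_circuit G K E" "pm K" for k K
    using alt_circuit_closed[OF that(3,4,1)] that(2) by (auto simp: X_def ends_def)
  let ?r = "\<lambda>K. {k \<in> K. ends G k \<inter> X = {}}"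
  have p1: "perfect_matching (delete_verts G X) (?r M1)"
    by (rule pm_delete_verts[OF M1(1)]) (use cl E(1) M1(1) in blast)
  have p0: "perfect_matching (delete_verts G X) (?r M0)"
    by (rule pm_delete_verts[OF M0]) (use cl E0 M0 in blast)
  \<comment> \<open>Here the unbounded face is used as a forcing face.\<close>
  have req: "?r M1 = ?r M0"
  proof -
    have f: "empty_or_unique_pm (delete_verts G X)" using F0(3) unfolding forcing_face_def per .
    show ?thesis
    proof (cases "verts G - X = {}")
      case True
      have "?r K = {}" if "pm K" for K
      proof (rule ccontr)
        assume "?r K \<noteq> {}"
        then obtain k where k: "k \<in> K" "ends G k \<inter> X = {}" by blast
        then have "k \<in> edges G" using that by (auto simp: perfect_matching_def)
        then have "ends G k \<noteq> {}" using ends_AB by blast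
        then show False using k True by (auto simp: ends_def)
      qed
      then show ?thesis using M1(1) M0 by blast
    next
      case False
      then show ?thesis using f p1 p0 unfolding empty_or_unique_pm_def by (auto simp: delete_verts_def)
    qed
  qed
  have "sym_diff M1 M0 \<subseteq> E"
  proof
    fix k assume k: "k \<in> sym_diff M1 M0"
    then have "k \<notin> ?r M1" "k \<notin> ?r M0" using req by blast+
    then have "ends G k \<inter> ?C \<noteq> {}" using k by (auto simp: X_def)
    then show "k \<in> E" using k alt_circuit_closed[OF E(1) M1(1)] alt_circuit_closed[OF E0 M0] by blast
  qed
  then have "M2 = M0" using E(2) unfolding M2_def by blast
  then have top: "\<And>f. f \<in> faces G \<Longrightarrow> f \<noteq> F0 \<Longrightarrow> bounded f \<and> hgt M1 M0 f = 1"
  proof -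
    fix f assume f: "f \<in> faces G" "f \<noteq> F0"
    then show "bounded f \<and> hgt M1 M0 f = 1"
      using h12[OF f(1)] inF[OF f] bounded_subset[OF J(4) inF[OF f]] \<open>M2 = M0\<close> by simp
  qed
  have range: "\<And>M f. pm M \<Longrightarrow> f \<in> faces G \<Longrightarrow> 0 \<le> hgt M M0 f \<and> hgt M M0 f \<le> hgt M1 M0 f"
    using M0pos bound[OF _ M0] by simp
  show ?thesis by (rule that[OF M0 M1(1) top range])
qed

end

section \<open>Perfect matchings as up-sets of finite faces\<close>

text \<open>The two matchings provided by \<open>extremal_matchings\<close> are fixed, and heights are measured over
  the lower one, \<open>M0\<close>.\<close>

locale plane_extremal = plane_elem +
  fixes M0 M1
  assumes M0: "pm M0" and M1: "pm M1"
    and top: "\<And>f. f \<in> faces G \<Longrightarrow> f \<noteq> F0 \<Longrightarrow> bounded f \<and> hgt M1 M0 f = 1"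
    and range: "\<And>M f. pm M \<Longrightarrow> f \<in> faces G \<Longrightarrow> 0 \<le> hgt M M0 f \<and> hgt M M0 f \<le> hgt M1 M0 f"
begin

lemma finite_faces_eq: "finite_faces G = faces G - {F0}"
  using top F0 by (auto simp: finite_faces_def)

definition D :: "complex set set \<Rightarrow> complex set set" where
  "D M = {f \<in> finite_faces G. hgt M M0 f = 1}"

lemma D_sub: "D M \<subseteq> finite_faces G"
  by (auto simp: D_def)

lemma F0_notin_D: "F0 \<notin> D M"
  using finite_faces_eq by (auto simp: D_def)

lemma hgt_M0:
  assumes "pm M" "f \<in> faces G"
  shows "hgt M M0 f = (if f \<in> D M then 1 else 0)"
proof (cases "f = F0")
  case True
  then show ?thesis using hgt_F0[OF assms(1) M0] F0_notin_D by simp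
next
  case False
  then have "hgt M M0 f = 0 \<or> hgt M M0 f = 1" using range[OF assms] top[OF assms(2)] by auto
  then show ?thesis using False assms(2) finite_faces_eq by (auto simp: D_def)
qed

lemma hgt_D:
  assumes "pm M" "pm N" "f \<in> faces G"
  shows "hgt M N f = (if f \<in> D M then 1 else 0) - (if f \<in> D N then 1 else 0)"
  using hgt_add[OF assms(1,2) M0 assms(3)] hgt_M0[OF assms(1,3)] hgt_M0[OF assms(2,3)] by simp

lemma D_inj:
  assumes "pm M" "pm N" "D M = D N"
  shows "M = N"
  using hgt_inj[OF assms(1,2)] hgt_D[OF assms(1,2)] assms(3) by simp

lemma D_M0: "D M0 = {}"
  using hgt_self[OF M0] by (auto simp: D_def finite_faces_def)

lemma D_M1: "D M1 = finite_faces G"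
  using top by (auto simp: D_def finite_faces_eq)

definition faces_inside :: "complex set set \<Rightarrow> complex set set" where
  "faces_inside E = {f \<in> faces G. f \<subseteq> inside (\<Union>E)}"

lemma faces_inside:
  assumes "alt_circuit G M E"
  shows "faces_inside E \<subseteq> finite_faces G" "faces_inside E \<noteq> {}"
proof -
  show "faces_inside E \<subseteq> finite_faces G"
    using circuit_jordan(4)[OF assms] bounded_subset by (auto simp: faces_inside_def finite_faces_def)
  show "faces_inside E \<noteq> {}" using circuit_face_inside[OF assms] by (auto simp: faces_inside_def)
qed

text \<open>A rotation changes the height of all faces inside the circuit by the same amount, and 0 and 1
  are the only heights; so these faces agree before, and agree after the rotation.\<close>

lemma circuit_flip_D:
  assumes M: "pm M" and E: "alt_circuit G M E"
  shows "faces_inside E \<subseteq> D M \<and> D (sym_diff M E) = D M - faces_inside E \<or>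
    faces_inside E \<inter> D M = {} \<and> D (sym_diff M E) = D M \<union> faces_inside E"
proof -
  let ?M = "sym_diff M E"
  have M': "pm ?M" by (rule perfect_matching_flip[OF M E])
  obtain \<epsilon> where ep: "\<epsilon> = 1 \<or> \<epsilon> = -1"
    "\<And>f. f \<in> faces G \<Longrightarrow> hgt ?M M f = (if f \<subseteq> inside (\<Union>E) then \<epsilon> else 0)"
    using hgt_flip[OF M E] by metis
  have *: "(if f \<in> D ?M then 1 else 0) - (if f \<in> D M then 1 else 0) = (if f \<in> faces_inside E then \<epsilon> else 0)"
    if "f \<in> faces G" for f
    using ep(2)[OF that] hgt_D[OF M' M that] that by (simp add: faces_inside_def)
  have DF: "f \<in> faces G" if "f \<in> D K" for f K using that by (auto simp: D_def finite_faces_def)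
  have IF: "f \<in> faces G" if "f \<in> faces_inside E" for f using that by (auto simp: faces_inside_def)
  from ep(1) show ?thesis
  proof
    assume e: "\<epsilon> = 1"
    have a: "f \<notin> D M \<and> f \<in> D ?M" if "f \<in> faces_inside E" for f
      using *[OF IF[OF that]] that e by (auto split: if_splits)
    moreover have "f \<in> D M \<longleftrightarrow> f \<in> D ?M" if "f \<notin> faces_inside E" for f
      using *[of f] that DF by (cases "f \<in> faces G") (auto split: if_splits)
    ultimately show ?thesis by blast
  next
    assume e: "\<epsilon> = -1"
    have a: "f \<in> D M \<and> f \<notin> D ?M" if "f \<in> faces_inside E" for f
      using *[OF IF[OF that]] that e by (auto split: if_splits)
    moreover have "f \<in> D M \<longleftrightarrow> f \<in> D ?M" if "f \<notin> faces_inside E" for f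
      using *[of f] that DF by (cases "f \<in> faces G") (auto split: if_splits)
    ultimately show ?thesis by blast
  qed
qed

text \<open>In the difference of \<open>M\<close> and \<open>N\<close> the rotation of a circuit has opposite effects on the two
  matchings.\<close>

lemma circuit_flip_D_both:
  assumes M: "pm M" and N: "pm N" and E: "alt_circuit G M E" "E \<subseteq> sym_diff M N"
  shows "faces_inside E \<subseteq> D M - D N \<and> D (sym_diff M E) = D M - faces_inside E \<and> D (sym_diff N E) = D N \<union> faces_inside E \<or>
    faces_inside E \<subseteq> D N - D M \<and> D (sym_diff M E) = D M \<union> faces_inside E \<and> D (sym_diff N E) = D N - faces_inside E"
proof -
  note EN = height_flip_both(1)[OF M N E]
  obtain f where f: "f \<in> faces_inside E" using faces_inside(2)[OF E(1)] by blast
  then have fF: "f \<in> faces G" by (simp add: faces_inside_def)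
  have "hgt (sym_diff N E) N f = - hgt (sym_diff M E) M f" by (rule hgt_flip_both[OF M N E fF])
  then have s: "(if f \<in> D (sym_diff N E) then 1 else 0) - (if f \<in> D N then 1 else 0) =
      - ((if f \<in> D (sym_diff M E) then 1 else 0) - (if f \<in> D M then 1 else (0::int)))"
    using hgt_D[OF perfect_matching_flip[OF M E(1)] M fF] hgt_D[OF perfect_matching_flip[OF N EN] N fF] by simp
  show ?thesis
    using circuit_flip_D[OF M E(1)]
  proof
    assume a: "faces_inside E \<subseteq> D M \<and> D (sym_diff M E) = D M - faces_inside E"
    then have "f \<in> D M" "f \<notin> D (sym_diff M E)" using f by auto
    then have "f \<notin> D N" using s by (auto split: if_splits)
    then show ?thesis using circuit_flip_D[OF N EN] a f by blast
  next
    assume a: "faces_inside E \<inter> D M = {} \<and> D (sym_diff M E) = D M \<union> faces_inside E"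
    then have "f \<notin> D M" "f \<in> D (sym_diff M E)" using f by auto
    then have "f \<in> D N" using s by (auto split: if_splits)
    then show ?thesis using circuit_flip_D[OF N EN] a f by blast
  qed
qed

text \<open>Rotating a circuit of the difference in \<open>M\<close> or in \<open>N\<close> brings the two matchings closer; one of the
  two ways preserves the union of the two face sets, the other one their intersection.\<close>

lemma lattice_step:
  assumes M: "pm M" and N: "pm N" and ne: "M \<noteq> N"
  obtains I M' N' where "pm M'" "pm N'"
    "card (sym_diff M' N) < card (sym_diff M N)" "card (sym_diff M N') < card (sym_diff M N)"
    "I \<subseteq> D M - D N \<and> D M' = D M - I \<and> D N' = D N \<union> I \<or>
     I \<subseteq> D N - D M \<and> D M' = D M \<union> I \<and> D N' = D N - I"
proof -
  obtain e where "e \<in> sym_diff M N" using ne by auto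
  then obtain E where E: "alt_circuit G M E" "E \<subseteq> sym_diff M N" "e \<in> E"
    using sym_diff_circuit[OF M N] by metis
  note EN = height_flip_both(1)[OF M N E(1,2)]
  have fin': "finite (sym_diff M N)" using pm_finite M N by auto
  have sd: "sym_diff (sym_diff M E) N = sym_diff M N - E" "sym_diff M (sym_diff N E) = sym_diff M N - E"
    using E(2) by blast+
  have "card (sym_diff M N - E) < card (sym_diff M N)"
    using E fin' by (intro psubset_card_mono) auto
  then show ?thesis
    using that[OF perfect_matching_flip[OF M E(1)] perfect_matching_flip[OF N EN], of "faces_inside E"]
      circuit_flip_D_both[OF M N E(1,2)] unfolding sd by simp
qed

lemma D_join:
  assumes "pm M" "pm N"
  shows "\<exists>K. pm K \<and> D K = D M \<union> D N"
  using assms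
proof (induction "card (sym_diff M N)" arbitrary: M N rule: less_induct)
  case less
  show ?case
  proof (cases "M = N")
    case False
    obtain I M' N' where s: "pm M'" "pm N'"
      "card (sym_diff M' N) < card (sym_diff M N)" "card (sym_diff M N') < card (sym_diff M N)"
      "I \<subseteq> D M - D N \<and> D M' = D M - I \<and> D N' = D N \<union> I \<or>
       I \<subseteq> D N - D M \<and> D M' = D M \<union> I \<and> D N' = D N - I"
      using lattice_step[OF less.prems False] .
    obtain K1 K2 where K: "pm K1" "D K1 = D M' \<union> D N" "pm K2" "D K2 = D M \<union> D N'"
      using less.hyps[OF s(3) s(1) less.prems(2)] less.hyps[OF s(4) less.prems(1) s(2)] by blast
    from s(5) show ?thesis
    proof
      assume I: "I \<subseteq> D M - D N \<and> D M' = D M - I \<and> D N' = D N \<union> I"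
      then have "D K2 = D M \<union> D N" using K(4) by auto
      then show ?thesis using K(3) by auto
    next
      assume I: "I \<subseteq> D N - D M \<and> D M' = D M \<union> I \<and> D N' = D N - I"
      then have "D K1 = D M \<union> D N" using K(2) by auto
      then show ?thesis using K(1) by auto
    qed
  qed (use less.prems in auto)
qed

lemma D_meet:
  assumes "pm M" "pm N"
  shows "\<exists>K. pm K \<and> D K = D M \<inter> D N"
  using assms
proof (induction "card (sym_diff M N)" arbitrary: M N rule: less_induct)
  case less
  show ?case
  proof (cases "M = N")
    case False
    obtain I M' N' where s: "pm M'" "pm N'"
      "card (sym_diff M' N) < card (sym_diff M N)" "card (sym_diff M N') < card (sym_diff M N)"
      "I \<subseteq> D M - D N \<and> D M' = D M - I \<and> D N' = D N \<union> I \<or>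
       I \<subseteq> D N - D M \<and> D M' = D M \<union> I \<and> D N' = D N - I"
      using lattice_step[OF less.prems False] .
    obtain K1 K2 where K: "pm K1" "D K1 = D M' \<inter> D N" "pm K2" "D K2 = D M \<inter> D N'"
      using less.hyps[OF s(3) s(1) less.prems(2)] less.hyps[OF s(4) less.prems(1) s(2)] by blast
    from s(5) show ?thesis
    proof
      assume I: "I \<subseteq> D M - D N \<and> D M' = D M - I \<and> D N' = D N \<union> I"
      then have "D K1 = D M \<inter> D N" using K(2) by auto
      then show ?thesis using K(1) by auto
    next
      assume I: "I \<subseteq> D N - D M \<and> D M' = D M \<union> I \<and> D N' = D N - I"
      then have "D K2 = D M \<inter> D N" using K(4) by auto
      then show ?thesis using K(3) by auto
    qed
  qed (use less.prems in auto)
qed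

definition face_le :: "complex set \<Rightarrow> complex set \<Rightarrow> bool" where
  "face_le f g \<longleftrightarrow> (\<forall>M. pm M \<longrightarrow> f \<in> D M \<longrightarrow> g \<in> D M)"

lemma face_le_refl: "face_le f f"
  by (simp add: face_le_def)

lemma face_le_trans: "face_le f g \<Longrightarrow> face_le g h \<Longrightarrow> face_le f h"
  by (simp add: face_le_def)

lemma D_up: "pm M \<Longrightarrow> f \<in> D M \<Longrightarrow> face_le f g \<Longrightarrow> g \<in> D M"
  by (simp add: face_le_def)

lemma finite_finite_faces: "finite (finite_faces G)"
  using finite_faces_all finite_faces_eq by simp

text \<open>The intersection of all face sets that contain \<open>f\<close>.\<close>

lemma principal_upset:
  assumes f: "f \<in> finite_faces G"
  shows "\<exists>K. pm K \<and> D K = {g \<in> finite_faces G. face_le f g}"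
proof -
  have meet: "\<exists>K. pm K \<and> D K = finite_faces G \<inter> \<Inter>(D ` \<M>)" if "finite \<M>" "\<And>M. M \<in> \<M> \<Longrightarrow> pm M" for \<M>
    using that
  proof (induction rule: finite_induct)
    case empty
    then show ?case using M1 D_M1 by auto
  next
    case (insert M \<M>)
    then obtain K where "pm K" "D K = finite_faces G \<inter> \<Inter>(D ` \<M>)" by auto
    then show ?case using D_meet[of M K] insert.prems by auto
  qed
  have "finite {M. pm M \<and> f \<in> D M}" using finite_pms by (rule rev_finite_subset) blast
  then obtain K where K: "pm K" "D K = finite_faces G \<inter> \<Inter>(D ` {M. pm M \<and> f \<in> D M})"
    using meet[of "{M. pm M \<and> f \<in> D M}"] by blast
  have "g \<in> D K \<longleftrightarrow> g \<in> finite_faces G \<and> face_le f g" for g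
    unfolding K(2) face_le_def by blast
  then show ?thesis using K(1) by blast
qed

lemma upset_is_D:
  assumes U: "U \<subseteq> finite_faces G" "\<And>x y. x \<in> U \<Longrightarrow> y \<in> finite_faces G \<Longrightarrow> face_le x y \<Longrightarrow> y \<in> U"
  shows "\<exists>K. pm K \<and> D K = U"
proof -
  have "\<exists>K. pm K \<and> D K = (\<Union>f\<in>V. {g \<in> finite_faces G. face_le f g})" if "finite V" "V \<subseteq> finite_faces G" for V
    using that
  proof (induction rule: finite_induct)
    case empty
    then show ?case using M0 D_M0 by auto
  next
    case (insert f V)
    then obtain K where K: "pm K" "D K = (\<Union>f\<in>V. {g \<in> finite_faces G. face_le f g})" by auto
    obtain L where L: "pm L" "D L = {g \<in> finite_faces G. face_le f g}"
      using principal_upset[of f] insert.prems by auto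
    show ?case using D_join[OF L(1) K(1)] K(2) L(2) by auto
  qed
  from this[of U] obtain K where K: "pm K" "D K = (\<Union>f\<in>U. {g \<in> finite_faces G. face_le f g})"
    using U(1) finite_finite_faces finite_subset by blast
  moreover have "(\<Union>f\<in>U. {g \<in> finite_faces G. face_le f g}) = U"
  proof
    show "(\<Union>f\<in>U. {g \<in> finite_faces G. face_le f g}) \<subseteq> U" using U(2) by auto
    show "U \<subseteq> (\<Union>f\<in>U. {g \<in> finite_faces G. face_le f g})" using U(1) face_le_refl by auto
  qed
  ultimately show ?thesis by auto
qed

text \<open>An edge that enters the inside would have both its faces there.  But for
  some perfect matching just one of them belongs to the face set, because heights jump across the
  edge.\<close>

lemma circuit_encloses_face:
  assumes E: "alt_circuit G M E" and M: "pm M"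
    and same: "\<And>f g K. f \<in> faces_inside E \<Longrightarrow> g \<in> faces_inside E \<Longrightarrow> pm K \<Longrightarrow> f \<in> D K \<longleftrightarrow> g \<in> D K"
  shows "inside (\<Union>E) \<in> faces G" "faces_inside E = {inside (\<Union>E)}"
proof -
  note J = circuit_jordan[OF E]
  let ?I = "inside (\<Union>E)"
  have no_edge: "\<not> inner y \<subseteq> ?I" if y: "y \<in> edges G" for y
  proof
    assume ins: "inner y \<subseteq> ?I"
    obtain f g where s: "sides y f g" using edge_sides[OF y] .
    have sF: "f \<in> faces G" "g \<in> faces G" using s by (auto simp: sides_def)
    have "x \<subseteq> ?I" if x: "x \<in> faces G" "y \<subseteq> frontier x" for x
    proof -
      have "?I \<inter> closure x \<noteq> {}" using ins inner_nonempty[OF y] x(2) by (auto simp: frontier_def inner_def)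
      then have "?I \<inter> x \<noteq> {}" using open_Int_closure_eq_empty[OF J(1)] by blast
      then show ?thesis using face_circuit_sides[OF E x(1)] J(8) by blast
    qed
    then have fg: "f \<in> faces_inside E" "g \<in> faces_inside E" using s by (auto simp: sides_def faces_inside_def)
    obtain K L where KL: "pm K" "pm L" "y \<in> K" "y \<notin> L" using edge_separated[OF y] .
    then have "\<bar>hgt K L f - hgt K L g\<bar> = 1" using hgt_jump[OF KL(1,2) s] by auto
    moreover have "hgt K L f = hgt K L g"
      using hgt_D[OF KL(1,2) sF(1)] hgt_D[OF KL(1,2) sF(2)] same[OF fg] KL by simp
    ultimately show False by simp
  qed
  have no_vert: "v \<notin> ?I" if v: "v \<in> verts G" for v
  proof
    assume vI: "v \<in> ?I"
    note m = medge[OF M v]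
    have "v \<in> medge M v" using m(2) by (simp add: ends_def)
    moreover have "medge M v \<notin> E" using calculation vI J(7,8) by blast
    ultimately show False using inner_meets_side[OF E m(3)] vI no_edge[OF m(3)] by blast
  qed
  have "inner y \<inter> ?I = {}" if y: "y \<in> edges G" for y
  proof (cases "y \<in> E")
    case True
    then have "inner y \<subseteq> \<Union>E" by (auto simp: inner_def)
    then show ?thesis using J(7) by blast
  next
    case False
    then have "inner y \<inter> \<Union>E = {}" using inner_disjoint[OF y] alt_circuit_edges[OF E] by blast
    then show ?thesis using circuit_sides[OF E inner_connected[OF y]] no_edge[OF y] J(8) by blast
  qed
  then have "?I \<subseteq> - drawing" using no_vert unfolding drawing_decomp by blast
  moreover obtain f where f: "f \<in> faces G" "f \<subseteq> ?I" using circuit_face_inside[OF E] .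
  ultimately have "?I \<subseteq> f"
    using components_maximal[of f "- drawing" ?I] J(2) face_nonempty[OF f(1)] unfolding faces_eq by blast
  then have "f = ?I" using f by blast
  then show I: "?I \<in> faces G" using f by simp
  have "x = ?I" if "x \<in> faces G" "x \<subseteq> ?I" for x
    using face_eq[OF that(1) I] face_nonempty[OF that(1)] that(2) by blast
  then show "faces_inside E = {?I}"
    unfolding faces_inside_def using I by auto
qed

text \<open>The principal up-set \<open>U\<close> of \<open>f\<close> and the set \<open>V\<close> of elements strictly above \<open>f\<close> differ by the
  class of \<open>f\<close>.  A circuit in the difference of their matchings has only members of the class inside,
  hence encloses a single face \<open>s\<close>.  Then \<open>V \<union> {s}\<close> is also an up-set, so \<open>s\<close> is the whole class.\<close>

lemma face_le_antisym:
  assumes f: "f \<in> finite_faces G" and g: "g \<in> finite_faces G" and le: "face_le f g" "face_le g f"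
  shows "f = g"
proof -
  define U where "U = {x \<in> finite_faces G. face_le f x}"
  define V where "V = {x \<in> finite_faces G. face_le f x \<and> \<not> face_le x f}"
  have "\<exists>K. pm K \<and> D K = U"
  proof (rule upset_is_D)
    show "U \<subseteq> finite_faces G" by (auto simp: U_def)
    show "y \<in> U" if "x \<in> U" "y \<in> finite_faces G" "face_le x y" for x y
      using that face_le_trans[of f x y] by (simp add: U_def)
  qed
  then obtain MU where MU: "pm MU" "D MU = U" by blast
  have "\<exists>K. pm K \<and> D K = V"
  proof (rule upset_is_D)
    show "V \<subseteq> finite_faces G" by (auto simp: V_def)
    show "y \<in> V" if "x \<in> V" "y \<in> finite_faces G" "face_le x y" for x y
      using that face_le_trans[of f x y] face_le_trans[of x y f] by (auto simp: V_def)
  qed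
  then obtain MV where MV: "pm MV" "D MV = V" by blast
  have "MV \<noteq> MU" using MU MV f face_le_refl by (auto simp: U_def V_def)
  then obtain e where "e \<in> sym_diff MV MU" by auto
  then obtain E where E: "alt_circuit G MV E" "E \<subseteq> sym_diff MV MU"
    using sym_diff_circuit[OF MV(1) MU(1)] by metis
  have "V \<subseteq> U" by (auto simp: U_def V_def)
  then have I: "faces_inside E \<subseteq> U - V" "D (sym_diff MV E) = V \<union> faces_inside E"
    using circuit_flip_D_both[OF MV(1) MU(1) E] faces_inside(2)[OF E(1)] MU MV by blast+
  have cls: "face_le f x" "face_le x f" if "x \<in> faces_inside E" for x
    using that I(1) by (auto simp: U_def V_def)
  have "x \<in> D K \<longleftrightarrow> y \<in> D K" if "x \<in> faces_inside E" "y \<in> faces_inside E" "pm K" for x y K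
    using cls that D_up by blast
  from circuit_encloses_face(2)[OF E(1) MV(1) this] obtain s where s: "faces_inside E = {s}" by blast
  have pm': "pm (sym_diff MV E)" by (rule perfect_matching_flip[OF MV(1) E(1)])
  have "x = s" if x: "face_le f x" "face_le x f" for x
  proof -
    have "face_le s x" using cls[of s] s x face_le_trans by blast
    then have "x \<in> V \<union> {s}" using D_up[OF pm', of s x] I(2) s by simp
    moreover have "x \<notin> V" using x by (simp add: V_def)
    ultimately show ?thesis by simp
  qed
  then show ?thesis using le face_le_refl by metis
qed

section \<open>Resonant faces and resonance edges\<close>

text \<open>All of the difference is one circuit, as rotating one circuit already leads to the face set of
  \<open>N\<close>.\<close>

lemma single_flip:
  assumes M: "pm M" and N: "pm N" and s: "sym_diff (D M) (D N) = {s}"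
  shows "alt_circuit G M (sym_diff M N)" "s = inside (\<Union>(sym_diff M N))"
proof -
  have "M \<noteq> N" using s by auto
  then obtain e where "e \<in> sym_diff M N" by auto
  then obtain E where E: "alt_circuit G M E" "E \<subseteq> sym_diff M N"
    using sym_diff_circuit[OF M N] by metis
  note b = circuit_flip_D_both[OF M N E]
  have "faces_inside E \<subseteq> sym_diff (D M) (D N)" using b by blast
  then have I: "faces_inside E = {s}" using faces_inside(2)[OF E(1)] unfolding s by blast
  then have sI: "s = inside (\<Union>E)" using circuit_encloses_face(2)[OF E(1) M] by simp
  have "D (sym_diff M E) = D N"
    using b
  proof
    assume "faces_inside E \<subseteq> D M - D N \<and> D (sym_diff M E) = D M - faces_inside E \<and>
      D (sym_diff N E) = D N \<union> faces_inside E"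
    then have "s \<in> D M - D N" "D (sym_diff M E) = D M - {s}" using I by auto
    then show ?thesis using s by auto
  next
    assume "faces_inside E \<subseteq> D N - D M \<and> D (sym_diff M E) = D M \<union> faces_inside E \<and>
      D (sym_diff N E) = D N - faces_inside E"
    then have "s \<in> D N - D M" "D (sym_diff M E) = D M \<union> {s}" using I by auto
    then show ?thesis using s by auto
  qed
  then have "sym_diff M E = N" using D_inj[OF perfect_matching_flip[OF M E(1)] N] by simp
  then have "E = sym_diff M N" by blast
  then show "alt_circuit G M (sym_diff M N)" "s = inside (\<Union>(sym_diff M N))" using E sI by auto
qed

lemma periphery_edges:
  assumes "alt_circuit G M E" "frontier s = \<Union>E"
  shows "edges (periphery G s) = E"
  using edge_subset_Union[OF _ alt_circuit_edges[OF assms(1)]] alt_circuit_edges[OF assms(1)]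
  unfolding periphery_def assms(2) by auto

lemma periphery_ends: "x \<in> edges (periphery G s) \<Longrightarrow> ends (periphery G s) x = ends G x"
  by (auto simp: periphery_def ends_def)

lemma periphery_cycle:
  assumes c: "alt_cycle G M n v e" and fr: "frontier s = \<Union>(e ` {..<n})"
  shows "cycle_enum (periphery G s) n v e"
proof -
  note cD = alt_cycleD[OF c]
  have circ: "alt_circuit G M (e ` {..<n})" using c by (auto simp: alt_circuit_def)
  note pe = periphery_edges[OF circ fr]
  have n: "0 < n" using cD(1) by simp
  have "verts (periphery G s) = v ` {..<n}"
  proof
    show "verts (periphery G s) \<subseteq> v ` {..<n}"
    proof
      fix w assume "w \<in> verts (periphery G s)"
      then obtain i where i: "i < n" "w \<in> e i" "w \<in> verts G" by (auto simp: periphery_def fr)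
      then have "w \<in> {v i, v (Suc i mod n)}" using cD(5)[OF i(1)] by (auto simp: ends_def)
      then show "w \<in> v ` {..<n}" using i n by auto
    qed
    show "v ` {..<n} \<subseteq> verts (periphery G s)"
    proof
      fix w assume "w \<in> v ` {..<n}"
      then obtain i where i: "i < n" "w = v i" by auto
      then have "w \<in> ends G (e i)" using cD(5) by simp
      then show "w \<in> verts (periphery G s)" using i by (auto simp: periphery_def fr ends_def)
    qed
  qed
  then have "bij_betw v {..<n} (verts (periphery G s))" using cD(2) by (simp add: bij_betw_def)
  moreover have "bij_betw e {..<n} (edges (periphery G s))" using cD(3) pe by (simp add: bij_betw_def)
  moreover have "ends (periphery G s) (e i) = {v i, v (Suc i mod n)}" if "i < n" for i
    using periphery_ends[of "e i" s] pe that cD(5) by simp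
  ultimately show ?thesis using cD(1) by (simp add: cycle_enum_def)
qed

lemma cycle_periphery:
  assumes c: "cycle_enum (periphery G s) n v e" and al: "\<And>i. i < n \<Longrightarrow> e i \<in> M \<longleftrightarrow> e (Suc i mod n) \<notin> M"
  shows "alt_circuit G M (edges (periphery G s))"
proof -
  have b: "2 \<le> n" "bij_betw v {..<n} (verts (periphery G s))" "bij_betw e {..<n} (edges (periphery G s))"
    and en: "\<And>i. i < n \<Longrightarrow> ends (periphery G s) (e i) = {v i, v (Suc i mod n)}"
    using c by (auto simp: cycle_enum_def)
  have eE: "e i \<in> edges (periphery G s)" if "i < n" for i using b(3) that by (auto simp: bij_betw_def)
  have "alt_cycle G M n v e"
    unfolding alt_cycle_def
  proof (intro conjI allI impI)
    show "2 \<le> n" by (rule b(1))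
    show "inj_on v {..<n}" "inj_on e {..<n}" using b by (auto simp: bij_betw_def)
    fix i assume i: "i < n"
    show "e i \<in> edges G" using eE[OF i] by (simp add: periphery_def)
    show "ends G (e i) = {v i, v (Suc i mod n)}" using en[OF i] periphery_ends[OF eE[OF i]] by simp
    show "e i \<in> M \<longleftrightarrow> e (Suc i mod n) \<notin> M" by (rule al[OF i])
  qed
  moreover have "edges (periphery G s) = e ` {..<n}" using b(3) by (simp add: bij_betw_def)
  ultimately show ?thesis unfolding alt_circuit_def by blast
qed

text \<open>Apart from vertices the frontier of \<open>s\<close> lies on the circuit, so that \<open>s\<close> fills one side of the
  circuit except for vertices.  This is the inside since \<open>s\<close> is bounded, and a vertex in there would
  have an edge that runs into \<open>s\<close>.\<close>

lemma periphery_circuit_inside: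
  assumes s: "s \<in> finite_faces G" and M: "pm M" and E: "alt_circuit G M (edges (periphery G s))"
  shows "s = inside (\<Union>(edges (periphery G s)))"
proof -
  let ?E = "edges (periphery G s)"
  note J = circuit_jordan[OF E]
  have sF: "s \<in> faces G" "bounded s" using s by (auto simp: finite_faces_def)
  have fr: "frontier s \<subseteq> \<Union>?E \<union> verts G"
  proof
    fix x assume x: "x \<in> frontier s"
    then have "x \<in> drawing" using face_frontier[OF sF(1)] by blast
    then consider "x \<in> verts G" | y where "y \<in> edges G" "x \<in> inner y" unfolding drawing_decomp by blast
    then show "x \<in> \<Union>?E \<union> verts G"
    proof cases
      case 2
      then have "y \<subseteq> frontier s" using frontier_inner[OF sF(1)] x by blast
      then show ?thesis using 2 by (auto simp: periphery_def inner_def)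
    qed auto
  qed
  have sv: "s \<inter> verts G = {}" using face_drawing[OF sF(1)] by (auto simp: drawing_def)
  have fill: "X - verts G = s" if X: "open X" "connected X" "X \<inter> \<Union>?E = {}" "s \<subseteq> X" for X
  proof -
    have con: "connected (X - verts G)"
      using connected_open_diff_countable[of X "verts G"] X fin by (simp add: countable_finite)
    have "(X - verts G) \<inter> s \<noteq> {}" using X(4) sv face_nonempty[OF sF(1)] by blast
    moreover have "(X - verts G) \<inter> frontier s = {}" using fr X(3) by blast
    ultimately have "X - verts G - s = {}" using connected_Int_frontier[OF con] by blast
    then show ?thesis using X(4) sv by blast
  qed
  have "s \<subseteq> inside (\<Union>?E)"
  proof (rule ccontr)
    assume "\<not> s \<subseteq> inside (\<Union>?E)"
    then have "s \<subseteq> outside (\<Union>?E)" using face_circuit_sides[OF E sF(1)] by blast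
    then have "outside (\<Union>?E) - verts G = s" using fill[OF J(5,6)] J(7) by blast
    then have "outside (\<Union>?E) \<subseteq> s \<union> verts G" by blast
    moreover have "bounded (s \<union> verts G)" using sF(2) fin by (simp add: finite_imp_bounded)
    ultimately show False using J(12) bounded_subset by blast
  qed
  then have eq: "inside (\<Union>?E) - verts G = s" using fill[OF J(1,2)] J(7) by blast
  have "v \<notin> inside (\<Union>?E)" if v: "v \<in> verts G" for v
  proof
    assume vI: "v \<in> inside (\<Union>?E)"
    note m = medge[OF M v]
    have "v \<in> medge M v" using m(2) by (simp add: ends_def)
    moreover have "medge M v \<notin> ?E" using calculation vI J(7,8) by blast
    ultimately have "inner (medge M v) \<subseteq> s"
      using inner_meets_side[OF E m(3)] vI eq by (auto simp: inner_def)
    then show False using inner_nonempty[OF m(3)] face_drawing[OF sF(1)] m(3) by (auto simp: drawing_def inner_def)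
  qed
  then show ?thesis using eq by blast
qed

lemma periphery_flip:
  assumes s: "s \<in> finite_faces G" and M: "pm M" and E: "alt_circuit G M (edges (periphery G s))"
  shows "D (sym_diff M (edges (periphery G s))) = sym_diff (D M) {s}"
proof -
  note sI = periphery_circuit_inside[OF assms]
  have "s \<in> faces G" using s by (simp add: finite_faces_def)
  then have "faces_inside (edges (periphery G s)) = {s}"
  proof -
    assume s: "s \<in> faces G"
    have "x = s" if "x \<in> faces G" "x \<subseteq> s" for x
      using face_eq[OF that(1) s] face_nonempty[OF that(1)] that(2) by blast
    then show ?thesis unfolding faces_inside_def sI[symmetric] using s by auto
  qed
  then show ?thesis using circuit_flip_D[OF M E] by auto
qed

lemma flip_periphery:
  assumes M: "pm M" and N: "pm N" and s: "sym_diff (D M) (D N) = {s}"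
  shows "sym_diff M N = edges (periphery G s)" "alt_circuit G M (edges (periphery G s))"
    "frontier s = \<Union>(edges (periphery G s))"
proof -
  note sf = single_flip[OF assms]
  have fr: "frontier s = \<Union>(sym_diff M N)" using circuit_jordan(9)[OF sf(1)] sf(2) by simp
  show pe: "sym_diff M N = edges (periphery G s)" using periphery_edges[OF sf(1) fr] by simp
  show "alt_circuit G M (edges (periphery G s))" "frontier s = \<Union>(edges (periphery G s))"
    using sf(1) fr unfolding pe by auto
qed

lemma flip_in_finite_faces: "sym_diff (D M) (D N) = {s} \<Longrightarrow> s \<in> finite_faces G"
  using D_sub by blast

text \<open>In the definition of resonance edges the periphery is just required to be a cycle; it
  alternates, because each of its edges lies in exactly one of the two matchings.\<close>

lemma resonance_edge_iff:
  "resonance_edge G M N s \<longleftrightarrow> pm M \<and> pm N \<and> sym_diff (D M) (D N) = {s}"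
proof
  assume "resonance_edge G M N s"
  then have r: "pm M" "pm N" "s \<in> finite_faces G" "cycle_graph (periphery G s)"
    "sym_diff M N = edges (periphery G s)" by (auto simp: resonance_edge_def)
  obtain n v e where c: "cycle_enum (periphery G s) n v e" using r(4) by (auto simp: cycle_graph_def)
  have n: "2 \<le> n" and eb: "bij_betw e {..<n} (edges (periphery G s))"
    and en: "\<And>i. i < n \<Longrightarrow> ends (periphery G s) (e i) = {v i, v (Suc i mod n)}"
    using c by (auto simp: cycle_enum_def)
  have "e i \<in> M \<longleftrightarrow> e (Suc i mod n) \<notin> M" if i: "i < n" for i
  proof -
    define j where "j = Suc i mod n"
    have j: "j < n" "j \<noteq> i" using n i by (auto simp: j_def mod_Suc)
    have ne: "e i \<noteq> e j" using eb i j by (auto simp: bij_betw_def inj_on_def)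
    have eE: "e i \<in> edges (periphery G s)" "e j \<in> edges (periphery G s)" using eb i j by (auto simp: bij_betw_def)
    have w: "v j \<in> ends G (e i)" "v j \<in> ends G (e j)"
      using en[OF i] en[OF j(1)] periphery_ends[OF eE(1)] periphery_ends[OF eE(2)] by (auto simp: j_def)
    have "\<not> (e i \<in> K \<and> e j \<in> K)" if "pm K" for K
      using medge_eq[OF that _ w(1)] medge_eq[OF that _ w(2)] ne by metis
    then show ?thesis using r(1,2) eE unfolding r(5)[symmetric] j_def[symmetric] by blast
  qed
  then have E: "alt_circuit G M (edges (periphery G s))" by (rule cycle_periphery[OF c])
  have "N = sym_diff M (edges (periphery G s))" unfolding r(5)[symmetric] by blast
  then have "D N = sym_diff (D M) {s}" using periphery_flip[OF r(3,1) E] by simp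
  then have "sym_diff (D M) (D N) = {s}" by auto
  then show "pm M \<and> pm N \<and> sym_diff (D M) (D N) = {s}" using r by simp
next
  assume r: "pm M \<and> pm N \<and> sym_diff (D M) (D N) = {s}"
  then have p: "sym_diff M N = edges (periphery G s)" "alt_circuit G M (edges (periphery G s))"
    "frontier s = \<Union>(edges (periphery G s))" using flip_periphery[of M N s] by auto
  obtain n v e where c: "alt_cycle G M n v e" "edges (periphery G s) = e ` {..<n}"
    using p(2) by (auto simp: alt_circuit_def)
  have "cycle_graph (periphery G s)"
    using periphery_cycle[OF c(1)] p(3) c(2) by (auto simp: cycle_graph_def)
  moreover have "s \<in> finite_faces G" using r flip_in_finite_faces by blast
  ultimately show "resonance_edge G M N s" using r p(1) by (simp add: resonance_edge_def)
qed

lemma resonant_face_circuit: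
  assumes s: "s \<in> finite_faces G" and M: "pm M"
  shows "resonant_face G M s \<longleftrightarrow> alt_circuit G M (edges (periphery G s))"
proof
  assume "resonant_face G M s"
  then show "alt_circuit G M (edges (periphery G s))"
    unfolding resonant_face_def alternating_cycle_def using cycle_periphery by metis
next
  assume E: "alt_circuit G M (edges (periphery G s))"
  then have "s = inside (\<Union>(edges (periphery G s)))" by (rule periphery_circuit_inside[OF s M])
  then have fr: "frontier s = \<Union>(edges (periphery G s))" using circuit_jordan(9)[OF E] by simp
  obtain n v e where c: "alt_cycle G M n v e" "edges (periphery G s) = e ` {..<n}"
    using E by (auto simp: alt_circuit_def)
  have "cycle_enum (periphery G s) n v e" using periphery_cycle[OF c(1)] fr c(2) by simp
  then show "resonant_face G M s"
    unfolding resonant_face_def alternating_cycle_def using alt_cycleD(6)[OF c(1)] by blast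
qed

lemma periphery_verts:
  assumes "s \<in> finite_faces G" "pm M" "alt_circuit G M (edges (periphery G s))"
  shows "verts (periphery G s) = verts G \<inter> \<Union>(edges (periphery G s))"
proof -
  have "s = inside (\<Union>(edges (periphery G s)))" by (rule periphery_circuit_inside[OF assms])
  then have "frontier s = \<Union>(edges (periphery G s))" using circuit_jordan(9)[OF assms(3)] by simp
  moreover have "verts (periphery G s) = verts G \<inter> frontier s" by (simp add: periphery_def)
  ultimately show ?thesis by simp
qed

end

section \<open>Hypercubes in the graph of up-sets of a finite poset\<close>

lemma card_sym_diff_singleton:
  assumes "finite X"
  shows "int (card (sym_diff X {i})) = (if i \<in> X then int (card X) - 1 else int (card X) + 1)"
proof (cases "i \<in> X")
  case True
  then have "sym_diff X {i} = X - {i}" by auto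
  moreover have "card X > 0" using True assms card_gt_0_iff by blast
  ultimately show ?thesis using True assms by (simp add: card_Diff_singleton of_nat_diff)
next
  case False
  then have "sym_diff X {i} = insert i X" by auto
  then show ?thesis using False assms by simp
qed

lemma sym_diff_cancel:
  assumes "sym_diff X Y = {a}" "sym_diff Y Z = {a}"
  shows "X = Z"
proof -
  have "x \<in> X \<longleftrightarrow> x \<in> Z" for x
    using assms unfolding set_eq_iff by (cases "x = a") auto
  then show ?thesis by blast
qed

lemma sym_diff_left: "sym_diff (sym_diff X Y) (sym_diff X Z) = sym_diff Y Z"
  by blast

text \<open>The two walks across a square from \<open>X\<close> to \<open>W\<close> change the same two elements in opposite
  orders.\<close>

lemma square_labels:
  assumes "sym_diff X Y = {a}" "sym_diff X Z = {b}" "sym_diff Z W = {c}" "sym_diff Y W = {d}"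
    and "Y \<noteq> Z" "W \<noteq> X"
  shows "c = a"
proof -
  have "a \<noteq> b" using assms(1,2,5) sym_diff_cancel[of Y X a Z] by (auto simp: Un_commute)
  moreover have "c \<noteq> b" using assms(2,3,6) sym_diff_cancel[of X Z b W] by auto
  moreover have "x \<in> sym_diff {a} {d} \<longleftrightarrow> x \<in> sym_diff {b} {c}" for x
    using assms(1-4)[unfolded set_eq_iff, THEN spec[of _ x]] by auto
  from this[of b] this[of c] calculation have "c = a" by auto
  then show ?thesis .
qed

lemma bij_betw_ex: "bij_betw f X Y \<Longrightarrow> y \<in> Y \<Longrightarrow> \<exists>x\<in>X. f x = y"
  unfolding bij_betw_def by blast

text \<open>The vertices are coded by the subsets of a finite set of coordinates.  This is a hypercube
  whose edges are, in addition, the sets of their ends.\<close>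

definition cube_coding :: "'a graph \<Rightarrow> ('a \<Rightarrow> 'b set) \<Rightarrow> 'b set \<Rightarrow> bool" where
  "cube_coding Q g K \<longleftrightarrow> finite K \<and> bij_betw g (verts Q) (Pow K) \<and>
     edges Q = {{u, v} | u v. u \<in> verts Q \<and> v \<in> verts Q \<and> (\<exists>i. sym_diff (g u) (g v) = {i})}"

lemma cube_coding_sym_diff:
  assumes "cube_coding Q g K" "u \<in> verts Q" "v \<in> verts Q"
  shows "sym_diff (g u) (g v) \<subseteq> K" "finite (sym_diff (g u) (g v))"
proof -
  have "g u \<subseteq> K" "g v \<subseteq> K" "finite K"
    using assms by (auto simp: cube_coding_def bij_betw_def)
  then show "sym_diff (g u) (g v) \<subseteq> K" by auto
  then show "finite (sym_diff (g u) (g v))" using \<open>finite K\<close> finite_subset by blast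
qed

lemma cube_coding_adj:
  assumes "cube_coding Q g K"
  shows "(u, v) \<in> adj Q \<longleftrightarrow> u \<in> verts Q \<and> v \<in> verts Q \<and> (\<exists>i. sym_diff (g u) (g v) = {i})"
proof
  assume "(u, v) \<in> adj Q"
  then obtain e where e: "e \<in> edges Q" "ends Q e = {u, v}" by (auto simp: adj_def)
  then obtain a b where "e = {a, b}" "a \<in> verts Q" "b \<in> verts Q" "\<exists>i. sym_diff (g a) (g b) = {i}"
    using assms by (auto simp: cube_coding_def)
  then show "u \<in> verts Q \<and> v \<in> verts Q \<and> (\<exists>i. sym_diff (g u) (g v) = {i})"
    using e by (auto simp: ends_def doubleton_eq_iff Un_commute)
next
  assume *: "u \<in> verts Q \<and> v \<in> verts Q \<and> (\<exists>i. sym_diff (g u) (g v) = {i})"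
  then have "{u, v} \<in> edges Q" using assms by (auto simp: cube_coding_def)
  moreover have "ends Q {u, v} = {u, v}" using * by (auto simp: ends_def)
  ultimately show "(u, v) \<in> adj Q" by (auto simp: adj_def)
qed

text \<open>Distance is Hamming distance: an edge changes the symmetric difference by one element, and as
  long as it is not empty one element can be removed.\<close>

lemma cube_coding_gdist:
  assumes c: "cube_coding Q g K" and u: "u \<in> verts Q" and v: "v \<in> verts Q"
  shows "gdist Q u v = card (sym_diff (g u) (g v))"
proof -
  have lower: "w \<in> verts Q \<and> card (sym_diff (g u) (g w)) \<le> n" if "(u, w) \<in> adj Q ^^ n" for w n
    using that
  proof (induction n arbitrary: w)
    case 0
    then show ?case using u by auto
  next
    case (Suc n)
    then obtain y where y: "(u, y) \<in> adj Q ^^ n" "(y, w) \<in> adj Q" by auto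
    then obtain i where i: "w \<in> verts Q" "y \<in> verts Q" "sym_diff (g y) (g w) = {i}"
      using cube_coding_adj[OF c] by auto
    have "sym_diff (g u) (g w) = sym_diff (sym_diff (g u) (g y)) {i}" using i(3) by blast
    then have "int (card (sym_diff (g u) (g w))) \<le> int (card (sym_diff (g u) (g y))) + 1"
      using card_sym_diff_singleton[OF cube_coding_sym_diff(2)[OF c u i(2)], of i] by auto
    then show ?case using Suc.IH[OF y(1)] i(1) by auto
  qed
  have upper: "(u, w) \<in> adj Q ^^ n" if "w \<in> verts Q" "card (sym_diff (g u) (g w)) = n" for w n
    using that
  proof (induction n arbitrary: w)
    case 0
    then have "sym_diff (g u) (g w) = {}" using cube_coding_sym_diff(2)[OF c u] by auto
    then have "g u = g w" by auto
    then show ?case using u 0 c by (auto simp: cube_coding_def bij_betw_def inj_on_def)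
  next
    case (Suc n)
    then obtain i where i: "i \<in> sym_diff (g u) (g w)" by (metis card.empty ex_in_conv nat.simps(3))
    have "i \<in> K" using i cube_coding_sym_diff(1)[OF c u Suc.prems(1)] by blast
    moreover have "g w \<subseteq> K" using Suc.prems c by (auto simp: cube_coding_def bij_betw_def)
    ultimately have "sym_diff (g w) {i} \<in> Pow K" by auto
    then obtain y where y: "y \<in> verts Q" "g y = sym_diff (g w) {i}"
      using c bij_betw_ex[of g "verts Q" "Pow K"] unfolding cube_coding_def by meson
    have "sym_diff (g u) (g y) = sym_diff (sym_diff (g u) (g w)) {i}" using y(2) by blast
    then have "int (card (sym_diff (g u) (g y))) = int n"
      using card_sym_diff_singleton[OF cube_coding_sym_diff(2)[OF c u Suc.prems(1)], of i] i Suc.prems by auto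
    then have "(u, y) \<in> adj Q ^^ n" using Suc.IH y(1) by auto
    moreover have "(y, w) \<in> adj Q"
    proof -
      have "sym_diff (g y) (g w) = {i}" using y(2) by blast
      then show ?thesis using cube_coding_adj[OF c] y(1) Suc.prems(1) by blast
    qed
    ultimately show ?case by auto
  qed
  show ?thesis unfolding gdist_def
    using lower upper[OF v refl] by (intro Least_equality) auto
qed

text \<open>Let \<open>d\<close> be the set of coordinates in which \<open>x1\<close> and \<open>y1\<close> differ.  The four distances arise from
  \<open>d\<close> by switching \<open>i\<close>, \<open>j\<close>, both or none.  The two switches contribute independently unless
  \<open>i = j\<close>, when they cancel.\<close>

lemma cube_coding_Theta:
  assumes c: "cube_coding Q g K"
    and x: "x1 \<in> verts Q" "x2 \<in> verts Q" "sym_diff (g x1) (g x2) = {i}"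
    and y: "y1 \<in> verts Q" "y2 \<in> verts Q" "sym_diff (g y1) (g y2) = {j}"
  shows "({x1, x2}, {y1, y2}) \<in> Theta Q \<longleftrightarrow> i = j"
proof -
  have E: "{x1, x2} \<in> edges Q" "{y1, y2} \<in> edges Q"
    using c x y unfolding cube_coding_def by auto
  have ends: "ends Q {x1, x2} = {x1, x2}" "ends Q {y1, y2} = {y1, y2}" using x y by (auto simp: ends_def)
  define d where "d = sym_diff (g x1) (g y1)"
  have fd: "finite d" using cube_coding_sym_diff(2)[OF c x(1) y(1)] by (simp add: d_def)
  have d12: "sym_diff (g x1) (g y2) = sym_diff d {j}" unfolding d_def using y(3) by blast
  have d21: "sym_diff (g x2) (g y1) = sym_diff d {i}" unfolding d_def using x(3) by blast
  have d22: "sym_diff (g x2) (g y2) = sym_diff (sym_diff d {j}) {i}" unfolding d_def using x(3) y(3) by blast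
  have fd': "finite (sym_diff d {j})" using fd by simp
  note cs = card_sym_diff_singleton[OF fd] card_sym_diff_singleton[OF fd']
  have key: "gdist Q x1 y1 + gdist Q x2 y2 \<noteq> gdist Q x1 y2 + gdist Q x2 y1 \<longleftrightarrow> i = j"
  proof -
    have "int (gdist Q x1 y1) = int (card d)" "int (gdist Q x1 y2) = int (card (sym_diff d {j}))"
      "int (gdist Q x2 y1) = int (card (sym_diff d {i}))"
      "int (gdist Q x2 y2) = int (card (sym_diff (sym_diff d {j}) {i}))"
      using cube_coding_gdist[OF c] x y d12 d21 d22 by (auto simp: d_def)
    then have "int (gdist Q x1 y1) + int (gdist Q x2 y2) \<noteq> int (gdist Q x1 y2) + int (gdist Q x2 y1) \<longleftrightarrow> i = j"
      unfolding cs by (auto split: if_splits)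
    then show ?thesis by linarith
  qed
  show ?thesis
  proof
    assume "({x1, x2}, {y1, y2}) \<in> Theta Q"
    then obtain a1 a2 b1 b2 where ab: "{x1, x2} = {a1, a2}" "{y1, y2} = {b1, b2}"
      "gdist Q a1 b1 + gdist Q a2 b2 \<noteq> gdist Q a1 b2 + gdist Q a2 b1"
      by (auto simp: Theta_def ends)
    then have "gdist Q x1 y1 + gdist Q x2 y2 \<noteq> gdist Q x1 y2 + gdist Q x2 y1"
      by (auto simp: doubleton_eq_iff add.commute)
    then show "i = j" using key by blast
  next
    assume "i = j"
    then show "({x1, x2}, {y1, y2}) \<in> Theta Q"
      unfolding Theta_def using E ends key by blast
  qed
qed

lemma hypercube_graph_coding:
  "cube_coding (hypercube_graph k) (\<lambda>xs. {i. i < k \<and> xs ! i}) {..<k}"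
proof -
  let ?g = "\<lambda>xs. {i. i < k \<and> xs ! i}"
  have inj: "inj_on ?g {xs. length xs = k}"
  proof (rule inj_onI)
    fix xs ys :: "bool list" assume "xs \<in> {xs. length xs = k}" "ys \<in> {xs. length xs = k}" "?g xs = ?g ys"
    then show "xs = ys" by (intro nth_equalityI) (auto simp: set_eq_iff)
  qed
  have "?g ` {xs. length xs = k} = Pow {..<k}"
  proof
    show "Pow {..<k} \<subseteq> ?g ` {xs. length xs = k}"
    proof
      fix T assume "T \<in> Pow {..<k}"
      then show "T \<in> ?g ` {xs. length xs = k}"
        by (intro image_eqI[of _ _ "map (\<lambda>i. i \<in> T) [0..<k]"]) auto
    qed
  qed auto
  then have bij: "bij_betw ?g {xs. length xs = k} (Pow {..<k})" using inj by (auto simp: bij_betw_def)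
  have flip: "(\<exists>i<k. ys = xs[i := \<not> xs ! i]) \<longleftrightarrow> (\<exists>i. sym_diff (?g xs) (?g ys) = {i})"
    if l: "length xs = k" "length ys = k" for xs ys :: "bool list"
  proof
    assume "\<exists>i<k. ys = xs[i := \<not> xs ! i]"
    then obtain i where i: "i < k" "ys = xs[i := \<not> xs ! i]" by auto
    have "sym_diff (?g xs) (?g ys) = {i}" using i l by (auto simp: nth_list_update split: if_splits)
    then show "\<exists>i. sym_diff (?g xs) (?g ys) = {i}" by blast
  next
    assume "\<exists>i. sym_diff (?g xs) (?g ys) = {i}"
    then obtain i where i: "sym_diff (?g xs) (?g ys) = {i}" by auto
    then have "i < k" by auto
    moreover have "ys = xs[i := \<not> xs ! i]"
    proof (rule nth_equalityI)
      fix j assume "j < length ys"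
      moreover have "j \<in> sym_diff (?g xs) (?g ys) \<longleftrightarrow> j = i" using i by blast
      ultimately show "ys ! j = xs[i := \<not> xs ! i] ! j"
        using l \<open>i < k\<close> by (cases "j = i") auto
    qed (use l in auto)
    ultimately show "\<exists>i<k. ys = xs[i := \<not> xs ! i]" by blast
  qed
  have "edges (hypercube_graph k) = {{u, v} | u v. u \<in> {xs. length xs = k} \<and> v \<in> {xs. length xs = k} \<and>
      (\<exists>i. sym_diff (?g u) (?g v) = {i})}" (is "?L = ?R")
  proof
    show "?L \<subseteq> ?R"
    proof
      fix e assume "e \<in> ?L"
      then obtain xs i where x: "e = {xs, xs[i := \<not> xs ! i]}" "length xs = k" "i < k"
        by (auto simp: hypercube_graph_def)
      let ?ys = "xs[i := \<not> xs ! i]"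
      have "length ?ys = k" using x by simp
      moreover have "\<exists>i. sym_diff (?g xs) (?g ?ys) = {i}"
        using flip[OF x(2) \<open>length ?ys = k\<close>] x(3) by blast
      ultimately show "e \<in> ?R" using x(1,2) by blast
    qed
    show "?R \<subseteq> ?L"
    proof
      fix e assume "e \<in> ?R"
      then obtain u v where uv: "e = {u, v}" "length u = k" "length v = k" "\<exists>i. sym_diff (?g u) (?g v) = {i}"
        by blast
      then obtain i where "i < k" "v = u[i := \<not> u ! i]" using flip[OF uv(2,3)] by blast
      then show "e \<in> ?L" using uv by (auto simp: hypercube_graph_def)
    qed
  qed
  then show ?thesis using bij by (simp add: cube_coding_def hypercube_graph_def)
qed

text \<open>An isomorphism renames vertices and edges separately; if edges are the sets of their ends,
  the renaming of the vertices determines that of the edges.\<close>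

lemma coding_of_iso:
  assumes iso: "graph_iso Q H" and H: "cube_coding H g K"
    and simple: "\<And>e. e \<in> edges Q \<Longrightarrow> e \<subseteq> verts Q"
  shows "\<exists>g'. cube_coding Q (g' :: 'a \<Rightarrow> 'c set) K"
proof -
  obtain \<phi> \<psi> where b: "bij_betw \<phi> (verts Q) (verts H)" "bij_betw \<psi> (edges Q) (edges H)"
    and en: "\<And>e. e \<in> edges Q \<Longrightarrow> ends H (\<psi> e) = \<phi> ` ends Q e"
    using iso by (auto simp: graph_iso_def)
  have bg: "bij_betw g (verts H) (Pow K)" using H by (auto simp: cube_coding_def)
  have bij: "bij_betw (g \<circ> \<phi>) (verts Q) (Pow K)" by (rule bij_betw_trans[OF b(1) bg])
  have eq: "ends Q e = e" if "e \<in> edges Q" for e using simple[OF that] by (auto simp: ends_def)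
  have phi_in: "\<phi> u \<in> verts H" if "u \<in> verts Q" for u using b(1) that by (auto simp: bij_betw_def)
  have Hends: "ends H {a, c} = {a, c}" if "a \<in> verts H" "c \<in> verts H" for a c
    using that by (auto simp: ends_def)
  have "edges Q = {{u, v} | u v. u \<in> verts Q \<and> v \<in> verts Q \<and> (\<exists>i. sym_diff ((g \<circ> \<phi>) u) ((g \<circ> \<phi>) v) = {i})}"
    (is "_ = ?R")
  proof
    show "edges Q \<subseteq> ?R"
    proof
      fix e assume e: "e \<in> edges Q"
      then have "\<psi> e \<in> edges H" using b(2) by (auto simp: bij_betw_def)
      then obtain a c i where ac: "\<psi> e = {a, c}" "a \<in> verts H" "c \<in> verts H" "sym_diff (g a) (g c) = {i}"
        using H by (auto simp: cube_coding_def)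
      then have "{a, c} = \<phi> ` e" using en[OF e] eq[OF e] Hends by simp
      moreover obtain u v where uv: "u \<in> verts Q" "v \<in> verts Q" "\<phi> u = a" "\<phi> v = c"
        using bij_betw_ex[OF b(1)] ac(2,3) by meson
      ultimately have "\<phi> ` e = \<phi> ` {u, v}" by simp
      then have "e = {u, v}"
        using b(1) simple[OF e] uv inj_on_image_eq_iff[of \<phi> "verts Q" e "{u, v}"] by (simp add: bij_betw_def)
      then show "e \<in> ?R" using uv ac by auto
    qed
    show "?R \<subseteq> edges Q"
    proof
      fix e assume "e \<in> ?R"
      then obtain u v i where uv: "e = {u, v}" "u \<in> verts Q" "v \<in> verts Q"
        "sym_diff (g (\<phi> u)) (g (\<phi> v)) = {i}" by auto
      then have "{\<phi> u, \<phi> v} \<in> edges H" using H phi_in by (auto simp: cube_coding_def)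
      then obtain e' where e': "e' \<in> edges Q" "\<psi> e' = {\<phi> u, \<phi> v}" using bij_betw_ex[OF b(2)] by blast
      then have "\<phi> ` e' = \<phi> ` {u, v}" using en[OF e'(1)] eq[OF e'(1)] Hends phi_in uv by simp
      then have "e' = {u, v}"
        using b(1) simple[OF e'(1)] uv inj_on_image_eq_iff[of \<phi> "verts Q" e' "{u, v}"] by (simp add: bij_betw_def)
      then show "e \<in> edges Q" using e' uv by simp
    qed
  qed
  then have "cube_coding Q (g \<circ> \<phi>) K" using bij H by (auto simp: cube_coding_def)
  then show ?thesis by blast
qed

lemma iso_of_codings:
  assumes Q: "cube_coding Q g K" and H: "cube_coding H h L" and f: "bij_betw f K L"
  shows "graph_iso Q H"
proof -
  have bg: "bij_betw g (verts Q) (Pow K)" and bh: "bij_betw h (verts H) (Pow L)"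
    using Q H by (auto simp: cube_coding_def)
  define \<phi> where "\<phi> u = inv_into (verts H) h (f ` g u)" for u
  have fim: "bij_betw (image f) (Pow K) (Pow L)" using f by (rule bij_betw_Pow)
  have bphi: "bij_betw \<phi> (verts Q) (verts H)"
    using bij_betw_trans[OF bij_betw_trans[OF bg fim] bij_betw_inv_into[OF bh]] by (simp add: \<phi>_def[abs_def] comp_def)
  have hphi: "h (\<phi> u) = f ` g u" if "u \<in> verts Q" for u
  proof -
    have "g u \<in> Pow K" using bg that unfolding bij_betw_def by blast
    then have "f ` g u \<in> Pow L" using fim unfolding bij_betw_def by blast
    then show ?thesis unfolding \<phi>_def using bh by (metis bij_betw_def f_inv_into_f)
  qed
  have flip: "(\<exists>i. sym_diff (h (\<phi> u)) (h (\<phi> v)) = {i}) \<longleftrightarrow> (\<exists>i. sym_diff (g u) (g v) = {i})"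
    if "u \<in> verts Q" "v \<in> verts Q" for u v
  proof -
    have sub: "g u \<subseteq> K" "g v \<subseteq> K" using bg that by (auto simp: bij_betw_def)
    have inj: "inj_on f K" using f by (simp add: bij_betw_def)
    have "sym_diff (h (\<phi> u)) (h (\<phi> v)) = f ` sym_diff (g u) (g v)"
      using sub inj_on_image_set_diff[OF inj, of "g u" "g v"] inj_on_image_set_diff[OF inj, of "g v" "g u"]
      by (simp add: hphi that image_Un Diff_subset subset_trans[OF Diff_subset])
    moreover have "(\<exists>i. f ` X = {i}) \<longleftrightarrow> (\<exists>i. X = {i})" if "X \<subseteq> K" for X
    proof
      assume "\<exists>i. f ` X = {i}"
      then have "card (f ` X) = 1" by auto
      then have "card X = 1" using card_image[OF inj_on_subset[OF inj that]] by simp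
      then show "\<exists>i. X = {i}" by (auto simp: card_1_singleton_iff)
    qed auto
    moreover have "sym_diff (g u) (g v) \<subseteq> K" using sub by auto
    ultimately show ?thesis by simp
  qed
  have sQ: "e \<subseteq> verts Q" if "e \<in> edges Q" for e using that Q by (auto simp: cube_coding_def)
  have bpsi: "bij_betw (image \<phi>) (edges Q) (edges H)"
    unfolding bij_betw_def
  proof
    have "inj_on (image \<phi>) (Pow (verts Q))"
      using bphi by (simp add: bij_betw_def inj_on_image_Pow)
    then show "inj_on (image \<phi>) (edges Q)" by (rule inj_on_subset) (use sQ in auto)
    show "image \<phi> ` edges Q = edges H"
    proof
      show "image \<phi> ` edges Q \<subseteq> edges H"
      proof
        fix e assume "e \<in> image \<phi> ` edges Q"
        then obtain u v where uv: "e = \<phi> ` {u, v}" "u \<in> verts Q" "v \<in> verts Q" "\<exists>i. sym_diff (g u) (g v) = {i}"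
          using Q by (auto simp: cube_coding_def)
        moreover have "\<phi> u \<in> verts H" "\<phi> v \<in> verts H" using bphi uv by (auto simp: bij_betw_def)
        ultimately show "e \<in> edges H" using H flip[OF uv(2,3)] unfolding cube_coding_def by auto
      qed
      show "edges H \<subseteq> image \<phi> ` edges Q"
      proof
        fix e assume "e \<in> edges H"
        then obtain a c where ac: "e = {a, c}" "a \<in> verts H" "c \<in> verts H" "\<exists>i. sym_diff (h a) (h c) = {i}"
          using H by (auto simp: cube_coding_def)
        obtain u v where uv: "u \<in> verts Q" "v \<in> verts Q" "\<phi> u = a" "\<phi> v = c"
          using bij_betw_ex[OF bphi] ac(2,3) by meson
        then have "{u, v} \<in> edges Q" using Q ac flip[OF uv(1,2)] unfolding cube_coding_def by auto
        then show "e \<in> image \<phi> ` edges Q" using ac uv by (intro image_eqI[of _ _ "{u, v}"]) auto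
      qed
    qed
  qed
  have "ends H (\<phi> ` e) = \<phi> ` ends Q e" if "e \<in> edges Q" for e
    using sQ[OF that] bphi by (auto simp: ends_def bij_betw_def)
  then show ?thesis unfolding graph_iso_def using bphi bpsi by blast
qed

text \<open>Opposite edges of a square change the same element, hence so do all parallel edges of a
  cube: there is one label \<open>l i\<close> for each direction \<open>i\<close>.\<close>

lemma cube_labels:
  fixes E :: "'k set \<Rightarrow> 's set"
  assumes K: "finite K" and inj: "inj_on E (Pow K)"
    and step: "\<And>T i. T \<subseteq> K \<Longrightarrow> i \<in> K - T \<Longrightarrow> \<exists>s. sym_diff (E T) (E (insert i T)) = {s}"
  obtains l where "inj_on l K" "\<And>T. T \<subseteq> K \<Longrightarrow> E T = sym_diff (E {}) (l ` T)"
proof -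
  define l where "l i = (SOME s. sym_diff (E {}) (E {i}) = {s})" for i
  have l0: "sym_diff (E {}) (E {i}) = {l i}" if "i \<in> K" for i
    using someI_ex[OF step[of "{}" i]] that by (simp add: l_def)
  have neq: "E T \<noteq> E T'" if "T \<subseteq> K" "T' \<subseteq> K" "T \<noteq> T'" for T T' using inj that by (auto simp: inj_on_def)
  have li: "sym_diff (E T) (E (insert i T)) = {l i}" if "T \<subseteq> K" "i \<in> K - T" for T i
    using finite_subset[OF that(1) K] that
  proof (induction T arbitrary: i rule: finite_induct)
    case empty
    then show ?case using l0 by auto
  next
    case (insert j T)
    have a: "sym_diff (E T) (E (insert i T)) = {l i}" and b: "sym_diff (E T) (E (insert j T)) = {l j}"
      using insert by auto
    obtain c where c: "sym_diff (E (insert j T)) (E (insert i (insert j T))) = {c}"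
      using step[of "insert j T" i] insert.prems by auto
    obtain d where d: "sym_diff (E (insert i T)) (E (insert i (insert j T))) = {d}"
      using step[of "insert i T" j] insert.prems insert.hyps by (auto simp: insert_commute)
    have n1: "E (insert i T) \<noteq> E (insert j T)" using insert.hyps insert.prems by (intro neq) auto
    have "insert i (insert j T) \<noteq> T" using insert.hyps by blast
    then have n2: "E (insert i (insert j T)) \<noteq> E T" using insert.prems by (intro neq) blast+
    have "c = l i" using square_labels[OF a b c d n1 n2] .
    then show ?case using c by simp
  qed
  have "inj_on l K"
  proof (rule inj_onI, rule ccontr)
    fix i j assume ij: "i \<in> K" "j \<in> K" "l i = l j" "i \<noteq> j"
    then have "E {i} = E {j}" using sym_diff_cancel[of "E {i}" "E {}" "l i" "E {j}"] l0[of i] l0[of j]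
      by (simp add: Un_commute)
    then show False using neq[of "{i}" "{j}"] ij by auto
  qed
  moreover have "E T = sym_diff (E {}) (l ` T)" if "T \<subseteq> K" for T
    using finite_subset[OF that K] that
  proof (induction T rule: finite_induct)
    case (insert j T)
    have "E T = sym_diff (E {}) (l ` T)" "sym_diff (E T) (E (insert j T)) = {l j}"
      using insert.IH insert.hyps insert.prems li[of T j] by auto
    moreover have "l j \<notin> l ` T" using \<open>inj_on l K\<close> insert.hyps insert.prems by (auto simp: inj_on_def)
    ultimately have "x \<in> E (insert j T) \<longleftrightarrow> x \<in> sym_diff (E {}) (insert (l j) (l ` T))" for x
      unfolding set_eq_iff by (cases "x = l j") auto
    then show ?case by auto
  qed auto
  ultimately show ?thesis using that by blast
qed

text \<open>The graph of up-sets of a finite poset, where \<open>D\<close> gives the up-set that a vertex stands for.\<close>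

locale upset_graph =
  fixes R :: "'m graph" and D :: "'m \<Rightarrow> 's set" and F :: "'s set" and le :: "'s \<Rightarrow> 's \<Rightarrow> bool"
  assumes finF: "finite F"
    and le_refl: "\<And>x. x \<in> F \<Longrightarrow> le x x"
    and le_trans: "\<And>x y z. \<lbrakk>x \<in> F; y \<in> F; z \<in> F; le x y; le y z\<rbrakk> \<Longrightarrow> le x z"
    and le_antisym: "\<And>x y. \<lbrakk>x \<in> F; y \<in> F; le x y; le y x\<rbrakk> \<Longrightarrow> x = y"
    and D_bij: "bij_betw D (verts R) {U. U \<subseteq> F \<and> (\<forall>x\<in>U. \<forall>y\<in>F. le x y \<longrightarrow> y \<in> U)}"
    and R_edges: "edges R = {{M, N} | M N. M \<in> verts R \<and> N \<in> verts R \<and> (\<exists>s. sym_diff (D M) (D N) = {s})}"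
begin

definition upset :: "'s set \<Rightarrow> bool" where
  "upset U \<longleftrightarrow> U \<subseteq> F \<and> (\<forall>x\<in>U. \<forall>y\<in>F. le x y \<longrightarrow> y \<in> U)"

definition antichain :: "'s set \<Rightarrow> bool" where
  "antichain S \<longleftrightarrow> S \<subseteq> F \<and> (\<forall>s\<in>S. \<forall>t\<in>S. le s t \<longrightarrow> s = t)"

definition max_antichain :: "'s set \<Rightarrow> bool" where
  "max_antichain S \<longleftrightarrow> antichain S \<and> (\<forall>x\<in>F. \<exists>s\<in>S. le s x \<or> le x s)"

definition label :: "'m set \<Rightarrow> 's \<Rightarrow> bool" where
  "label x s \<longleftrightarrow> (\<exists>M N. x = {M, N} \<and> M \<in> verts R \<and> N \<in> verts R \<and> sym_diff (D M) (D N) = {s})"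

definition labels :: "'m graph \<Rightarrow> 's set" where
  "labels Q = {s. \<exists>T\<in>Theta_classes Q. \<forall>x\<in>T. label x s}"

definition cube :: "'s set \<Rightarrow> 's set \<Rightarrow> 'm graph" where
  "cube D0 S = (let V = {M \<in> verts R. D0 \<subseteq> D M \<and> D M \<subseteq> D0 \<union> S} in
     \<lparr>verts = V, edges = {{M, N} | M N. M \<in> V \<and> N \<in> V \<and> (\<exists>s. sym_diff (D M) (D N) = {s})}\<rparr>)"

text \<open>The members of \<open>S\<close> can be added to \<open>D0\<close> and removed again independently of each other.\<close>

definition valid :: "'s set \<Rightarrow> 's set \<Rightarrow> bool" where
  "valid D0 S \<longleftrightarrow> D0 \<inter> S = {} \<and> (\<forall>U\<subseteq>S. upset (D0 \<union> U))"

lemma D_upset: "M \<in> verts R \<Longrightarrow> upset (D M)"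
  using D_bij by (auto simp: bij_betw_def upset_def)

lemma D_inj: "M \<in> verts R \<Longrightarrow> N \<in> verts R \<Longrightarrow> D M = D N \<Longrightarrow> M = N"
  using D_bij by (auto simp: bij_betw_def inj_on_def)

lemma D_surj: "upset U \<Longrightarrow> \<exists>M\<in>verts R. D M = U"
proof -
  assume "upset U"
  then have "U \<in> D ` verts R" using D_bij unfolding bij_betw_def upset_def by simp
  then show ?thesis by auto
qed

lemma valid_subset: "valid D0 S \<Longrightarrow> D0 \<union> S \<subseteq> F"
  by (auto simp: valid_def upset_def)

lemma strict_order:
  assumes "I \<subseteq> F"
  shows "asymp_on I (\<lambda>x y. le x y \<and> x \<noteq> y)" "transp_on I (\<lambda>x y. le x y \<and> x \<noteq> y)"
proof -
  show "asymp_on I (\<lambda>x y. le x y \<and> x \<noteq> y)"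
    by (rule asymp_onI) (use assms le_antisym in blast)
  show "transp_on I (\<lambda>x y. le x y \<and> x \<noteq> y)"
    by (rule transp_onI) (metis assms le_antisym le_trans subsetD)
qed

lemma cube_verts: "verts (cube D0 S) = {M \<in> verts R. D0 \<subseteq> D M \<and> D M \<subseteq> D0 \<union> S}"
  by (simp add: cube_def Let_def)

lemma cube_coding_cube:
  assumes "valid D0 S"
  shows "cube_coding (cube D0 S) (\<lambda>M. D M - D0) S"
  unfolding cube_coding_def
proof (intro conjI)
  show "finite S" using valid_subset[OF assms] finF finite_subset by auto
  have "inj_on (\<lambda>M. D M - D0) (verts (cube D0 S))"
  proof (rule inj_onI)
    fix M N assume MN: "M \<in> verts (cube D0 S)" "N \<in> verts (cube D0 S)" "D M - D0 = D N - D0"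
    then have "D M = D N" by (auto simp: cube_verts)
    then show "M = N" using D_inj MN by (auto simp: cube_verts)
  qed
  moreover have "(\<lambda>M. D M - D0) ` verts (cube D0 S) = Pow S"
  proof
    show "Pow S \<subseteq> (\<lambda>M. D M - D0) ` verts (cube D0 S)"
    proof
      fix U assume U: "U \<in> Pow S"
      then obtain M where M: "M \<in> verts R" "D M = D0 \<union> U"
        using assms D_surj[of "D0 \<union> U"] by (auto simp: valid_def)
      moreover have "D0 \<inter> U = {}" using U assms by (auto simp: valid_def)
      ultimately show "U \<in> (\<lambda>M. D M - D0) ` verts (cube D0 S)"
        using U by (intro image_eqI[of _ _ M]) (auto simp: cube_verts)
    qed
  qed (auto simp: cube_verts)
  ultimately show "bij_betw (\<lambda>M. D M - D0) (verts (cube D0 S)) (Pow S)" by (auto simp: bij_betw_def)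
  have "sym_diff (D M - D0) (D N - D0) = sym_diff (D M) (D N)"
    if "M \<in> verts (cube D0 S)" "N \<in> verts (cube D0 S)" for M N
    using that by (auto simp: cube_verts)
  then show "edges (cube D0 S) = {{u, v} |u v. u \<in> verts (cube D0 S) \<and> v \<in> verts (cube D0 S) \<and>
          (\<exists>i. sym_diff (D u - D0) (D v - D0) = {i})}"
    unfolding cube_def Let_def graph.simps by (rule_tac Collect_cong) (metis (mono_tags, lifting))
qed

lemma cube_is_hypercube:
  assumes "valid D0 S"
  shows "subgraph (cube D0 S) R" "graph_iso (cube D0 S) (hypercube_graph (card S))"
proof -
  show "subgraph (cube D0 S) R"
    unfolding subgraph_def
  proof (intro conjI ballI)
    show "edges (cube D0 S) \<subseteq> edges R" unfolding R_edges cube_def Let_def graph.simps by blast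
  qed (auto simp: cube_def Let_def ends_def)
  have "finite S" using valid_subset[OF assms] finF finite_subset by auto
  then obtain f where "bij_betw f S {..<card S}" using ex_bij_betw_finite_nat[of S] by (auto simp: atLeast0LessThan)
  then show "graph_iso (cube D0 S) (hypercube_graph (card S))"
    using iso_of_codings[OF cube_coding_cube[OF assms] hypercube_graph_coding] by blast
qed

lemma labels_cube:
  assumes "valid D0 S"
  shows "labels (cube D0 S) = S"
proof -
  note c = cube_coding_cube[OF assms]
  have sd: "sym_diff (D M - D0) (D N - D0) = sym_diff (D M) (D N)"
    if "M \<in> verts (cube D0 S)" "N \<in> verts (cube D0 S)" for M N
    using that by (auto simp: cube_verts)
  have E: "\<exists>M N s. x = {M, N} \<and> M \<in> verts (cube D0 S) \<and> N \<in> verts (cube D0 S) \<and> sym_diff (D M) (D N) = {s}"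
    if "x \<in> edges (cube D0 S)" for x
    using that unfolding cube_def Let_def graph.simps by blast
  have lab: "label {M, N} s \<longleftrightarrow> sym_diff (D M) (D N) = {s}"
    if "M \<in> verts (cube D0 S)" "N \<in> verts (cube D0 S)" for M N s
    using that by (auto simp: label_def cube_verts doubleton_eq_iff Un_commute)
  have Th: "({M, N}, {M', N'}) \<in> Theta (cube D0 S) \<longleftrightarrow> s = s'"
    if "M \<in> verts (cube D0 S)" "N \<in> verts (cube D0 S)" "sym_diff (D M) (D N) = {s}"
      "M' \<in> verts (cube D0 S)" "N' \<in> verts (cube D0 S)" "sym_diff (D M') (D N') = {s'}" for M N M' N' s s'
    using cube_coding_Theta[OF c that(1,2) _ that(4,5), of s s'] sd that by simp
  show ?thesis
  proof
    show "labels (cube D0 S) \<subseteq> S"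
    proof
      fix s assume "s \<in> labels (cube D0 S)"
      then obtain x where x: "x \<in> edges (cube D0 S)" "\<forall>y\<in>Theta (cube D0 S) `` {x}. label y s"
        by (auto simp: labels_def Theta_classes_def quotient_def)
      obtain M N t where MN: "x = {M, N}" "M \<in> verts (cube D0 S)" "N \<in> verts (cube D0 S)"
        "sym_diff (D M) (D N) = {t}" using E[OF x(1)] by blast
      have "(x, x) \<in> Theta (cube D0 S)" using Th[OF MN(2-4) MN(2-4)] MN(1) by blast
      then have "label x s" using x(2) by blast
      then have "sym_diff (D M) (D N) = {s}" using lab MN by blast
      then have "s \<in> D M \<and> s \<notin> D N \<or> s \<in> D N \<and> s \<notin> D M" by blast
      then show "s \<in> S" using MN(2,3) unfolding cube_verts by blast
    qed
    show "S \<subseteq> labels (cube D0 S)"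
    proof
      fix s assume s: "s \<in> S"
      obtain M where M: "M \<in> verts R" "D M = D0" using assms D_surj[of D0] unfolding valid_def by (metis empty_subsetI sup_bot_right)
      obtain N where N: "N \<in> verts R" "D N = D0 \<union> {s}" using assms D_surj[of "D0 \<union> {s}"] s unfolding valid_def by blast
      have V: "M \<in> verts (cube D0 S)" "N \<in> verts (cube D0 S)" using M N s by (auto simp: cube_verts)
      have sMN: "sym_diff (D M) (D N) = {s}" using M N s assms by (auto simp: valid_def)
      have x: "{M, N} \<in> edges (cube D0 S)" using V sMN unfolding cube_def Let_def graph.simps by blast
      have "label y s" if "({M, N}, y) \<in> Theta (cube D0 S)" for y
      proof -
        have "y \<in> edges (cube D0 S)" using that by (auto simp: Theta_def)
        then obtain M' N' t where y: "y = {M', N'}" "M' \<in> verts (cube D0 S)" "N' \<in> verts (cube D0 S)"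
          "sym_diff (D M') (D N') = {t}" using E by blast
        then have "s = t" using Th[OF V sMN y(2-4)] that by blast
        then show ?thesis using lab y by blast
      qed
      then show "s \<in> labels (cube D0 S)"
        using x by (auto simp: labels_def Theta_classes_def quotient_def)
    qed
  qed
qed

text \<open>By \<open>cube_labels\<close> the up-sets of the vertices are those of one vertex, changed in a set of labels;
  removing all labels gives \<open>D0\<close>.\<close>

lemma hypercube_is_cube:
  assumes sub: "subgraph Q R" and iso: "graph_iso Q (hypercube_graph k)"
  obtains D0 S where "valid D0 S" "Q = cube D0 S" "card S = k"
proof -
  have VR: "verts Q \<subseteq> verts R" using sub by (auto simp: subgraph_def)
  have simple: "e \<subseteq> verts Q" if "e \<in> edges Q" for e
  proof -
    have "e \<in> edges R" "ends R e \<subseteq> verts Q" using sub that by (auto simp: subgraph_def)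
    then show ?thesis unfolding R_edges by (auto simp: ends_def)
  qed
  obtain g where c: "cube_coding Q (g :: 'm \<Rightarrow> nat set) {..<k}"
    using coding_of_iso[OF iso hypercube_graph_coding simple] by blast
  have gb: "bij_betw g (verts Q) (Pow {..<k})"
    and QE: "edges Q = {{u, v} | u v. u \<in> verts Q \<and> v \<in> verts Q \<and> (\<exists>i. sym_diff (g u) (g v) = {i})}"
    using c by (auto simp: cube_coding_def)
  define h where "h = inv_into (verts Q) g"
  have hV: "h T \<in> verts Q" "g (h T) = T" if "T \<subseteq> {..<k}" for T
  proof -
    have "T \<in> g ` verts Q" using gb that by (simp add: bij_betw_def)
    then show "h T \<in> verts Q" "g (h T) = T" unfolding h_def by (rule inv_into_into, rule f_inv_into_f)
  qed
  have hg: "h (g u) = u" "g u \<subseteq> {..<k}" if "u \<in> verts Q" for u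
    using gb that by (auto simp: h_def bij_betw_def)
  have labR: "\<exists>s. sym_diff (D u) (D v) = {s}" if uv: "u \<in> verts Q" "v \<in> verts Q" "sym_diff (g u) (g v) = {i}" for u v i
  proof -
    have "{u, v} \<in> edges Q" using uv QE by blast
    then have "{u, v} \<in> edges R" using sub by (auto simp: subgraph_def)
    then show ?thesis unfolding R_edges by (auto simp: doubleton_eq_iff Un_commute)
  qed
  have inj: "inj_on (\<lambda>T. D (h T)) (Pow {..<k})"
  proof (rule inj_onI)
    fix T T' assume "T \<in> Pow {..<k}" "T' \<in> Pow {..<k}" "D (h T) = D (h T')"
    then have "h T = h T'" using D_inj VR hV(1) by blast
    then show "T = T'" using hV(2) \<open>T \<in> Pow {..<k}\<close> \<open>T' \<in> Pow {..<k}\<close> by (metis PowD)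
  qed
  have step: "\<exists>s. sym_diff (D (h T)) (D (h (insert i T))) = {s}" if "T \<subseteq> {..<k}" "i \<in> {..<k} - T" for T i
  proof -
    have sub: "insert i T \<subseteq> {..<k}" using that by auto
    have "sym_diff (g (h T)) (g (h (insert i T))) = {i}" using that by (auto simp: hV(2)[OF that(1)] hV(2)[OF sub])
    then show ?thesis using labR hV(1)[OF that(1)] hV(1)[OF sub] by blast
  qed
  obtain l where l: "inj_on l {..<k}" "\<And>T. T \<subseteq> {..<k} \<Longrightarrow> D (h T) = sym_diff (D (h {})) (l ` T)"
    using cube_labels[OF finite_lessThan inj step] by blast
  define S where "S = l ` {..<k}"
  define D0 where "D0 = D (h {}) - S"
  have range: "(\<exists>u\<in>verts Q. D u = W) \<longleftrightarrow> D0 \<subseteq> W \<and> W \<subseteq> D0 \<union> S" for W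
  proof
    assume "\<exists>u\<in>verts Q. D u = W"
    then obtain u where u: "u \<in> verts Q" "D u = W" by auto
    then have "W = sym_diff (D (h {})) (l ` g u)" using l(2)[OF hg(2)[OF u(1)]] hg(1)[OF u(1)] by simp
    moreover have "l ` g u \<subseteq> S" using hg(2)[OF u(1)] by (auto simp: S_def)
    ultimately show "D0 \<subseteq> W \<and> W \<subseteq> D0 \<union> S" unfolding D0_def by blast
  next
    assume W: "D0 \<subseteq> W \<and> W \<subseteq> D0 \<union> S"
    define T where "T = {i. i < k \<and> l i \<in> sym_diff (D (h {})) W}"
    have T: "T \<subseteq> {..<k}" by (auto simp: T_def)
    have "sym_diff (D (h {})) W \<subseteq> S" using W unfolding D0_def by blast
    then have "l ` T = sym_diff (D (h {})) W" by (auto simp: T_def S_def)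
    then have "D (h T) = sym_diff (D (h {})) (sym_diff (D (h {})) W)" using l(2)[OF T] by simp
    also have "\<dots> = W" by blast
    finally have "D (h T) = W" .
    then show "\<exists>u\<in>verts Q. D u = W" using hV(1)[OF T] by blast
  qed
  have "valid D0 S"
    unfolding valid_def
  proof (intro conjI allI impI)
    show "D0 \<inter> S = {}" by (auto simp: D0_def)
    fix U assume "U \<subseteq> S"
    then have "\<exists>u\<in>verts Q. D u = D0 \<union> U" using range[of "D0 \<union> U"] by auto
    then show "upset (D0 \<union> U)" using D_upset VR by (metis subsetD)
  qed
  moreover have "Q = cube D0 S"
  proof -
    have V: "verts Q = verts (cube D0 S)"
    proof
      show "verts Q \<subseteq> verts (cube D0 S)"
      proof
        fix M assume "M \<in> verts Q"
        then have "D0 \<subseteq> D M \<and> D M \<subseteq> D0 \<union> S" using range[of "D M"] by metis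
        then show "M \<in> verts (cube D0 S)" using VR \<open>M \<in> verts Q\<close> by (auto simp: cube_verts)
      qed
      show "verts (cube D0 S) \<subseteq> verts Q"
      proof
        fix M assume "M \<in> verts (cube D0 S)"
        then have M: "M \<in> verts R" "D0 \<subseteq> D M \<and> D M \<subseteq> D0 \<union> S" by (auto simp: cube_verts)
        then obtain u where "u \<in> verts Q" "D u = D M" using range[of "D M"] by metis
        then show "M \<in> verts Q" using D_inj M(1) VR by (metis subsetD)
      qed
    qed
    have sd: "(\<exists>i. sym_diff (g u) (g v) = {i}) \<longleftrightarrow> (\<exists>s. sym_diff (D u) (D v) = {s})"
      if uv: "u \<in> verts Q" "v \<in> verts Q" for u v
    proof
      assume "\<exists>s. sym_diff (D u) (D v) = {s}"
      then obtain s where s: "sym_diff (D u) (D v) = {s}" by blast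
      have "D u = sym_diff (D (h {})) (l ` g u)" "D v = sym_diff (D (h {})) (l ` g v)"
        using l(2)[OF hg(2)] hg(1) uv by metis+
      then have "sym_diff (D u) (D v) = sym_diff (l ` g u) (l ` g v)" by (simp only: sym_diff_left)
      then have "sym_diff (l ` g u) (l ` g v) = {s}" using s by simp
      then have "l ` sym_diff (g u) (g v) = {s}"
        
        using inj_on_image_set_diff[OF l(1), of "g u" "g v"] inj_on_image_set_diff[OF l(1), of "g v" "g u"]
          hg(2)[OF uv(1)] hg(2)[OF uv(2)]
        by (simp add: image_Un subset_trans[OF Diff_subset])
      moreover have "sym_diff (g u) (g v) \<subseteq> {..<k}" using hg(2) uv by blast
      ultimately have "card (sym_diff (g u) (g v)) = 1"
        using card_image[OF inj_on_subset[OF l(1)]] by (metis is_singletonI is_singleton_altdef)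
      then show "\<exists>i. sym_diff (g u) (g v) = {i}" by (simp add: card_1_singleton_iff)
    qed (use labR uv in blast)
    have "edges Q = edges (cube D0 S)"
    proof -
      have "edges (cube D0 S) = {{M, N} | M N. M \<in> verts Q \<and> N \<in> verts Q \<and> (\<exists>s. sym_diff (D M) (D N) = {s})}"
        unfolding V by (simp add: cube_def Let_def)
      also have "\<dots> = edges Q" unfolding QE by (rule Collect_cong) (metis (mono_tags, lifting) sd)
      finally show ?thesis by simp
    qed
    then show ?thesis using V by (cases Q; cases "cube D0 S") simp
  qed
  moreover have "card S = k" using card_image[OF l(1)] by (simp add: S_def)
  ultimately show ?thesis using that by blast
qed

lemma is_hypercube_iff: "is_hypercube_of R Q \<longleftrightarrow> (\<exists>D0 S. valid D0 S \<and> Q = cube D0 S)"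
proof
  assume "is_hypercube_of R Q"
  then obtain k where "subgraph Q R" "graph_iso Q (hypercube_graph k)" by (auto simp: is_hypercube_of_def)
  then show "\<exists>D0 S. valid D0 S \<and> Q = cube D0 S" by (metis hypercube_is_cube)
next
  assume "\<exists>D0 S. valid D0 S \<and> Q = cube D0 S"
  then show "is_hypercube_of R Q" using cube_is_hypercube unfolding is_hypercube_of_def by blast
qed

lemma nontrivial_iff: "Q \<in> nontrivial_hypercubes R \<longleftrightarrow> (\<exists>D0 S. valid D0 S \<and> Q = cube D0 S \<and> S \<noteq> {})"
proof
  assume "Q \<in> nontrivial_hypercubes R"
  then obtain k where k: "k \<ge> 1" "subgraph Q R" "graph_iso Q (hypercube_graph k)"
    by (auto simp: nontrivial_hypercubes_def)
  obtain D0 S where "valid D0 S" "Q = cube D0 S" "card S = k" using hypercube_is_cube[OF k(2,3)] .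
  then show "\<exists>D0 S. valid D0 S \<and> Q = cube D0 S \<and> S \<noteq> {}" using k by fastforce
next
  assume "\<exists>D0 S. valid D0 S \<and> Q = cube D0 S \<and> S \<noteq> {}"
  then obtain D0 S where v: "valid D0 S" "Q = cube D0 S" "S \<noteq> {}" by auto
  have "finite S" using valid_subset[OF v(1)] finF finite_subset by auto
  then have "1 \<le> card S" using v by (simp add: Suc_le_eq card_gt_0_iff)
  then show "Q \<in> nontrivial_hypercubes R"
    using cube_is_hypercube[OF v(1)] v(2) by (auto simp: nontrivial_hypercubes_def)
qed

lemma valid_antichain:
  assumes "valid D0 S"
  shows "antichain S"
  unfolding antichain_def
proof (intro conjI ballI impI)
  show "S \<subseteq> F" using valid_subset[OF assms] by auto
  fix s t assume st: "s \<in> S" "t \<in> S" "le s t"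
  have "upset (D0 \<union> {s})" using assms st by (auto simp: valid_def)
  then have "t \<in> D0 \<union> {s}" using st \<open>S \<subseteq> F\<close> by (auto simp: upset_def)
  then show "s = t" using assms st by (auto simp: valid_def)
qed

definition above :: "'s set \<Rightarrow> 's set" where
  "above S = {x \<in> F - S. \<exists>s\<in>S. le s x}"

lemma valid_above:
  assumes "antichain S"
  shows "valid (above S) S"
  unfolding valid_def
proof (intro conjI allI impI)
  show "above S \<inter> S = {}" by (auto simp: above_def)
  fix U assume U: "U \<subseteq> S"
  have SF: "S \<subseteq> F" and ac: "\<And>s t. s \<in> S \<Longrightarrow> t \<in> S \<Longrightarrow> le s t \<Longrightarrow> s = t"
    using assms by (auto simp: antichain_def)
  show "upset (above S \<union> U)"
    unfolding upset_def
  proof (intro conjI ballI impI)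
    show "above S \<union> U \<subseteq> F" using SF U by (auto simp: above_def)
    fix x y assume x: "x \<in> above S \<union> U" and y: "y \<in> F" "le x y"
    have xF: "x \<in> F" using x SF U by (auto simp: above_def)
    obtain s where s: "s \<in> S" "le s x" using x U SF le_refl by (auto simp: above_def)
    then have sy: "le s y" using le_trans[of s x y] xF y SF by auto
    show "y \<in> above S \<union> U"
    proof (cases "y \<in> S")
      case True
      then have "s = y" using ac s(1) sy by blast
      then have "x = y" using le_antisym[OF xF y(1) y(2)] s by simp
      then show ?thesis using x by simp
    next
      case False
      then show ?thesis using y s sy by (auto simp: above_def)
    qed
  qed
qed

lemma valid_above_subset: "valid D0 S \<Longrightarrow> above S \<subseteq> D0"
proof
  fix x assume v: "valid D0 S" and "x \<in> above S"
  then obtain s where s: "s \<in> S" "le s x" "x \<in> F" "x \<notin> S" by (auto simp: above_def)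
  have "upset (D0 \<union> {s})" using v s by (auto simp: valid_def)
  then show "x \<in> D0" using s by (auto simp: upset_def)
qed

lemma valid_not_below:
  assumes "valid D0 S" "x \<in> D0" "s \<in> S"
  shows "\<not> le x s"
proof
  assume "le x s"
  have "upset (D0 \<union> {})" using assms(1) unfolding valid_def by blast
  moreover have "s \<in> F" using valid_subset[OF assms(1)] assms by auto
  ultimately have "s \<in> D0" using assms \<open>le x s\<close> by (auto simp: upset_def)
  then show False using assms by (auto simp: valid_def)
qed

text \<open>In any case \<open>D0\<close> contains all elements above \<open>S\<close> and none below \<open>S\<close>, which leaves no choice
  if every element is comparable with a member of \<open>S\<close>.\<close>

lemma valid_max_antichain:
  assumes "valid D0 S" "max_antichain S"
  shows "D0 = above S"
proof
  show "above S \<subseteq> D0" using valid_above_subset[OF assms(1)] .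
  show "D0 \<subseteq> above S"
  proof
    fix x assume x: "x \<in> D0"
    have xF: "x \<in> F" "x \<notin> S" using valid_subset[OF assms(1)] x assms(1) by (auto simp: valid_def)
    then obtain s where "s \<in> S" "le s x \<or> le x s" using assms(2) by (auto simp: max_antichain_def)
    then show "x \<in> above S" using valid_not_below[OF assms(1) x] xF by (auto simp: above_def)
  qed
qed

text \<open>Consider the elements that are comparable with no member of \<open>S\<close>.  If there are some in \<open>D0\<close>,
  then a minimal one of these can be removed; otherwise a maximal one can be added.\<close>

lemma valid_extend:
  assumes v: "valid D0 S" and nm: "\<not> max_antichain S"
  obtains D1 t where "t \<in> F" "t \<notin> S" "valid D1 (insert t S)" "D1 \<subseteq> D0" "D0 \<union> S \<subseteq> D1 \<union> insert t S"
proof -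
  have ac: "antichain S" and SF: "S \<subseteq> F" using valid_antichain[OF v] by (auto simp: antichain_def)
  have D0F: "D0 \<subseteq> F" using valid_subset[OF v] by auto
  define I where "I = {x \<in> F. \<forall>s\<in>S. \<not> le s x \<and> \<not> le x s}"
  have Ine: "I \<noteq> {}" using nm ac by (auto simp: max_antichain_def I_def)
  have finI: "finite I" using finF by (auto simp: I_def)
  have IS: "I \<inter> S = {}" using le_refl SF by (auto simp: I_def)
  show ?thesis
  proof (cases "I \<inter> D0 = {}")
    case False
    have "\<exists>t\<in>I \<inter> D0. \<forall>y\<in>I \<inter> D0. le y t \<longrightarrow> y = t"
    proof -
      have "asymp_on (I \<inter> D0) (\<lambda>x y. le x y \<and> x \<noteq> y)" "transp_on (I \<inter> D0) (\<lambda>x y. le x y \<and> x \<noteq> y)"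
        using strict_order[of "I \<inter> D0"] finI D0F by auto
      from Finite_Set.bex_min_element[OF _ this] False finI show ?thesis by blast
    qed
    then obtain t where t: "t \<in> I" "t \<in> D0" and tm: "\<And>y. y \<in> I \<Longrightarrow> y \<in> D0 \<Longrightarrow> le y t \<Longrightarrow> y = t" by blast
    have tF: "t \<in> F" "t \<notin> S" using t IS by (auto simp: I_def)
    have "valid (D0 - {t}) (insert t S)"
      unfolding valid_def
    proof (intro conjI allI impI)
      show "(D0 - {t}) \<inter> insert t S = {}" using v by (auto simp: valid_def)
      fix U assume U: "U \<subseteq> insert t S"
      have up: "upset (D0 \<union> (U - {t}))" 
      proof -
        have "U - {t} \<subseteq> S" using U by auto
        then show ?thesis using v unfolding valid_def by blast
      qed
      show "upset (D0 - {t} \<union> U)"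
        unfolding upset_def
      proof (intro conjI ballI impI)
        show "D0 - {t} \<union> U \<subseteq> F" using D0F U SF tF by auto
        fix x y assume x: "x \<in> D0 - {t} \<union> U" and y: "y \<in> F" "le x y"
        have xD: "x \<in> D0 \<union> (U - {t})" using x t by auto
        then have yD: "y \<in> D0 \<union> (U - {t})" using up y by (auto simp: upset_def)
        show "y \<in> D0 - {t} \<union> U"
        proof (rule ccontr)
          assume "y \<notin> D0 - {t} \<union> U"
          then have yt: "y = t" "t \<notin> U" using yD by auto
          have xF: "x \<in> F" using x D0F U SF tF by auto
          show False
          proof (cases "x \<in> U")
            case True
            then have "x \<in> S" using U yt by auto
            then show False using y yt t by (auto simp: I_def)
          next
            case F: False
            then have xD0: "x \<in> D0" "x \<noteq> t" using x by auto
            then have "x \<notin> I" using tm y yt by auto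
            then obtain s where s: "s \<in> S" "le s x \<or> le x s" using xF by (auto simp: I_def)
            then have "le s x" using valid_not_below[OF v xD0(1)] by blast
            then have "le s t" using le_trans[of s x t] s SF xF tF y yt by auto
            then show False using t s by (auto simp: I_def)
          qed
        qed
      qed
    qed
    then show ?thesis using that[of t "D0 - {t}"] tF t by auto
  next
    case empty: True
    have "\<exists>t\<in>I. \<forall>y\<in>I. le t y \<longrightarrow> y = t"
    proof -
      have "asymp_on I (\<lambda>x y. le x y \<and> x \<noteq> y)" "transp_on I (\<lambda>x y. le x y \<and> x \<noteq> y)"
        using strict_order[of I] by (auto simp: I_def)
      from Finite_Set.bex_max_element[OF finI this Ine] show ?thesis by blast
    qed
    then obtain t where t: "t \<in> I" and tm: "\<And>y. y \<in> I \<Longrightarrow> le t y \<Longrightarrow> y = t" by blast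
    have tF: "t \<in> F" "t \<notin> S" "t \<notin> D0" using t IS empty by (auto simp: I_def)
    have "valid D0 (insert t S)"
      unfolding valid_def
    proof (intro conjI allI impI)
      show "D0 \<inter> insert t S = {}" using v tF by (auto simp: valid_def)
      fix U assume U: "U \<subseteq> insert t S"
      have up: "upset (D0 \<union> (U - {t}))" 
      proof -
        have "U - {t} \<subseteq> S" using U by auto
        then show ?thesis using v unfolding valid_def by blast
      qed
      show "upset (D0 \<union> U)"
        unfolding upset_def
      proof (intro conjI ballI impI)
        show "D0 \<union> U \<subseteq> F" using D0F U SF tF by auto
        fix x y assume x: "x \<in> D0 \<union> U" and y: "y \<in> F" "le x y"
        show "y \<in> D0 \<union> U"
        proof (cases "x = t")
          case False
          then have "x \<in> D0 \<union> (U - {t})" using x by auto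
          then show ?thesis using up y by (auto simp: upset_def)
        next
          case True
          show ?thesis
          proof (cases "y = t")
            case True
            then show ?thesis using x \<open>x = t\<close> by simp
          next
            case False
            then have "y \<notin> I" using tm y True by auto
            then obtain s where s: "s \<in> S" "le s y \<or> le y s" using y by (auto simp: I_def)
            have "\<not> le y s"
              using le_trans[of t y s] s SF y tF True t by (auto simp: I_def)
            then have "le s y" using s by simp
            moreover have "y \<notin> S" using y True t by (auto simp: I_def)
            ultimately have "y \<in> above S" using s y by (auto simp: above_def)
            then show ?thesis using valid_above_subset[OF v] by auto
          qed
        qed
      qed
    qed
    then show ?thesis using that[of t D0] tF by auto
  qed
qed

lemma cube_mono:
  assumes "D1 \<subseteq> D0" "D0 \<union> S \<subseteq> D1 \<union> S'"
  shows "subgraph (cube D0 S) (cube D1 S')"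
proof -
  have V: "verts (cube D0 S) \<subseteq> verts (cube D1 S')" using assms unfolding cube_verts by blast
  have "edges (cube D0 S) \<subseteq> edges (cube D1 S')"
    using V unfolding cube_def Let_def graph.simps by blast
  moreover have "ends (cube D1 S') e \<subseteq> verts (cube D0 S)" if "e \<in> edges (cube D0 S)" for e
    using that unfolding cube_def Let_def graph.simps ends_def by blast
  ultimately show ?thesis using V by (auto simp: subgraph_def)
qed

lemma cube_subgraph_labels:
  assumes v: "valid D0 S" "valid D1 S'" and sub: "subgraph (cube D0 S) (cube D1 S')"
  shows "S \<subseteq> S'"
proof
  fix s assume s: "s \<in> S"
  obtain M where M: "M \<in> verts R" "D M = D0" using v(1) D_surj[of D0] unfolding valid_def by (metis empty_subsetI sup_bot_right)
  obtain N where N: "N \<in> verts R" "D N = D0 \<union> {s}" using v(1) D_surj[of "D0 \<union> {s}"] s unfolding valid_def by blast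
  have "M \<in> verts (cube D0 S)" "N \<in> verts (cube D0 S)" using M N s by (auto simp: cube_verts)
  then have "M \<in> verts (cube D1 S')" "N \<in> verts (cube D1 S')" using sub by (auto simp: subgraph_def)
  then have "D1 \<subseteq> D0" "D0 \<union> {s} \<subseteq> D1 \<union> S'" using M N by (auto simp: cube_verts)
  moreover have "s \<notin> D0" using v(1) s by (auto simp: valid_def)
  ultimately show "s \<in> S'" by auto
qed

lemma max_antichain_iff:
  "max_antichain S \<longleftrightarrow> antichain S \<and> (\<forall>T. antichain T \<and> S \<subseteq> T \<longrightarrow> T = S)"
proof
  assume m: "max_antichain S"
  show "antichain S \<and> (\<forall>T. antichain T \<and> S \<subseteq> T \<longrightarrow> T = S)"
  proof (intro conjI allI impI)
    show "antichain S" using m by (simp add: max_antichain_def)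
    fix T assume T: "antichain T \<and> S \<subseteq> T"
    have "x \<in> S" if x: "x \<in> T" for x
    proof -
      have "x \<in> F" using T x by (auto simp: antichain_def)
      then obtain s where "s \<in> S" "le s x \<or> le x s" using m by (auto simp: max_antichain_def)
      then show ?thesis using T x by (auto simp: antichain_def)
    qed
    then show "T = S" using T by auto
  qed
next
  assume m: "antichain S \<and> (\<forall>T. antichain T \<and> S \<subseteq> T \<longrightarrow> T = S)"
  show "max_antichain S"
    unfolding max_antichain_def
  proof (intro conjI ballI)
    show "antichain S" using m by simp
    fix x assume x: "x \<in> F"
    show "\<exists>s\<in>S. le s x \<or> le x s"
    proof (rule ccontr)
      assume n: "\<not> (\<exists>s\<in>S. le s x \<or> le x s)"
      then have "antichain (insert x S)" using m x by (auto simp: antichain_def)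
      then have "insert x S = S" using m by blast
      then show False using n le_refl[OF x] by auto
    qed
  qed
qed

lemma max_antichain_nonempty: "F \<noteq> {} \<Longrightarrow> max_antichain S \<Longrightarrow> S \<noteq> {}"
  by (auto simp: max_antichain_def)

lemma labels_nontrivial:
  assumes "Q \<in> nontrivial_hypercubes R"
  shows "antichain (labels Q)" "labels Q \<noteq> {}"
  using assms labels_cube valid_antichain by (auto simp: nontrivial_iff)

text \<open>A larger cube has more labels, so a cube on a maximal antichain can only be contained in a cube
  on the same antichain, and this cube is unique.\<close>

lemma maximal_hypercube_iff:
  "Q \<in> maximal_hypercubes R \<longleftrightarrow> (\<exists>S. max_antichain S \<and> Q = cube (above S) S)"
proof
  assume Q: "Q \<in> maximal_hypercubes R"
  then obtain D0 S where v: "valid D0 S" "Q = cube D0 S"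
    by (auto simp: maximal_hypercubes_def is_hypercube_iff)
  have "max_antichain S"
  proof (rule ccontr)
    assume "\<not> max_antichain S"
    then obtain D1 t where t: "t \<in> F" "t \<notin> S" "valid D1 (insert t S)" "D1 \<subseteq> D0" "D0 \<union> S \<subseteq> D1 \<union> insert t S"
      using valid_extend[OF v(1)] by metis
    have "is_hypercube_of R (cube D1 (insert t S))" using t by (auto simp: is_hypercube_iff)
    then have eq: "cube D1 (insert t S) = cube D0 S"
      using Q v(2) cube_mono[OF t(4,5)] by (auto simp: maximal_hypercubes_def)
    then have "insert t S = S" using labels_cube[OF t(3)] labels_cube[OF v(1)] by simp
    then show False using t by auto
  qed
  then show "\<exists>S. max_antichain S \<and> Q = cube (above S) S" using v valid_max_antichain by blast
next
  assume "\<exists>S. max_antichain S \<and> Q = cube (above S) S"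
  then obtain S where S: "max_antichain S" "Q = cube (above S) S" by auto
  have v: "valid (above S) S" using S valid_above by (auto simp: max_antichain_def)
  have "Q' = Q" if Q': "is_hypercube_of R Q'" "subgraph Q Q'" for Q'
  proof -
    obtain D1 S' where w: "valid D1 S'" "Q' = cube D1 S'" using Q'(1) unfolding is_hypercube_iff by blast
    then have "S \<subseteq> S'" using cube_subgraph_labels[OF v w(1)] Q'(2) S by simp
    then have "S' = S" using S(1) valid_antichain[OF w(1)] by (simp add: max_antichain_iff)
    then show "Q' = Q" using w valid_max_antichain[OF w(1)] S by simp
  qed
  then show "Q \<in> maximal_hypercubes R"
    using v S(2) by (auto simp: maximal_hypercubes_def is_hypercube_iff)
qed

lemma maximal_nontrivial:
  assumes "F \<noteq> {}"
  shows "maximal_hypercubes R \<subseteq> nontrivial_hypercubes R"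
proof
  fix Q assume "Q \<in> maximal_hypercubes R"
  then obtain S where S: "max_antichain S" "Q = cube (above S) S" by (auto simp: maximal_hypercube_iff)
  then show "Q \<in> nontrivial_hypercubes R"
    using valid_above[of S] max_antichain_nonempty[OF assms S(1)] S by (auto simp: nontrivial_iff max_antichain_def)
qed

lemma labels_bij: "bij_betw labels (maximal_hypercubes R) {S. max_antichain S}"
proof -
  have l: "labels (cube (above S) S) = S" if "max_antichain S" for S
    using that labels_cube valid_above by (auto simp: max_antichain_def)
  have M: "maximal_hypercubes R = (\<lambda>S. cube (above S) S) ` {S. max_antichain S}"
    by (auto simp: maximal_hypercube_iff)
  show ?thesis unfolding M
    by (rule bij_betw_byWitness[where f' = "\<lambda>S. cube (above S) S"]) (auto simp: l)
qed

end

section \<open>Resonant sets are antichains\<close>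

context plane_extremal begin

sublocale poset: upset_graph "resonance_graph G" D "finite_faces G" face_le
proof
  show "finite (finite_faces G)" by (rule finite_finite_faces)
  show "face_le x x" for x by (rule face_le_refl)
  show "face_le x z" if "face_le x y" "face_le y z" for x y z using that by (rule face_le_trans)
  show "x = y" if "x \<in> finite_faces G" "y \<in> finite_faces G" "face_le x y" "face_le y x" for x y
    using that by (rule face_le_antisym)
  show "bij_betw D (verts (resonance_graph G)) {U. U \<subseteq> finite_faces G \<and>
      (\<forall>x\<in>U. \<forall>y\<in>finite_faces G. face_le x y \<longrightarrow> y \<in> U)}" (is "bij_betw D ?V ?U")
    unfolding bij_betw_def
  proof
    show "inj_on D ?V" using D_inj by (auto simp: inj_on_def resonance_graph_def)
    show "D ` ?V = ?U"
    proof
      show "D ` ?V \<subseteq> ?U"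
      proof
        fix U assume "U \<in> D ` ?V"
        then obtain M where M: "pm M" "U = D M" by (auto simp: resonance_graph_def)
        then show "U \<in> ?U" using D_sub D_up[OF M(1)] by blast
      qed
      show "?U \<subseteq> D ` ?V"
      proof
        fix U assume "U \<in> ?U"
        then have "\<exists>K. pm K \<and> D K = U" using upset_is_D[of U] by blast
        then show "U \<in> D ` ?V" by (auto simp: resonance_graph_def)
      qed
    qed
  qed
  show "edges (resonance_graph G) = {{M, N} | M N. M \<in> verts (resonance_graph G) \<and>
      N \<in> verts (resonance_graph G) \<and> (\<exists>s. sym_diff (D M) (D N) = {s})}"
    by (simp add: resonance_graph_def resonance_edge_iff)
qed

abbreviation circ :: "complex set \<Rightarrow> complex set set" where
  "circ s \<equiv> edges (periphery G s)"

abbreviation pverts :: "complex set \<Rightarrow> complex set" where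
  "pverts s \<equiv> verts (periphery G s)"

lemma circ_ends: "e \<in> circ s \<Longrightarrow> ends G e \<subseteq> pverts s"
  by (auto simp: periphery_def ends_def)

lemma ends_nonempty: "e \<in> edges G \<Longrightarrow> ends G e \<noteq> {}"
  using ends_AB by blast

lemma circ_edges: "circ s \<subseteq> edges G"
  by (auto simp: periphery_def)

lemma circ_disjoint:
  assumes "pverts s \<inter> pverts t = {}"
  shows "circ s \<inter> circ t = {}"
proof (rule ccontr)
  assume "circ s \<inter> circ t \<noteq> {}"
  then obtain e where e: "e \<in> circ s" "e \<in> circ t" by blast
  then have "ends G e \<noteq> {}" using circ_edges ends_nonempty by blast
  then show False using circ_ends[OF e(1)] circ_ends[OF e(2)] assms by blast
qed

text \<open>A resonant face is matched within its own boundary.\<close>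

lemma circuit_matching_edge:
  assumes s: "s \<in> finite_faces G" and M: "pm M" and E: "alt_circuit G M (circ s)"
    and k: "k \<in> M" "ends G k \<inter> pverts s \<noteq> {}"
  shows "k \<in> circ s"
  using alt_circuit_closed[OF E M k(1)] k(2) periphery_verts[OF s M E] by blast

lemma periphery_nonempty:
  assumes "alt_circuit G M (circ s)"
  shows "pverts s \<noteq> {}"
proof -
  obtain e where e: "e \<in> circ s" using alt_circuit_nonempty[OF assms] by blast
  then have "ends G e \<noteq> {}" using circ_edges ends_nonempty by blast
  then show ?thesis using circ_ends[OF e] by blast
qed

text \<open>Of the two up-sets before and after rotating \<open>s\<close>, one contains \<open>s\<close> and the other one does not,
  while they agree on \<open>x\<close>.\<close>

lemma flip_comparable:
  assumes s: "s \<in> finite_faces G" and M: "pm M" and E: "alt_circuit G M (circ s)" and x: "x \<noteq> s"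
  shows "face_le s x \<Longrightarrow> x \<in> D M" "face_le x s \<Longrightarrow> x \<notin> D M"
proof -
  have N: "pm (sym_diff M (circ s))" by (rule perfect_matching_flip[OF M E])
  have DN: "D (sym_diff M (circ s)) = sym_diff (D M) {s}" by (rule periphery_flip[OF s M E])
  show "x \<in> D M" if "face_le s x"
    using D_up[OF M _ that] D_up[OF N _ that] DN x by (cases "s \<in> D M") auto
  show "x \<notin> D M" if "face_le x s"
    using D_up[OF M _ that] D_up[OF N _ that] DN x by (cases "s \<in> D M") auto
qed

text \<open>The boundaries are disjoint, so each face stays resonant when another one is rotated; hence
  no face forces another one into an up-set.\<close>

lemma resonant_set_antichain:
  assumes "resonant_set G S"
  shows "poset.antichain S"
proof -
  have SF: "S \<subseteq> finite_faces G"
    and dis: "\<And>s t. s \<in> S \<Longrightarrow> t \<in> S \<Longrightarrow> s \<noteq> t \<Longrightarrow> pverts s \<inter> pverts t = {}"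
    using assms by (auto simp: resonant_set_def pairwise_def disjnt_def)
  obtain M where M: "pm M" "\<And>s. s \<in> S \<Longrightarrow> alt_circuit G M (circ s)"
    using assms resonant_face_circuit unfolding resonant_set_def by blast
  show ?thesis
    unfolding poset.antichain_def
  proof (intro conjI ballI impI SF)
    fix s t assume st: "s \<in> S" "t \<in> S" "face_le s t"
    show "s = t"
    proof (rule ccontr)
      assume ne: "s \<noteq> t"
      have F: "s \<in> finite_faces G" "t \<in> finite_faces G" using st SF by auto
      have N: "pm (sym_diff M (circ t))" by (rule perfect_matching_flip[OF M(1) M(2)[OF st(2)]])
      have "alt_circuit G (sym_diff M (circ t)) (circ s)"
        by (rule alt_circuit_cong[OF M(2)[OF st(1)]]) (use circ_disjoint[OF dis[OF st(1,2) ne]] in blast)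
      then have "t \<in> D (sym_diff M (circ t))" using flip_comparable(1)[OF F(1) N _ _ st(3)] ne by auto
      moreover have "t \<in> D M" using flip_comparable(1)[OF F(1) M(1) M(2)[OF st(1)] _ st(3)] ne by auto
      ultimately show False using periphery_flip[OF F(2) M(1) M(2)[OF st(2)]] by auto
    qed
  qed
qed

text \<open>The up-set of the elements above \<open>S\<close> can be enlarged by any member of \<open>S\<close>, so all of \<open>S\<close> is
  resonant for its matching.  Two of these faces have no common vertex: they would share the
  matching edge \<open>m\<close> at that vertex, and adding either of the two faces would remove \<open>m\<close>; but the
  two faces are on opposite sides of \<open>m\<close>, where the height jumps in opposite directions.\<close>

lemma antichain_resonant_set:
  assumes ac: "poset.antichain S"
  shows "resonant_set G S"
proof -
  have SF: "S \<subseteq> finite_faces G" using ac by (simp add: poset.antichain_def)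
  have v: "poset.valid (poset.above S) S" by (rule poset.valid_above[OF ac])
  have pmU: "\<exists>M. pm M \<and> D M = poset.above S \<union> U" if "U \<subseteq> S" for U
  proof -
    have "poset.upset (poset.above S \<union> U)" using v that by (simp add: poset.valid_def)
    then show ?thesis using poset.D_surj by (auto simp: resonance_graph_def)
  qed
  obtain M where M: "pm M" "D M = poset.above S" using pmU[of "{}"] by auto
  have Sab: "S \<inter> poset.above S = {}" by (auto simp: poset.above_def)
  have flip: "\<exists>N. pm N \<and> D N = D M \<union> {s} \<and> sym_diff M N = circ s \<and> alt_circuit G M (circ s)" if s: "s \<in> S" for s
  proof -
    obtain N where N: "pm N" "D N = D M \<union> {s}" using pmU[of "{s}"] s M by auto
    have "sym_diff (D M) (D N) = {s}" using N M(2) Sab s by auto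
    then show ?thesis using flip_periphery[OF M(1) N(1)] N by blast
  qed
  have "pverts s \<inter> pverts t = {}" if st: "s \<in> S" "t \<in> S" "s \<noteq> t" for s t
  proof (rule ccontr)
    assume "pverts s \<inter> pverts t \<noteq> {}"
    then obtain w where w: "w \<in> pverts s" "w \<in> pverts t" by blast
    obtain Ns where Ns: "pm Ns" "D Ns = D M \<union> {s}" "sym_diff M Ns = circ s" "alt_circuit G M (circ s)"
      using flip[OF st(1)] by blast
    obtain Nt where Nt: "pm Nt" "D Nt = D M \<union> {t}" "sym_diff M Nt = circ t" "alt_circuit G M (circ t)"
      using flip[OF st(2)] by blast
    have F: "s \<in> finite_faces G" "t \<in> finite_faces G" using st SF by auto
    have wG: "w \<in> verts G" using w by (simp add: periphery_def)
    define m where "m = medge M w"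
    have m: "m \<in> M" "w \<in> ends G m" "m \<in> edges G" using medge[OF M(1) wG] by (auto simp: m_def)
    have ms: "m \<in> circ s" "m \<in> circ t"
      using circuit_matching_edge[OF F(1) M(1) Ns(4) m(1)] circuit_matching_edge[OF F(2) M(1) Nt(4) m(1)] m(2) w by blast+
    then have mN: "m \<notin> Ns" "m \<notin> Nt" using m(1) Ns(3) Nt(3) by blast+
    have fr: "m \<subseteq> frontier s" "m \<subseteq> frontier t" using ms by (auto simp: periphery_def)
    have FF: "s \<in> faces G" "t \<in> faces G" using F by (auto simp: finite_faces_def)
    obtain a b where ab: "sides m a b" using edge_sides[OF m(3)] .
    have "s = a \<or> s = b" "t = a \<or> t = b" using sides_iff[OF ab] FF fr by auto
    then have "sides m s t" using ab sides_commute st(3) by blast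
    then have "hgt M Ns s - hgt M Ns t = hgt M Nt s - hgt M Nt t"
      using hgt_jump_sign[OF M(1) Ns(1) M(1) Nt(1) _ m(1) mN(1) m(1) mN(2)] by blast
    moreover have "s \<notin> D M" "t \<notin> D M" using st Sab M(2) by auto
    ultimately show False
      using hgt_D[OF M(1) Ns(1) FF(1)] hgt_D[OF M(1) Ns(1) FF(2)]
        hgt_D[OF M(1) Nt(1) FF(1)] hgt_D[OF M(1) Nt(1) FF(2)] Ns(2) Nt(2) st(3) by auto
  qed
  moreover have "resonant_face G M s" if s: "s \<in> S" for s
  proof -
    have sF: "s \<in> finite_faces G" using s SF by auto
    show ?thesis using flip[OF s] resonant_face_circuit[OF sF M(1)] by blast
  qed
  ultimately show ?thesis
    using SF M(1) unfolding resonant_set_def pairwise_def disjnt_def by blast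
qed

lemma resonant_set_iff: "resonant_set G S \<longleftrightarrow> poset.antichain S"
  using resonant_set_antichain antichain_resonant_set by blast

lemma maximal_resonant_set_iff: "maximal_resonant_set G S \<longleftrightarrow> poset.max_antichain S"
  by (simp add: maximal_resonant_set_def resonant_set_iff poset.max_antichain_iff)

lemma resonant_closed:
  assumes S: "S \<subseteq> finite_faces G" and M: "pm M" and E: "\<And>s. s \<in> S \<Longrightarrow> alt_circuit G M (circ s)"
    and k: "k \<in> M" "ends G k \<inter> (\<Union>s\<in>S. pverts s) \<noteq> {}"
  shows "ends G k \<subseteq> (\<Union>s\<in>S. pverts s)"
proof -
  obtain s where s: "s \<in> S" "ends G k \<inter> pverts s \<noteq> {}" using k(2) by blast
  have sF: "s \<in> finite_faces G" using S s(1) by auto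
  have "k \<in> circ s" by (rule circuit_matching_edge[OF sF M E[OF s(1)] k(1) s(2)])
  then show ?thesis using circ_ends s(1) by blast
qed

text \<open>Complete two matchings of the remaining graph by the same edges on the boundaries of \<open>S\<close>.  The
  direction in which a face of \<open>S\<close> can be rotated depends only on these edges, so the two up-sets
  agree on \<open>S\<close>; they agree elsewhere, because each face is above or below a member of \<open>S\<close> that can
  be rotated.\<close>

lemma maximal_imp_canonical:
  assumes "maximal_resonant_set G S"
  shows "canonical_resonant_set G S"
proof -
  have rs: "resonant_set G S" and ma: "poset.max_antichain S"
    using assms maximal_resonant_set_iff by (auto simp: maximal_resonant_set_def)
  then have SF: "S \<subseteq> finite_faces G" by (simp add: resonant_set_def)
  obtain M where M: "pm M" "\<And>s. s \<in> S \<Longrightarrow> alt_circuit G M (circ s)"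
    using rs resonant_face_circuit unfolding resonant_set_def by blast
  define X where "X = (\<Union>s\<in>S. pverts s)"
  have cl: "ends G k \<subseteq> X" if "k \<in> M" "ends G k \<inter> X \<noteq> {}" for k
    using resonant_closed[OF SF M] that unfolding X_def by blast
  let ?H = "delete_verts G X"
  have ex: "perfect_matching ?H {k \<in> M. ends G k \<inter> X = {}}" by (rule pm_delete_verts[OF M(1) cl])
  have "L1 = L2" if L: "perfect_matching ?H L1" "perfect_matching ?H L2" for L1 L2
  proof -
    let ?K = "\<lambda>L. L \<union> {k \<in> M. ends G k \<inter> X \<noteq> {}}"
    have avoid: "ends G k \<inter> X = {}" if "k \<in> L" "perfect_matching ?H L" for k L
      using that by (auto simp: perfect_matching_def delete_verts_def)
    have Kpm: "pm (?K L)" if "perfect_matching ?H L" for L by (rule pm_extend[OF M(1) cl that])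
    have agree: "k \<in> ?K L \<longleftrightarrow> k \<in> M" if "k \<in> circ s" "s \<in> S" "perfect_matching ?H L" for k s L
    proof -
      have "k \<in> edges G" using that(1) circ_edges by blast
      then have "ends G k \<noteq> {}" by (rule ends_nonempty)
      then have "ends G k \<inter> X \<noteq> {}" using circ_ends[OF that(1)] that(2) unfolding X_def by blast
      then show ?thesis using avoid[of k L] that(3) by blast
    qed
    have KE: "alt_circuit G (?K L) (circ s)" if "s \<in> S" "perfect_matching ?H L" for s L
      by (rule alt_circuit_cong[OF M(2)[OF that(1)]]) (use agree[OF _ that] in blast)
    have hgt_agree: "hgt (sym_diff (?K L1) (circ s)) (?K L1) s = hgt (sym_diff (?K L2) (circ s)) (?K L2) s"
      if s: "s \<in> S" for s
    proof -
      have sF: "s \<in> faces G" using s SF by (auto simp: finite_faces_def)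
      have eq: "circ s - ?K L1 = circ s - ?K L2" "circ s \<inter> ?K L1 = circ s \<inter> ?K L2"
        using agree[OF _ s L(1)] agree[OF _ s L(2)] by blast+
      note p1 = perfect_matching_flip[OF Kpm[OF L(1)] KE[OF s L(1)]]
      note p2 = perfect_matching_flip[OF Kpm[OF L(2)] KE[OF s L(2)]]
      show ?thesis
      proof (rule hgt_eqI[OF p1 Kpm[OF L(1)] sF])
        fix z assume z: "z \<in> s"
        have "height (sym_diff (?K L1) (circ s)) (?K L1) z = height (sym_diff (?K L2) (circ s)) (?K L2) z"
          using height_flip[OF Kpm[OF L(1)] KE[OF s L(1)], of z] height_flip[OF Kpm[OF L(2)] KE[OF s L(2)], of z]
          unfolding eq by (rule trans[OF _ sym])
        then show "height (sym_diff (?K L1) (circ s)) (?K L1) z = of_int (hgt (sym_diff (?K L2) (circ s)) (?K L2) s)"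
          using hgt[OF p2 Kpm[OF L(2)] sF z] by (rule trans)
      qed
    qed
    have inS: "s \<in> D (?K L1) \<longleftrightarrow> s \<in> D (?K L2)" if s: "s \<in> S" for s
    proof -
      have sF: "s \<in> finite_faces G" "s \<in> faces G" using s SF by (auto simp: finite_faces_def)
      have "hgt (sym_diff (?K L) (circ s)) (?K L) s = (if s \<in> D (?K L) then -1 else 1)"
        if "perfect_matching ?H L" for L
        using hgt_D[OF perfect_matching_flip[OF Kpm[OF that] KE[OF s that]] Kpm[OF that] sF(2)]
          periphery_flip[OF sF(1) Kpm[OF that] KE[OF s that]] by auto
      then show ?thesis using hgt_agree[OF s] L by (auto split: if_splits)
    qed
    have "x \<in> D (?K L1) \<longleftrightarrow> x \<in> D (?K L2)" if x: "x \<in> finite_faces G" for x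
    proof -
      obtain s where s: "s \<in> S" "face_le s x \<or> face_le x s" using ma x unfolding poset.max_antichain_def by blast
      have sF: "s \<in> finite_faces G" using s(1) SF by auto
      show ?thesis
      proof (cases "x = s")
        case True
        then show ?thesis using inS s(1) by simp
      next
        case False
        note f1 = flip_comparable[OF sF Kpm[OF L(1)] KE[OF s(1) L(1)] False]
        note f2 = flip_comparable[OF sF Kpm[OF L(2)] KE[OF s(1) L(2)] False]
        show ?thesis using s(2) f1 f2 by blast
      qed
    qed
    then have "D (?K L1) = D (?K L2)" using D_sub by blast
    then have K: "?K L1 = ?K L2" using D_inj Kpm L by blast
    have "L = {k \<in> ?K L. ends G k \<inter> X = {}}" if "perfect_matching ?H L" for L
      using avoid[OF _ that] by blast
    from this[OF L(1)] this[OF L(2)] K show "L1 = L2" by simp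
  qed
  then have "\<exists>!L. perfect_matching ?H L" using ex by blast
  then show ?thesis
    using rs unfolding canonical_resonant_set_def empty_or_unique_pm_def X_def by blast
qed

text \<open>Rotating a face \<open>t\<close> of a larger resonant set produces a second matching of the graph without
  \<open>S\<close>.\<close>

lemma canonical_imp_maximal:
  assumes "canonical_resonant_set G S"
  shows "maximal_resonant_set G S"
proof -
  have rs: "resonant_set G S" and un: "empty_or_unique_pm (delete_verts G (\<Union>s\<in>S. pverts s))"
    using assms by (auto simp: canonical_resonant_set_def)
  define X where "X = (\<Union>s\<in>S. pverts s)"
  have "T = S" if T: "resonant_set G T" "S \<subseteq> T" for T
  proof (rule ccontr)
    assume "T \<noteq> S"
    then obtain t where t: "t \<in> T" "t \<notin> S" using T(2) by blast
    have TF: "T \<subseteq> finite_faces G"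
      and dj: "pairwise (\<lambda>s t. disjnt (pverts s) (pverts t)) T"
      using T(1) by (auto simp: resonant_set_def)
    have dis: "pverts s \<inter> pverts t = {}" if "s \<in> S" for s
      using pairwiseD[OF dj, of s t] that t T(2) by (auto simp: disjnt_def)
    have SF: "S \<subseteq> finite_faces G" using TF T(2) by auto
    obtain M where M: "pm M" "\<And>s. s \<in> T \<Longrightarrow> alt_circuit G M (circ s)"
      using T(1) resonant_face_circuit unfolding resonant_set_def by blast
    note tE = M(2)[OF t(1)]
    let ?N = "sym_diff M (circ t)"
    have N: "pm ?N" by (rule perfect_matching_flip[OF M(1) tE])
    have ME: "alt_circuit G M (circ s)" if "s \<in> S" for s using M(2) T(2) that by blast
    have NE: "alt_circuit G ?N (circ s)" if "s \<in> S" for s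
      by (rule alt_circuit_cong[OF ME[OF that]]) (use circ_disjoint[OF dis[OF that]] in blast)
    have p: "perfect_matching (delete_verts G X) {k \<in> M. ends G k \<inter> X = {}}"
      "perfect_matching (delete_verts G X) {k \<in> ?N. ends G k \<inter> X = {}}"
      unfolding X_def
      by (rule pm_delete_verts[OF M(1) resonant_closed[OF SF M(1) ME]], assumption+)
        (rule pm_delete_verts[OF N resonant_closed[OF SF N NE]], assumption+)
    have Xt: "pverts t \<inter> X = {}" using dis unfolding X_def by blast
    obtain w where w: "w \<in> pverts t" using periphery_nonempty[OF tE] by blast
    then have "w \<in> verts (delete_verts G X)" using Xt by (auto simp: delete_verts_def periphery_def)
    then have eq: "{k \<in> M. ends G k \<inter> X = {}} = {k \<in> ?N. ends G k \<inter> X = {}}"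
      using un p unfolding X_def[symmetric] empty_or_unique_pm_def by blast
    obtain e where e: "e \<in> circ t" using alt_circuit_nonempty[OF tE] by blast
    then have "ends G e \<inter> X = {}" using circ_ends Xt by blast
    then show False using eq e by blast
  qed
  then show ?thesis using rs by (auto simp: maximal_resonant_set_def)
qed

lemma maximal_iff_canonical: "maximal_resonant_set G S \<longleftrightarrow> canonical_resonant_set G S"
  using maximal_imp_canonical canonical_imp_maximal by blast

lemma finite_faces_nonempty: "finite_faces G \<noteq> {}"
proof -
  obtain e where e: "e \<in> edges G" using edges_nonempty by blast
  obtain f g where "sides e f g" using edge_sides[OF e] .
  then have fg: "f \<in> faces G" "g \<in> faces G" "f \<noteq> g" by (auto simp: sides_def)
  show ?thesis
  proof (cases "f = F0")
    case True
    then have "g \<in> finite_faces G" using fg by (simp add: finite_faces_eq)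
    then show ?thesis by auto
  next
    case False
    then have "f \<in> finite_faces G" using fg by (simp add: finite_faces_eq)
    then show ?thesis by auto
  qed
qed

lemma Theta_face_labels_eq: "Theta_face_labels G Q = poset.labels Q"
proof -
  have "M \<in> verts (resonance_graph G) \<longleftrightarrow> pm M" for M by (simp add: resonance_graph_def)
  then have "edge_face_label G x s \<longleftrightarrow> poset.label x s" for x s
    by (simp add: edge_face_label_def poset.label_def resonance_edge_iff)
  then show ?thesis by (simp add: Theta_face_labels_def poset.labels_def)
qed

lemma hypercubes_and_resonant_sets:
  "Theta_face_labels G \<in> nontrivial_hypercubes (resonance_graph G) \<rightarrow> {S. resonant_set G S \<and> S \<noteq> {}}"
  "maximal_hypercubes (resonance_graph G) \<subseteq> nontrivial_hypercubes (resonance_graph G)"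
  "{S. maximal_resonant_set G S} \<subseteq> {S. resonant_set G S \<and> S \<noteq> {}}"
  "bij_betw (Theta_face_labels G) (maximal_hypercubes (resonance_graph G)) {S. maximal_resonant_set G S}"
proof -
  have eq: "Theta_face_labels G = poset.labels" using Theta_face_labels_eq by (rule ext)
  show "Theta_face_labels G \<in> nontrivial_hypercubes (resonance_graph G) \<rightarrow> {S. resonant_set G S \<and> S \<noteq> {}}"
    using poset.labels_nontrivial by (auto simp: eq resonant_set_iff)
  show "maximal_hypercubes (resonance_graph G) \<subseteq> nontrivial_hypercubes (resonance_graph G)"
    by (rule poset.maximal_nontrivial[OF finite_faces_nonempty])
  show "{S. maximal_resonant_set G S} \<subseteq> {S. resonant_set G S \<and> S \<noteq> {}}"
    using poset.max_antichain_nonempty[OF finite_faces_nonempty]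
    by (auto simp: maximal_resonant_set_iff resonant_set_iff poset.max_antichain_def)
  show "bij_betw (Theta_face_labels G) (maximal_hypercubes (resonance_graph G)) {S. maximal_resonant_set G S}"
    unfolding eq maximal_resonant_set_iff by (rule poset.labels_bij)
qed

end

section \<open>Graphs with an edge in every perfect matching\<close>

context bip_graph begin

text \<open>Any edge with an end in common with \<open>e\<close> lies in some perfect matching, together with \<open>e\<close>.\<close>

lemma unavoidable_edge:
  assumes e: "e \<in> edges G" "\<And>M. pm M \<Longrightarrow> e \<in> M"
    and allowed: "\<And>y. y \<in> edges G \<Longrightarrow> allowed_edge G y" and conn: "connected_graph G"
  shows "edges G = {e}" "verts G = ends G e"
proof -
  have share: "y = e" if y: "y \<in> edges G" "w \<in> ends G y" "w \<in> ends G e" for y w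
  proof -
    obtain N where "pm N" "y \<in> N" using allowed[OF y(1)] by (auto simp: allowed_edge_def)
    then show ?thesis using medge_eq[of N] e(2) y by metis
  qed
  obtain a b where ab: "a \<in> A" "b \<in> B" "ends G e = {a, b}" using ends_AB[OF e(1)] by blast
  have "w \<in> ends G e" if "(a, w) \<in> (adj G)\<^sup>*" for w
    using that
  proof (induction rule: rtrancl_induct)
    case (step u w)
    then obtain y where "y \<in> edges G" "ends G y = {u, w}" by (auto simp: adj_def)
    then show ?case using share[of y u] step.IH by auto
  qed (use ab in auto)
  moreover have aG: "a \<in> verts G" using ab AB by auto
  ultimately have *: "verts G \<subseteq> ends G e" using conn unfolding connected_graph_def by blast
  have "ends G e \<subseteq> verts G" by (simp add: ends_def)
  with * show v: "verts G = ends G e" by (rule equalityI)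
  show "edges G = {e}"
  proof
    show "edges G \<subseteq> {e}"
    proof
      fix y assume y: "y \<in> edges G"
      obtain w where w: "w \<in> ends G y" using ends_AB[OF y] by blast
      then have "w \<in> verts G" by (simp add: ends_def)
      then have "w \<in> ends G e" using v by metis
      then show "y \<in> {e}" using share[OF y w] by simp
    qed
  qed (use e in auto)
qed

lemma single_edge_iso_K2:
  assumes e: "edges G = {e}" "verts G = ends G e"
  shows "graph_iso G K2"
proof -
  obtain a b where ab: "a \<in> A" "b \<in> B" "ends G e = {a, b}" using ends_AB[of e] e(1) by blast
  have ne: "a \<noteq> b" using ab AB by auto
  define \<phi> where "\<phi> x = (x = b)" for x
  have "bij_betw \<phi> (verts G) (verts K2)"
    using ne unfolding e(2) ab(3) by (auto simp: bij_betw_def inj_on_def \<phi>_def K2_def)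
  moreover have "bij_betw (\<lambda>_. {False, True}) (edges G) (edges K2)"
    unfolding e(1) by (auto simp: bij_betw_def K2_def)
  moreover have "\<forall>y\<in>edges G. ends K2 {False, True} = \<phi> ` ends G y"
    using ne ab unfolding e(1) by (auto simp: ends_def K2_def \<phi>_def)
  ultimately show ?thesis unfolding graph_iso_def by blast
qed

end

text \<open>A cycle has at least two edges, so that no face is resonant.\<close>

lemma single_edge_maximal_iff_canonical:
  assumes e: "edges G = {e}" "verts G = ends G e" and M: "perfect_matching G M" and S: "resonant_set G S"
  shows "maximal_resonant_set G S \<longleftrightarrow> canonical_resonant_set G S"
proof -
  have only: "T = {}" if "resonant_set G T" for T
  proof (rule ccontr)
    assume "T \<noteq> {}"
    then obtain s N where "resonant_face G N s" using \<open>resonant_set G T\<close> by (auto simp: resonant_set_def)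
    then obtain n v c where c: "cycle_enum (periphery G s) n v c"
      by (auto simp: resonant_face_def alternating_cycle_def)
    have n: "2 \<le> n" and b: "bij_betw c {..<n} (edges (periphery G s))" using c by (auto simp: cycle_enum_def)
    then have "c 0 \<in> edges (periphery G s)" "c 1 \<in> edges (periphery G s)" by (auto simp: bij_betw_def)
    then have "c 0 = c 1" using e(1) by (simp add: periphery_def)
    moreover have "inj_on c {..<n}" using b by (simp add: bij_betw_def)
    ultimately show False using inj_onD[of c "{..<n}" 0 1] n by simp
  qed
  have "N = {e}" if N: "perfect_matching G N" "verts G \<noteq> {}" for N
  proof -
    have "N \<subseteq> {e}" using N(1) e(1) by (simp add: perfect_matching_def)
    moreover have "N \<noteq> {}" using N by (auto simp: perfect_matching_def)
    ultimately show ?thesis by auto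
  qed
  then have "empty_or_unique_pm G" using M unfolding empty_or_unique_pm_def by blast
  moreover have "delete_verts G {} = G" by (cases G) (simp add: delete_verts_def)
  ultimately have "empty_or_unique_pm (delete_verts G {})" by simp
  moreover have "S = {}" by (rule only[OF S])
  ultimately have "canonical_resonant_set G S" using S by (simp add: canonical_resonant_set_def)
  moreover have "maximal_resonant_set G S"
    using S only \<open>S = {}\<close> by (auto simp: maximal_resonant_set_def)
  ultimately show ?thesis by blast
qed

theorem theorem4:
  fixes G :: "complex graph" and F0 :: "complex set"
  assumes "plane_graph G" and "bipartite G" and "elementary G"
    and "F0 \<in> faces G" and "\<not> bounded F0" and "forcing_face G F0"
  shows "(\<forall>S. resonant_set G S \<longrightarrow> (maximal_resonant_set G S \<longleftrightarrow> canonical_resonant_set G S)) \<and>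
    (\<not> graph_iso G K2 \<longrightarrow>
       Theta_face_labels G \<in> nontrivial_hypercubes (resonance_graph G) \<rightarrow> {S. resonant_set G S \<and> S \<noteq> {}} \<and>
       maximal_hypercubes (resonance_graph G) \<subseteq> nontrivial_hypercubes (resonance_graph G) \<and>
       {S. maximal_resonant_set G S} \<subseteq> {S. resonant_set G S \<and> S \<noteq> {}} \<and>
       bij_betw (Theta_face_labels G)
         (maximal_hypercubes (resonance_graph G)) {S. maximal_resonant_set G S})"
proof -
  obtain A B where AB: "A \<union> B = verts G" "A \<inter> B = {}"
    "\<forall>e\<in>edges G. \<exists>a\<in>A. \<exists>b\<in>B. ends G e = {a, b}"
    using assms(2) by (auto simp: bipartite_def)
  interpret plane_bip G A B
    by unfold_locales (use AB assms(1) in \<open>auto simp: plane_graph_def\<close>)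
  obtain M where M: "perfect_matching G M"
    and ac: "connected_graph \<lparr>verts = verts G, edges = {e. allowed_edge G e}\<rparr>"
    using assms(3) by (auto simp: elementary_def)
  have allowed: "allowed_edge G e" if "e \<in> edges G" for e
    by (rule all_edges_allowed[OF M ac that])
  have "adj \<lparr>verts = verts G, edges = {e. allowed_edge G e}\<rparr> \<subseteq> adj G"
    by (auto simp: adj_def ends_def allowed_edge_def perfect_matching_def)
  then have conn: "connected_graph G"
    using ac rtrancl_mono[of "adj \<lparr>verts = verts G, edges = {e. allowed_edge G e}\<rparr>" "adj G"]
    unfolding connected_graph_def graph.simps by blast
  show ?thesis
  proof (cases "\<exists>e\<in>edges G. \<forall>N. perfect_matching G N \<longrightarrow> e \<in> N")
    case True
    then obtain e where e: "e \<in> edges G" "\<And>N. perfect_matching G N \<Longrightarrow> e \<in> N" by blast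
    note K = unavoidable_edge[OF e allowed conn]
    show ?thesis using single_edge_iso_K2[OF K] single_edge_maximal_iff_canonical[OF K M] by blast
  next
    case False
    have ne: "edges G \<noteq> {}"
    proof -
      obtain v where "v \<in> verts G" using conn by (auto simp: connected_graph_def)
      then show ?thesis using medge(3)[OF M] by blast
    qed
    interpret plane_elem G A B F0
    proof
      show "\<exists>M. pm M \<and> e \<in> M" if "e \<in> edges G" for e using allowed[OF that] by (simp add: allowed_edge_def)
      show "\<exists>M. pm M \<and> e \<notin> M" if "e \<in> edges G" for e using False that by blast
    qed (use conn ne assms in auto)
    obtain M0 M1 where "plane_extremal G A B F0 M0 M1"
    proof (rule extremal_matchings)
      fix M0 M1 assume *: "pm M0" "pm M1"
        "\<And>f. f \<in> faces G \<Longrightarrow> f \<noteq> F0 \<Longrightarrow> bounded f \<and> hgt M1 M0 f = 1"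
        "\<And>M f. pm M \<Longrightarrow> f \<in> faces G \<Longrightarrow> 0 \<le> hgt M M0 f \<and> hgt M M0 f \<le> hgt M1 M0 f"
      have "plane_extremal G A B F0 M0 M1" by unfold_locales (use * in blast)+
      then show thesis by (rule that)
    qed
    then interpret plane_extremal G A B F0 M0 M1 .
    show ?thesis using maximal_iff_canonical hypercubes_and_resonant_sets by blast
  qed
qed

end
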